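(* Let $D$ be the unit disk in $\mathbb{C}$. Suppose that $f\in L_2(D)$ has, in polar coordinates, an expansion of the form $$f(re^{i\theta})=\sum_{n=-\infty}^{M}f_n(r)e^{in\theta}$$ for some integer $M$, and that there is $l_0$ such that $\hat f_M(l)=\int_0^1 f_M(r)r^l\,dr\ne0$ for all integers $l>l_0$. If for some distribution $G\in\mathcal{E}'(D)$ the product $\mathcal{T}_G\mathcal{T}_f$ has finite rank, then $G$ has finite support. In particular, if $G$ is a function, then $G=0$.
   Context: $\mathcal{B}^2(D)$ is the Bergman space of analytic functions in $L_2(D)$ with respect to Lebesgue measure, $\mathbf{P}:L_2(D)\to\mathcal{B}^2(D)$ is the orthogonal projection and $P(z,w)$ is its integral kernel (the Bergman kernel). For $f\in L_2(D)$, the Toeplitz operator is $\mathcal{T}_fu=\mathbf{P}(fu)$, defined for those $u\in\mathcal{B}^2(D)$ with $fu\in L_2(D)$ (in particular for all polynomials and all bounded analytic $u$). $\mathcal{E}'(D)$ is the space of distributions with compact support in $D$; for $G\in\mathcal{E}'(D)$, the Toeplitz operator $\mathcal{T}_G$ on $\mathcal{B}^2(D)$ is $(\mathcal{T}_Gu)(z)=\langle G,P(z,\cdot)u(\cdot)\rangle$; equivalently, $(\mathcal{T}_Gu,v)=\langle G,u\bar v\rangle$ for $u,v\in\mathcal{B}^2(D)$. The product $\mathcal{T}_G\mathcal{T}_f$ is defined on the domain of $\mathcal{T}_f$. "$G$ is a function" means that $G$ is the regular distribution given by an integrable function with compact support in $D$. *)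

theory Defs
  imports "HOL-Analysis.Analysis" "HOL-Library.Function_Algebras"
begin

abbreviation disk :: "complex set" where
  "disk \<equiv> ball 0 1"

abbreviation disk_measure :: "complex measure" where
  "disk_measure \<equiv> lebesgue_on disk"


section \<open>The Bergman space, its projection and its kernel\<close>

definition L2_disk :: "(complex \<Rightarrow> complex) set" where
  "L2_disk = {f \<in> borel_measurable disk_measure.
     integrable disk_measure (\<lambda>z. (cmod (f z))\<^sup>2)}"

definition L2_inner :: "(complex \<Rightarrow> complex) \<Rightarrow> (complex \<Rightarrow> complex) \<Rightarrow> complex" where
  "L2_inner f g = (LINT z|disk_measure. f z * cnj (g z))"

text \<open>Elements of the Bergman space are represented by total functions that are 0 outside
  the disk, so that equality of functions is equality in the Bergman space.\<close>

definition bergman_space :: "(complex \<Rightarrow> complex) set" where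
  "bergman_space = {u \<in> L2_disk. u holomorphic_on disk \<and> (\<forall>z. z \<notin> disk \<longrightarrow> u z = 0)}"

definition bergman_proj :: "(complex \<Rightarrow> complex) \<Rightarrow> complex \<Rightarrow> complex" where
  "bergman_proj f = (THE g. g \<in> bergman_space \<and>
     (\<forall>v\<in>bergman_space. L2_inner (\<lambda>z. f z - g z) v = 0))"

text \<open>An integral kernel is determined by the operator only up to null sets.  The
  Bergman kernel is the representative that is antianalytic in its second variable.\<close>

definition bergman_kernel :: "complex \<Rightarrow> complex \<Rightarrow> complex" where
  "bergman_kernel = (THE P.
     (\<forall>z\<in>disk. (\<lambda>w. cnj (P z w)) \<in> bergman_space) \<and>
     (\<forall>z w. z \<notin> disk \<longrightarrow> P z w = 0) \<and>
     (\<forall>f\<in>L2_disk. \<forall>z\<in>disk. bergman_proj f z = (LINT w|disk_measure. P z w * f w)))"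


section \<open>Distributions with compact support\<close>

text \<open>Derivatives are real derivatives on the plane: \<open>dir_deriv 1\<close> and \<open>dir_deriv \<i>\<close> are
  the partial derivatives with respect to the real and imaginary part.\<close>

definition dir_deriv :: "complex \<Rightarrow> (complex \<Rightarrow> complex) \<Rightarrow> complex \<Rightarrow> complex" where
  "dir_deriv v \<phi> z = frechet_derivative \<phi> (at z) v"

primrec Ck_on :: "nat \<Rightarrow> complex set \<Rightarrow> (complex \<Rightarrow> complex) \<Rightarrow> bool" where
  "Ck_on 0 U \<phi> \<longleftrightarrow> continuous_on U \<phi>"
| "Ck_on (Suc k) U \<phi> \<longleftrightarrow> (\<forall>z\<in>U. \<phi> differentiable (at z)) \<and>
     Ck_on k U (dir_deriv 1 \<phi>) \<and> Ck_on k U (dir_deriv \<i> \<phi>)"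

definition smooth_functions :: "complex set \<Rightarrow> (complex \<Rightarrow> complex) set" where
  "smooth_functions U = {\<phi>. \<forall>k. Ck_on k U \<phi>}"

definition mixed_partial :: "nat \<Rightarrow> nat \<Rightarrow> (complex \<Rightarrow> complex) \<Rightarrow> complex \<Rightarrow> complex" where
  "mixed_partial a b \<phi> = (dir_deriv 1 ^^ a) ((dir_deriv \<i> ^^ b) \<phi>)"

text \<open>The space \<open>\<E>'(D)\<close> as the dual of \<open>C\<^sup>\<infinity>(D)\<close>: linear functionals on smooth functions on
  the disk that are continuous for uniform convergence of all derivatives on compact sets.
  Values of \<open>G\<close> on functions that are not smooth on the disk are irrelevant, and the bound forces
  \<open>G \<phi>\<close> to depend only on the restriction of \<open>\<phi>\<close> to the disk.\<close>

definition compact_distributions :: "((complex \<Rightarrow> complex) \<Rightarrow> complex) set" where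
  "compact_distributions = {G.
     (\<forall>\<phi>\<in>smooth_functions disk. \<forall>\<psi>\<in>smooth_functions disk.
        G (\<lambda>z. \<phi> z + \<psi> z) = G \<phi> + G \<psi>) \<and>
     (\<forall>c. \<forall>\<phi>\<in>smooth_functions disk. G (\<lambda>z. c * \<phi> z) = c * G \<phi>) \<and>
     (\<exists>K N C. compact K \<and> K \<noteq> {} \<and> K \<subseteq> disk \<and>
        (\<forall>\<phi>\<in>smooth_functions disk.
           cmod (G \<phi>) \<le> C * (\<Sum>a\<le>N. \<Sum>b\<le>N. SUP z\<in>K. cmod (mixed_partial a b \<phi> z))))}"

definition test_functions :: "complex set \<Rightarrow> (complex \<Rightarrow> complex) set" where
  "test_functions U = {\<phi> \<in> smooth_functions disk.
     \<exists>K. compact K \<and> K \<subseteq> U \<and> (\<forall>z\<in>disk - K. \<phi> z = 0)}"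

definition distr_support :: "((complex \<Rightarrow> complex) \<Rightarrow> complex) \<Rightarrow> complex set" where
  "distr_support G = disk - \<Union>{U. open U \<and> U \<subseteq> disk \<and> (\<forall>\<phi>\<in>test_functions U. G \<phi> = 0)}"

definition is_regular_distr ::
    "((complex \<Rightarrow> complex) \<Rightarrow> complex) \<Rightarrow> (complex \<Rightarrow> complex) \<Rightarrow> bool" where
  "is_regular_distr G g \<longleftrightarrow> integrable disk_measure g \<and>
     (\<exists>K. compact K \<and> K \<subseteq> disk \<and> (AE z in disk_measure. z \<notin> K \<longrightarrow> g z = 0)) \<and>
     (\<forall>\<phi>\<in>smooth_functions disk. G \<phi> = (LINT z|disk_measure. g z * \<phi> z))"


section \<open>Toeplitz operators and finite rank\<close>

definition toeplitz_domain :: "(complex \<Rightarrow> complex) \<Rightarrow> (complex \<Rightarrow> complex) set" where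
  "toeplitz_domain f = {u \<in> bergman_space. (\<lambda>z. f z * u z) \<in> L2_disk}"

definition toeplitz :: "(complex \<Rightarrow> complex) \<Rightarrow> (complex \<Rightarrow> complex) \<Rightarrow> complex \<Rightarrow> complex" where
  "toeplitz f u = bergman_proj (\<lambda>z. f z * u z)"

definition toeplitz_distr ::
    "((complex \<Rightarrow> complex) \<Rightarrow> complex) \<Rightarrow> (complex \<Rightarrow> complex) \<Rightarrow> complex \<Rightarrow> complex" where
  "toeplitz_distr G u z = (if z \<in> disk then G (\<lambda>w. bergman_kernel z w * u w) else 0)"

interpretation complex_fun: vector_space "\<lambda>(c::complex) (u::complex \<Rightarrow> complex) z. c * u z"
  by unfold_locales (auto simp: fun_eq_iff algebra_simps)

definition finite_rank_on ::
    "(complex \<Rightarrow> complex) set \<Rightarrow> ((complex \<Rightarrow> complex) \<Rightarrow> complex \<Rightarrow> complex) \<Rightarrow> bool" where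
  "finite_rank_on S T \<longleftrightarrow> (\<exists>B. finite B \<and> T ` S \<subseteq> complex_fun.span B)"


section \<open>Expansions in polar coordinates\<close>

definition polar_term :: "(real \<Rightarrow> complex) \<Rightarrow> int \<Rightarrow> complex \<Rightarrow> complex" where
  "polar_term h n z = h (cmod z) * cis (of_int n * Arg z)"

text \<open>The expansion \<open>f(r e\<^sup>i\<^sup>\<theta>) = \<Sum>\<^sub>n\<^sub>\<le>\<^sub>M f\<^sub>n(r) e\<^sup>i\<^sup>n\<^sup>\<theta>\<close> is an orthogonal series that converges
  in \<open>L\<^sub>2(D)\<close>.\<close>

definition polar_expansion ::
    "(complex \<Rightarrow> complex) \<Rightarrow> (int \<Rightarrow> real \<Rightarrow> complex) \<Rightarrow> int \<Rightarrow> bool" where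
  "polar_expansion f F M \<longleftrightarrow> (\<forall>n\<le>M. polar_term (F n) n \<in> L2_disk) \<and>
     ((\<lambda>N::nat. LINT z|disk_measure.
         (cmod (f z - (\<Sum>n = - int N..M. polar_term (F n) n z)))\<^sup>2) \<longlonglongrightarrow> 0)"

text \<open>Where the integral does not converge the value is 0; for square integrable \<open>polar_term h n\<close>
  this can only happen for \<open>l \<le> 0\<close>.\<close>

definition radial_moment :: "(real \<Rightarrow> complex) \<Rightarrow> int \<Rightarrow> complex" where
  "radial_moment h l = (LINT r|lebesgue_on {0<..<1}. h r * of_real (r powi l))"

end

(* Proof idea.  T_f maps z^m to a polynomial of degree exactly m + M for large m, because its
   leading coefficient is a nonzero multiple of a moment of f_M.  So the range of T_f on monomials has
   finite codimension in the polynomials, and the form B(p, q) = G(p(z) q(cnj z)) has finite rank: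
   B(p, q) = sum_i B(p, v_i) B(u_i, q) with B(u_i, v_j) = delta_ij.

   Insert exponentials: G(p(z) exp(s z) q(cnj z) exp(t cnj z)) = sum_i a_i(p; s) c_i(q; t) with a_i, c_i
   entire in s and t.  At t = - cnj s the two exponentials have a product of modulus 1, so the left side
   is polynomially bounded in s.  Consequently the entire functions
   det(a_i(p_j; s)) * cnj(det(c_i(v_j; - cnj s))) are polynomials whose degree is bounded independently
   of the p_j.  Replacing one u_k by p therefore gives linear maps from polynomials p into a
   finite-dimensional space; some Q /= 0 lies in the kernel of all of them, and Cramer's rule yields
   a_i(Q; s) = 0, that is B(Q p, q) = 0 for all p and q.

   So Q G annihilates all polynomials in z and cnj z, and by density in the C^k topology Q G = 0.  Hence
   the support of G lies in the zero set of Q; if G is a function g, then Q g = 0 almost everywhere. *)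

theory Submission
  imports Defs "HOL-Complex_Analysis.Complex_Analysis" "HOL-Real_Asymp.Real_Asymp"
    "Jordan_Normal_Form.Determinant"
begin

section \<open>Linear algebra\<close>

text \<open>The exponentials turn the finite sum for B into an identity between functions of complex
  parameters. Along t = - cnj s the exponent s z - cnj (s z) is purely imaginary, so growth in s
  comes only from the derivatives in the seminorm that bounds G; its finite order fixes one exponent
  for all p and q. The individual a_i and c_i may still grow exponentially. Only products of
  determinants are controlled, because det A * det B is the determinant of a matrix whose entries
  are the controlled sums. Conjugating the second determinant turns its dependence on cnj s into an
  entire dependence on s and leaves the modulus unchanged, so Liouville's theorem applies.
  Biorthogonality makes both determinants 1 at s = 0; hence Cramer's rule is available near 0, and
  vanishing near 0 is enough since the Taylor coefficients of a_i(Q; s) are B(Q z^j, v_i) / j!. In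
  the density step, smooth functions on the disk may have no extension across the circle; the
  functions approximated there are the compactly supported quotients phi / Q.\<close>

lemma homogeneous_system_nontrivial:
  fixes a :: "'i \<Rightarrow> 'j \<Rightarrow> 'a::field"
  assumes "finite I" "finite J" "card I < card J"
  shows "\<exists>c. (\<exists>j\<in>J. c j \<noteq> 0) \<and> (\<forall>i\<in>I. (\<Sum>j\<in>J. c j * a i j) = 0)"
  using assms
proof (induction I arbitrary: J a rule: finite_induct)
  case empty
  then obtain j where "j \<in> J" by (metis card.empty card_gt_0_iff ex_in_conv)
  then show ?case by (intro exI[of _ "\<lambda>_. 1"]) auto
next
  case (insert i I)
  show ?case
  proof (cases "\<forall>j\<in>J. a i j = 0")
    case True
    from insert.IH[of J a] insert.prems insert.hyps obtain c
      where "\<exists>j\<in>J. c j \<noteq> 0" "\<forall>i\<in>I. (\<Sum>j\<in>J. c j * a i j) = 0" by auto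
    with True show ?thesis by (intro exI[of _ c]) auto
  next
    case False
    \<comment> \<open>Equation \<open>i\<close> is solved for the unknown \<open>k\<close>, and the
      modified coefficients are those of the remaining equations after elimination. Both index sets
      lose one element, so the strict inequality of cardinalities survives.\<close>
    then obtain k where k: "k \<in> J" "a i k \<noteq> 0" by auto
    define J' where "J' = J - {k}"
    have J': "finite J'" "card I < card J'" "J = insert k J'" "k \<notin> J'"
      using insert.prems insert.hyps k by (auto simp: J'_def)
    from insert.IH[OF J'(1,2), of "\<lambda>l j. a l j - a l k * a i j / a i k"] obtain c where
      c: "\<exists>j\<in>J'. c j \<noteq> 0" "\<forall>l\<in>I. (\<Sum>j\<in>J'. c j * (a l j - a l k * a i j / a i k)) = 0" by auto
    define d where "d = (\<lambda>j. if j = k then - (\<Sum>j\<in>J'. c j * a i j) / a i k else c j)"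
    have sum: "(\<Sum>j\<in>J. d j * a l j) = - (\<Sum>j\<in>J'. c j * a i j) / a i k * a l k + (\<Sum>j\<in>J'. c j * a l j)" for l
    proof -
      have "(\<Sum>j\<in>J'. d j * a l j) = (\<Sum>j\<in>J'. c j * a l j)"
        using J'(4) by (intro sum.cong) (auto simp: d_def)
      then show ?thesis using J' by (simp add: d_def)
    qed
    have "(\<Sum>j\<in>J. d j * a i j) = 0" unfolding sum using k by simp
    moreover have "(\<Sum>j\<in>J. d j * a l j) = 0" if "l \<in> I" for l
    proof -
      have "0 = (\<Sum>j\<in>J'. c j * (a l j - a l k * a i j / a i k))" using c that by simp
      also have "\<dots> = (\<Sum>j\<in>J'. c j * a l j) - (\<Sum>j\<in>J'. c j * a i j) / a i k * a l k"
        by (simp add: sum_subtractf right_diff_distrib sum_divide_distrib sum_distrib_left mult_ac)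
      finally show ?thesis unfolding sum by simp
    qed
    moreover have "\<exists>j\<in>J. d j \<noteq> 0" using c(1) J' by (auto simp: d_def intro!: bexI)
    ultimately show ?thesis by (intro exI[of _ d]) auto
  qed
qed


text \<open>A biorthogonal system of maximal length does it: if the identity failed at some
  \<open>p\<close>, \<open>q\<close>, the residual parts of \<open>p\<close> and \<open>q\<close>
  would lengthen the system.\<close>

lemma biorthogonal_decomposition:
  fixes B :: "complex poly \<Rightarrow> complex poly \<Rightarrow> complex"
  assumes addl: "\<And>p p' q. B (p + p') q = B p q + B p' q" and scl: "\<And>c p q. B (Polynomial.smult c p) q = c * B p q"
    and addr: "\<And>p q q'. B p (q + q') = B p q + B p q'" and scr: "\<And>c p q. B p (Polynomial.smult c q) = c * B p q"
    and bound: "\<And>n u v. (\<And>i j. i < n \<Longrightarrow> j < n \<Longrightarrow> B (u i) (v j) = (if i = j then 1 else 0)) \<Longrightarrow> n \<le> (N::nat)"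
  obtains n :: nat and u v where
    "\<And>i j. i < n \<Longrightarrow> j < n \<Longrightarrow> B (u i) (v j) = (if i = j then 1 else 0)"
    "\<And>p q. B p q = (\<Sum>i<n. B p (v i) * B (u i) q)"
proof -
  have suml: "B (\<Sum>i\<in>A. Polynomial.smult (c i) (p i)) q = (\<Sum>i\<in>A. c i * B (p i) q)" if "finite A" for A :: "nat set" and c p q
    using that by (induction A rule: finite_induct) (auto simp: addl scl dest: sym[of 0] intro: trans[OF _ scl[of 0 0, simplified]])
  have sumr: "B p (\<Sum>i\<in>A. Polynomial.smult (c i) (q i)) = (\<Sum>i\<in>A. c i * B p (q i))" if "finite A" for A :: "nat set" and c p q
    using that by (induction A rule: finite_induct) (auto simp: addr scr intro: trans[OF _ scr[of _ 0 0, simplified]])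
  define P where "P n \<longleftrightarrow> (\<exists>u v. \<forall>i<n. \<forall>j<n. B (u i) (v j) = (if i = j then 1 else 0))" for n :: nat
  have "P 0" by (simp add: P_def)
  moreover have "\<forall>n. P n \<longrightarrow> n \<le> N" unfolding P_def using bound by blast
  ultimately obtain n where n: "P n" "\<And>m. P m \<Longrightarrow> m \<le> n"
    using Greatest_le_nat[of P] GreatestI_nat[of P 0 N] by metis
  then obtain u v where uv: "\<And>i j. i < n \<Longrightarrow> j < n \<Longrightarrow> B (u i) (v j) = (if i = j then 1 else 0)"
    unfolding P_def by blast
  have "B p q = (\<Sum>i<n. B p (v i) * B (u i) q)" for p q
  proof (rule ccontr)
    assume neq: "B p q \<noteq> (\<Sum>i<n. B p (v i) * B (u i) q)"
    \<comment> \<open>\<open>p'\<close> and \<open>q'\<close> are \<open>p\<close> and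
      \<open>q\<close> with their components along the system removed, a Gram-Schmidt step for a
      bilinear form. The number \<open>d\<close> is the value of the form on these residuals, and
      dividing by it normalises that value to 1.\<close>
    define d where "d = B p q - (\<Sum>i<n. B p (v i) * B (u i) q)"
    define p' where "p' = Polynomial.smult (1 / d) (p + (\<Sum>i<n. Polynomial.smult (- B p (v i)) (u i)))"
    define q' where "q' = q + (\<Sum>i<n. Polynomial.smult (- B (u i) q) (v i))"
    have d: "d \<noteq> 0" using neq by (simp add: d_def)
    have pv: "B p' (v j) = 0" if "j < n" for j
    proof -
      have "(\<Sum>i<n. - B p (v i) * B (u i) (v j)) = (\<Sum>i<n. if i = j then - B p (v j) else 0)"
        using uv that by (intro sum.cong) auto
      then show ?thesis using that by (simp add: p'_def addl scl suml sum.delta' del: smult_minus_left)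
    qed
    have uq: "B (u j) q' = 0" if "j < n" for j
    proof -
      have "(\<Sum>i<n. - B (u i) q * B (u j) (v i)) = (\<Sum>i<n. if i = j then - B (u j) q else 0)"
        using uv that by (intro sum.cong) auto
      then show ?thesis using that by (simp add: q'_def addr scr sumr sum.delta' del: smult_minus_left)
    qed
    have "B p' q' = B p' q"
      unfolding q'_def addr sumr[OF finite_lessThan] using pv by simp
    also have "\<dots> = (1 / d) * (B p q + (\<Sum>i<n. - B p (v i) * B (u i) q))"
      unfolding p'_def scl addl suml[OF finite_lessThan] by simp
    also have "\<dots> = 1" using d by (simp add: d_def sum_negf)
    finally have pq: "B p' q' = 1" .
    have "P (Suc n)" unfolding P_def
      by (rule exI[of _ "u(n := p')"], rule exI[of _ "v(n := q')"])
        (use uv pv uq pq in \<open>auto simp: less_Suc_eq\<close>)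
    from n(2)[OF this] show False by simp
  qed
  with uv that show ?thesis by blast
qed


text \<open>The product is the determinant of \<open>transpose_mat A * B\<close>, whose entries are
  exactly the sums in \<open>bd\<close>; the Leibniz formula has n! terms. No bound on the entries
  of \<open>A\<close> or \<open>B\<close> themselves enters, and in the application there is none of
  polynomial size.\<close>

lemma det_col_mult_det_bound:
  fixes A B :: "complex mat"
  assumes A: "A \<in> carrier_mat n n" and B: "B \<in> carrier_mat n n"
    and bd: "\<And>j l. j < n \<Longrightarrow> l < n \<Longrightarrow> cmod (\<Sum>i<n. A $$ (i,j) * B $$ (i,l)) \<le> K" and K: "K \<ge> 0"
  shows "cmod (Determinant.det A * Determinant.det B) \<le> fact n * K ^ n"
proof -
  let ?M = "transpose_mat A * B"
  have At: "transpose_mat A \<in> carrier_mat n n" using A by simp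
  have M: "?M \<in> carrier_mat n n" using At B by (rule mult_carrier_mat)
  have ent: "?M $$ (j,l) = (\<Sum>i<n. A $$ (i,j) * B $$ (i,l))" if "j < n" "l < n" for j l
    using A B that by (auto simp: scalar_prod_def lessThan_atLeast0 intro!: sum.cong)
  have "Determinant.det A * Determinant.det B = Determinant.det ?M"
    using det_mult[OF At B] det_transpose[OF A] by simp
  also have "\<dots> = (\<Sum>p\<in>{p. p permutes {0..<n}}. signof p * (\<Prod>i=0..<n. ?M $$ (i, p i)))"
    using det_def'[OF M] by simp
  also have "cmod \<dots> \<le> (\<Sum>p\<in>{p. p permutes {0..<n}}. K ^ n)"
  proof (rule sum_norm_le)
    fix p assume "p \<in> {p. p permutes {0..<n}}"
    then have p: "p permutes {0..<n}" by simp
    have "(\<Prod>i=0..<n. cmod (?M $$ (i, p i))) \<le> (\<Prod>i=0..<n. K)"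
    proof (rule prod_mono, safe)
      fix i assume "i \<in> {0..<n}"
      moreover have "p i \<in> {0..<n}" using p permutes_in_image[OF p] calculation by blast
      ultimately show "cmod (?M $$ (i, p i)) \<le> K" using ent bd by auto
    qed simp
    then show "cmod (signof p * (\<Prod>i=0..<n. ?M $$ (i, p i))) \<le> K ^ n"
      by (simp add: norm_mult prod_norm sign_def)
  qed
  also have "\<dots> = fact n * K ^ n" by (simp add: card_permutations)
  finally show ?thesis .
qed

text \<open>By Cramer's rule every coordinate of the solution of A x = b is a quotient with
  numerator 0, so x = 0 and b = A 0.\<close>

lemma cramer_all_zero:
  fixes A :: "complex mat"
  assumes A: "A \<in> carrier_mat n n" and b: "b \<in> carrier_vec n" and nz: "Determinant.det A \<noteq> 0"
    and z: "\<And>k. k < n \<Longrightarrow> Determinant.det (replace_col A b k) = 0"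
  shows "b = 0\<^sub>v n"
proof -
  obtain A' where A': "A' \<in> carrier_mat n n" "A * A' = 1\<^sub>m n"
    using det_non_zero_imp_unit[OF A nz, of ring_mat] A
    by (auto simp: Units_def ring_mat_def)
  define x where "x = A' *\<^sub>v b"
  have x: "x \<in> carrier_vec n" using A' b by (simp add: x_def)
  have Ax: "A *\<^sub>v x = b"
    unfolding x_def using assoc_mult_mat_vec[OF A A'(1) b] A'(2) b by simp
  have "vec_index x k = 0" if "k < n" for k
    using cramer_lemma_mat[OF A x that] z[OF that] nz by (simp add: Ax)
  then have "x = 0\<^sub>v n" using x by (intro eq_vecI) auto
  moreover have "A *\<^sub>v 0\<^sub>v n = 0\<^sub>v n" using A by (intro eq_vecI) auto
  ultimately show ?thesis using Ax by simp
qed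

lemma det_holomorphic:
  assumes "\<And>i j. i < n \<Longrightarrow> j < n \<Longrightarrow> (\<lambda>s. a i j s) holomorphic_on S"
  shows "(\<lambda>s. Determinant.det (mat n n (\<lambda>(i,j). a i j s))) holomorphic_on S"
proof -
  have eq: "Determinant.det (mat n n (\<lambda>(i,j). a i j s)) =
      (\<Sum>p\<in>{p. p permutes {0..<n}}. signof p * (\<Prod>i=0..<n. a i (p i) s))" for s
  proof -
    have "p i < n" if "p permutes {0..<n}" "i < n" for p i
      using permutes_in_image[OF that(1), of i] that(2) by simp
    then show ?thesis by (subst det_def'[where n=n]) (auto intro!: sum.cong prod.cong)
  qed
  have "p i < n" if "p permutes {0..<n}" "i < n" for p i
    using permutes_in_image[OF that(1), of i] that(2) by simp
  then show ?thesis unfolding eq by (intro holomorphic_intros assms) auto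
qed


text \<open>The analytic core, detached from distributions: \<alpha> and \<gamma> stand for the
  values of G on polynomials times one exponential. The exponent \<open>N\<close> in
  \<open>bound\<close> is common to all \<open>p\<close> and \<open>q\<close>, only the constant
  varies. This uniformity makes the dimension count possible.\<close>

lemma annihilating_polynomial:
  fixes \<alpha> \<gamma> :: "complex poly \<Rightarrow> nat \<Rightarrow> complex \<Rightarrow> complex" and u v :: "nat \<Rightarrow> complex poly"
  assumes add: "\<And>p q i s. \<alpha> (p + q) i s = \<alpha> p i s + \<alpha> q i s"
    and scl: "\<And>c p i s. \<alpha> (Polynomial.smult c p) i s = c * \<alpha> p i s"
    and hol\<alpha>: "\<And>p i. i < n \<Longrightarrow> \<alpha> p i holomorphic_on UNIV"
    and hol\<gamma>: "\<And>p i. i < n \<Longrightarrow> \<gamma> p i holomorphic_on UNIV"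
    and \<alpha>0: "\<And>i j. i < n \<Longrightarrow> j < n \<Longrightarrow> \<alpha> (u j) i 0 = (if i = j then 1 else 0)"
    and \<gamma>0: "\<And>i j. i < n \<Longrightarrow> j < n \<Longrightarrow> \<gamma> (v j) i 0 = (if i = j then 1 else 0)"
    and bound: "\<And>p q. \<exists>C. \<forall>s. cmod (\<Sum>i<n. \<alpha> p i s * \<gamma> q i (- cnj s)) \<le> C * (1 + cmod s) ^ N"
  obtains Q where "Q \<noteq> 0" "\<forall>\<^sub>F s in nhds 0. \<forall>i<n. \<alpha> Q i s = 0"
proof -
  define X where "X s = mat n n (\<lambda>(i,j). \<alpha> (u j) i s)" for s
  define Y where "Y t = mat n n (\<lambda>(i,j). \<gamma> (v j) i t)" for t
  define Xk where "Xk k p s = mat n n (\<lambda>(i,j). \<alpha> (if j = k then p else u j) i s)" for k p s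
  \<comment> \<open>t -> det Y(t) is entire, so s -> cnj (det Y(- cnj s)) is entire as well:
    conjugating argument and value preserves holomorphy.\<close>
  define Z where "Z s = cnj (Determinant.det (Y (- cnj s)))" for s
  define \<Theta> where "\<Theta> k p s = Determinant.det (Xk k p s) * Z s" for k p s
  \<comment> \<open>Each of the n factors in a Leibniz term contributes (1 + |s|)^N.\<close>
  define d where "d = N * n"
  have Xk_replace: "Xk k p s = replace_col (X s) (vec n (\<lambda>i. \<alpha> p i s)) k" for k p s
    by (rule eq_matI) (auto simp: Xk_def X_def replace_col_def)
  have "(\<lambda>t. Determinant.det (Y t)) holomorphic_on UNIV"
    unfolding Y_def by (rule det_holomorphic) (use hol\<gamma> in auto)
  then have "(\<lambda>s. Determinant.det (Y (- s))) holomorphic_on UNIV"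
    using holomorphic_on_compose_gen[of "\<lambda>s. - s" UNIV "\<lambda>t. Determinant.det (Y t)" UNIV]
      holomorphic_on_minus[OF holomorphic_on_ident, of UNIV]
    by (simp add: o_def)
  then have "(\<lambda>s. Determinant.det (Y (- s))) holomorphic_on cnj ` UNIV"
    by (rule holomorphic_on_subset) (rule subset_UNIV)
  from holomorphic_on_compose_cnj_cnj[OF this open_UNIV]
  have holZ: "Z holomorphic_on UNIV"
    unfolding Z_def[abs_def] o_def .
  have hol\<Theta>: "\<Theta> k p holomorphic_on UNIV" for k p
    unfolding \<Theta>_def[abs_def] Xk_def by (rule holomorphic_on_mult[OF det_holomorphic holZ]) (rule hol\<alpha>)
  have \<Theta>_bound: "\<exists>C. \<forall>s. cmod (\<Theta> k p s) \<le> C * (1 + cmod s) ^ d" for k p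
  proof -
    define w where "w j = (if j = k then p else u j)" for j
    define C where "C j l = (SOME C. \<forall>s. cmod (\<Sum>i<n. \<alpha> (w j) i s * \<gamma> (v l) i (- cnj s)) \<le> C * (1 + cmod s) ^ N)" for j l
    have C: "cmod (\<Sum>i<n. \<alpha> (w j) i s * \<gamma> (v l) i (- cnj s)) \<le> C j l * (1 + cmod s) ^ N" for j l s
      unfolding C_def using someI_ex[OF bound[of "w j" "v l"]] by blast
    define C' where "C' = (\<Sum>j<n. \<Sum>l<n. \<bar>C j l\<bar>)"
    have C': "C j l \<le> C'" if "j < n" "l < n" for j l
    proof -
      have "\<bar>C j l\<bar> \<le> (\<Sum>l<n. \<bar>C j l\<bar>)" using that by (intro member_le_sum) auto
      also have "\<dots> \<le> C'" unfolding C'_def using that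
        by (intro member_le_sum[of j "{..<n}" "\<lambda>j. \<Sum>l<n. \<bar>C j l\<bar>"]) (auto intro: sum_nonneg)
      finally show ?thesis by simp
    qed
    have "cmod (\<Theta> k p s) \<le> (fact n * C' ^ n) * (1 + cmod s) ^ d" for s
    proof -
      have "cmod (\<Theta> k p s) = cmod (Determinant.det (Xk k p s) * Determinant.det (Y (- cnj s)))"
        by (simp add: \<Theta>_def Z_def norm_mult)
      also have "\<dots> \<le> fact n * (C' * (1 + cmod s) ^ N) ^ n"
      proof (rule det_col_mult_det_bound)
        fix j l assume jl: "j < n" "l < n"
        have "cmod (\<Sum>i<n. Xk k p s $$ (i,j) * Y (- cnj s) $$ (i,l)) =
            cmod (\<Sum>i<n. \<alpha> (w j) i s * \<gamma> (v l) i (- cnj s))"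
          using jl by (intro arg_cong[of _ _ cmod] sum.cong) (auto simp: Xk_def Y_def w_def)
        also have "\<dots> \<le> C j l * (1 + cmod s) ^ N" by (rule C)
        also have "\<dots> \<le> C' * (1 + cmod s) ^ N" using C'[OF jl] by (intro mult_right_mono) auto
        finally show "cmod (\<Sum>i<n. Xk k p s $$ (i,j) * Y (- cnj s) $$ (i,l)) \<le> C' * (1 + cmod s) ^ N" .
      next
        show "0 \<le> C' * (1 + cmod s) ^ N" by (auto simp: C'_def intro!: mult_nonneg_nonneg sum_nonneg)
      qed (auto simp: Xk_def Y_def)
      also have "\<dots> = (fact n * C' ^ n) * (1 + cmod s) ^ d"
        by (simp add: power_mult_distrib d_def power_mult)
      finally show ?thesis .
    qed
    then show ?thesis by blast
  qed
  have \<Theta>_poly: "\<Theta> k p s = (\<Sum>j\<le>d. (deriv ^^ j) (\<Theta> k p) 0 / fact j * s ^ j)" for k p s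
  proof -
    obtain C where C: "\<And>s. cmod (\<Theta> k p s) \<le> C * (1 + cmod s) ^ d" using \<Theta>_bound by blast
    have C0: "C \<ge> 0" using order_trans[OF norm_ge_zero C[of 0]] by simp
    have "cmod (\<Theta> k p s) \<le> (C * 2 ^ d) * cmod s ^ d" if "1 \<le> cmod s" for s
    proof -
      have "(1 + cmod s) ^ d \<le> (2 * cmod s) ^ d" using that by (intro power_mono) auto
      then have "C * (1 + cmod s) ^ d \<le> C * (2 * cmod s) ^ d" using C0 by (rule mult_left_mono)
      with C[of s] show ?thesis by (simp add: power_mult_distrib)
    qed
    from Liouville_polynomial[OF hol\<Theta> this] show ?thesis .
  qed
  \<comment> \<open>Laplace expansion along column \<open>k\<close>: the cofactors omit that column
    and hence do not depend on \<open>p\<close>, so \<Theta> is linear in \<open>p\<close>.\<close>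
  have \<Theta>_lin: "\<Theta> k p s = (\<Sum>i<n. \<alpha> p i s * (cofactor (X s) i k * Z s))" if "k < n" for k p s
  proof -
    have "cofactor (Xk k p s) i k = cofactor (X s) i k" if "i < n" for i
      unfolding cofactor_def mat_delete_def
      by (intro arg_cong2[of _ _ _ _ "(*)"] arg_cong[of _ _ Determinant.det] refl eq_matI)
        (auto simp: Xk_def X_def)
    moreover have "Determinant.det (Xk k p s) = (\<Sum>i<n. Xk k p s $$ (i,k) * cofactor (Xk k p s) i k)"
      by (rule laplace_expansion_column[OF _ that]) (simp add: Xk_def)
    ultimately show ?thesis using that
      by (simp add: \<Theta>_def sum_distrib_right mult.assoc Xk_def)
  qed
  have \<alpha>_sum: "\<alpha> (\<Sum>m\<in>A. Polynomial.smult (c m) (p m)) i s = (\<Sum>m\<in>A. c m * \<alpha> (p m) i s)"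
    if "finite A" for A :: "nat set" and c p i s
    using that
    by (induction A rule: finite_induct) (auto simp: add scl intro: trans[OF _ scl[of 0 0, simplified]])
  \<comment> \<open>\<open>I\<close> lists the n(d+1) coefficients of all the polynomials \<Theta>
    k; \<open>J\<close> offers one monomial more than that.\<close>
  define J where "J = {..n * Suc d}"
  define I where "I = {..<n} \<times> {..d}"
  obtain c where c: "\<exists>m\<in>J. c m \<noteq> 0"
    "\<And>k j. k < n \<Longrightarrow> j \<le> d \<Longrightarrow> (\<Sum>m\<in>J. c m * ((deriv ^^ j) (\<Theta> k (monom 1 m)) 0 / fact j)) = 0"
    using homogeneous_system_nontrivial[of I J "\<lambda>(k,j) m. (deriv ^^ j) (\<Theta> k (monom 1 m)) 0 / fact j"]
    by (auto simp: I_def J_def)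
  define Q where "Q = (\<Sum>m\<in>J. Polynomial.smult (c m) (monom 1 m))"
  have "finite J" by (simp add: J_def)
  have Q0: "Q \<noteq> 0"
  proof -
    obtain m where m: "m \<in> J" "c m \<noteq> 0" using c by blast
    have "coeff Q m = (\<Sum>l\<in>J. if l = m then c m else 0)"
      unfolding Q_def coeff_sum by (intro sum.cong) (auto simp: smult_monom)
    also have "\<dots> = c m" using m \<open>finite J\<close> by (simp add: sum.delta')
    finally show ?thesis using m by auto
  qed
  have \<Theta>Q: "\<Theta> k Q s = 0" if k: "k < n" for k s
  proof -
    have "\<Theta> k Q s = (\<Sum>i<n. \<Sum>m\<in>J. c m * (\<alpha> (monom 1 m) i s * (cofactor (X s) i k * Z s)))"
      unfolding \<Theta>_lin[OF k] Q_def \<alpha>_sum[OF \<open>finite J\<close>] by (simp add: sum_distrib_right mult.assoc)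
    also have "\<dots> = (\<Sum>m\<in>J. c m * \<Theta> k (monom 1 m) s)"
      unfolding \<Theta>_lin[OF k] sum_distrib_left by (rule sum.swap)
    also have "\<dots> = (\<Sum>m\<in>J. \<Sum>j\<le>d. c m * ((deriv ^^ j) (\<Theta> k (monom 1 m)) 0 / fact j) * s ^ j)"
      by (subst \<Theta>_poly) (simp add: sum_distrib_left mult.assoc)
    also have "\<dots> = (\<Sum>j\<le>d. (\<Sum>m\<in>J. c m * ((deriv ^^ j) (\<Theta> k (monom 1 m)) 0 / fact j)) * s ^ j)"
      by (subst sum.swap) (simp add: sum_distrib_right)
    also have "\<dots> = 0" using c(2)[OF k] by simp
    finally show ?thesis .
  qed
  \<comment> \<open>\<open>W\<close> is nonzero at 0 by biorthogonality, hence near 0, and this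
    makes both \<open>X s\<close> invertible and \<open>Z s\<close> cancellable there.\<close>
  define W where "W s = Determinant.det (X s) * Z s" for s
  have "X 0 = 1\<^sub>m n" "Y 0 = 1\<^sub>m n" by (auto simp: X_def Y_def \<alpha>0 \<gamma>0 intro!: eq_matI)
  then have W0: "W 0 = 1" by (simp add: W_def Z_def)
  have "W holomorphic_on UNIV"
    unfolding W_def[abs_def] X_def by (rule holomorphic_on_mult[OF det_holomorphic holZ]) (rule hol\<alpha>)
  then have "continuous_on UNIV W" by (rule holomorphic_on_imp_continuous_on)
  then have "open (W -` (- {0}))" by (rule open_vimage[rotated]) auto
  then have "\<forall>\<^sub>F s in nhds 0. W s \<noteq> 0"
    using W0 by (auto simp: eventually_nhds intro!: exI[of _ "W -` (- {0})"])
  then have "\<forall>\<^sub>F s in nhds 0. \<forall>i<n. \<alpha> Q i s = 0"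
  proof eventually_elim
    case (elim s)
    then have nz: "Determinant.det (X s) \<noteq> 0" "Z s \<noteq> 0" by (auto simp: W_def)
    have "Determinant.det (replace_col (X s) (vec n (\<lambda>i. \<alpha> Q i s)) k) = 0" if "k < n" for k
      using \<Theta>Q[OF that, of s] nz by (simp add: \<Theta>_def Xk_replace)
    then have "vec n (\<lambda>i. \<alpha> Q i s) = 0\<^sub>v n"
      by (intro cramer_all_zero[OF _ _ nz(1)]) (auto simp: X_def)
    then show ?case by (metis index_vec index_zero_vec(1))
  qed
  with Q0 that show ?thesis by blast
qed

section \<open>Smooth functions on the plane\<close>

lemma dir_deriv_eq: "(\<phi> has_derivative D) (at z) \<Longrightarrow> dir_deriv v \<phi> z = D v"
  unfolding dir_deriv_def by (metis frechet_derivative_at)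

lemma has_derivative_dir_deriv:
  "\<phi> differentiable (at z) \<Longrightarrow> (\<phi> has_derivative (\<lambda>v. dir_deriv v \<phi> z)) (at z)"
  unfolding dir_deriv_def by (simp add: frechet_derivative_works)

lemma has_derivative_cong_open:
  fixes \<phi> \<psi> :: "complex \<Rightarrow> complex"
  assumes "open U" "z \<in> U" "\<And>w. w \<in> U \<Longrightarrow> \<phi> w = \<psi> w"
  shows "(\<phi> has_derivative D) (at z) \<longleftrightarrow> (\<psi> has_derivative D) (at z)"
  using has_derivative_transform_within_open[of \<phi> D z UNIV U \<psi>]
    has_derivative_transform_within_open[of \<psi> D z UNIV U \<phi>] assms by auto

lemma dir_deriv_cong:
  assumes "open U" "z \<in> U" "\<And>w. w \<in> U \<Longrightarrow> \<phi> w = \<psi> w"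
  shows "dir_deriv v \<phi> z = dir_deriv v \<psi> z"
  unfolding dir_deriv_def frechet_derivative_def using has_derivative_cong_open[OF assms] by simp

lemma Ck_on_cong:
  assumes "open U" "\<And>w. w \<in> U \<Longrightarrow> \<phi> w = \<psi> w"
  shows "Ck_on k U \<phi> \<longleftrightarrow> Ck_on k U \<psi>"
  using assms(2)
proof (induction k arbitrary: \<phi> \<psi>)
  case 0
  then show ?case by (simp cong: continuous_on_cong)
next
  case (Suc k)
  have "dir_deriv v \<phi> w = dir_deriv v \<psi> w" if "w \<in> U" for v w
    by (rule dir_deriv_cong[OF assms(1) that Suc.prems])
  then have "Ck_on k U (dir_deriv v \<phi>) \<longleftrightarrow> Ck_on k U (dir_deriv v \<psi>)" for v
    by (rule Suc.IH)
  moreover have "\<phi> differentiable (at z) \<longleftrightarrow> \<psi> differentiable (at z)" if "z \<in> U" for z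
    unfolding differentiable_def by (intro ex_cong1 has_derivative_cong_open[OF assms(1) that Suc.prems])
  ultimately show ?case unfolding Ck_on.simps(2) by blast
qed

lemma dir_deriv_pow_cong:
  assumes "open U" "\<And>w. w \<in> U \<Longrightarrow> \<phi> w = \<psi> w" "z \<in> U"
  shows "(dir_deriv v ^^ a) \<phi> z = (dir_deriv v ^^ a) \<psi> z"
  using assms(3)
proof (induction a arbitrary: z)
  case (Suc a)
  have "dir_deriv v ((dir_deriv v ^^ a) \<phi>) z = dir_deriv v ((dir_deriv v ^^ a) \<psi>) z"
    by (rule dir_deriv_cong[OF assms(1) Suc.prems Suc.IH])
  then show ?case by simp
qed (use assms in simp)

lemma mixed_partial_cong:
  assumes "open U" "\<And>w. w \<in> U \<Longrightarrow> \<phi> w = \<psi> w" "z \<in> U"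
  shows "mixed_partial a b \<phi> z = mixed_partial a b \<psi> z"
  unfolding mixed_partial_def
  by (rule dir_deriv_pow_cong[OF assms(1) _ assms(3)], rule dir_deriv_pow_cong[OF assms(1)]) (use assms in auto)

text \<open>Needed in the product rule, where the undifferentiated factors enter with one order of
  smoothness less than assumed.\<close>

lemma Ck_on_SucD: "Ck_on (Suc k) U \<phi> \<Longrightarrow> Ck_on k U \<phi>"
proof (induction k arbitrary: \<phi>)
  case 0
  then show ?case
    by (auto intro!: continuous_at_imp_continuous_on differentiable_imp_continuous_within)
next
  case (Suc k)
  from Suc.prems have "Ck_on (Suc k) U (dir_deriv 1 \<phi>)" "Ck_on (Suc k) U (dir_deriv \<i> \<phi>)"
    and diff: "\<forall>z\<in>U. \<phi> differentiable (at z)"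
    unfolding Ck_on.simps(2)[of "Suc k"] by blast+
  then have "Ck_on k U (dir_deriv 1 \<phi>)" "Ck_on k U (dir_deriv \<i> \<phi>)" using Suc.IH by blast+
  with diff show ?case unfolding Ck_on.simps(2) by blast
qed

lemma smooth_Ck: "\<phi> \<in> smooth_functions U \<Longrightarrow> Ck_on k U \<phi>"
  by (simp add: smooth_functions_def)

lemma smooth_dir_deriv:
  assumes "\<phi> \<in> smooth_functions U"
  shows "dir_deriv 1 \<phi> \<in> smooth_functions U" "dir_deriv \<i> \<phi> \<in> smooth_functions U"
  using smooth_Ck[OF assms, of "Suc _"] by (simp_all add: smooth_functions_def)

lemma smooth_differentiable: "\<phi> \<in> smooth_functions U \<Longrightarrow> z \<in> U \<Longrightarrow> \<phi> differentiable (at z)"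
  using smooth_Ck[of \<phi> U "Suc 0"] by simp

lemma smooth_continuous: "\<phi> \<in> smooth_functions U \<Longrightarrow> continuous_on U \<phi>"
  using smooth_Ck[of \<phi> U 0] by simp

lemma smooth_cong:
  "open U \<Longrightarrow> (\<And>w. w \<in> U \<Longrightarrow> \<phi> w = \<psi> w) \<Longrightarrow> \<phi> \<in> smooth_functions U \<longleftrightarrow> \<psi> \<in> smooth_functions U"
  unfolding smooth_functions_def using Ck_on_cong[of U \<phi> \<psi>] by auto

lemma Ck_on_subset: "Ck_on k U \<phi> \<Longrightarrow> V \<subseteq> U \<Longrightarrow> Ck_on k V \<phi>"
  by (induction k arbitrary: \<phi>) (auto intro: continuous_on_subset)

lemma smooth_subset: "\<phi> \<in> smooth_functions U \<Longrightarrow> V \<subseteq> U \<Longrightarrow> \<phi> \<in> smooth_functions V"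
  unfolding smooth_functions_def using Ck_on_subset by blast

lemma Ck_on_Un: "open U \<Longrightarrow> open V \<Longrightarrow> Ck_on k U \<phi> \<Longrightarrow> Ck_on k V \<phi> \<Longrightarrow> Ck_on k (U \<union> V) \<phi>"
  by (induction k arbitrary: \<phi>) (auto intro: continuous_on_open_Un)

lemma smooth_Un: "open U \<Longrightarrow> open V \<Longrightarrow> \<phi> \<in> smooth_functions U \<Longrightarrow> \<phi> \<in> smooth_functions V
    \<Longrightarrow> \<phi> \<in> smooth_functions (U \<union> V)"
  unfolding smooth_functions_def using Ck_on_Un by blast

lemma dir_deriv_add:
  assumes "\<phi> differentiable (at z)" "\<psi> differentiable (at z)"
  shows "dir_deriv v (\<lambda>z. \<phi> z + \<psi> z) z = dir_deriv v \<phi> z + dir_deriv v \<psi> z"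
  by (rule dir_deriv_eq) (intro has_derivative_add has_derivative_dir_deriv assms)

lemma dir_deriv_mult:
  assumes "\<phi> differentiable (at z)" "\<psi> differentiable (at z)"
  shows "dir_deriv v (\<lambda>z. \<phi> z * \<psi> z) z = \<phi> z * dir_deriv v \<psi> z + dir_deriv v \<phi> z * \<psi> z"
  by (rule dir_deriv_eq) (intro has_derivative_mult has_derivative_dir_deriv assms)

lemma Ck_on_add:
  assumes "open U" "Ck_on k U \<phi>" "Ck_on k U \<psi>"
  shows "Ck_on k U (\<lambda>z. \<phi> z + \<psi> z)"
  using assms(2,3)
proof (induction k arbitrary: \<phi> \<psi>)
  case 0
  then show ?case by (auto intro: continuous_intros)
next
  case (Suc k)
  have "Ck_on k U (dir_deriv v (\<lambda>z. \<phi> z + \<psi> z)) \<longleftrightarrow> Ck_on k U (\<lambda>z. dir_deriv v \<phi> z + dir_deriv v \<psi> z)" for v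
    using Suc.prems by (intro Ck_on_cong[OF assms(1)] dir_deriv_add) auto
  then show ?case using Suc.prems Suc.IH by auto
qed

lemma Ck_on_mult:
  assumes "open U" "Ck_on k U \<phi>" "Ck_on k U \<psi>"
  shows "Ck_on k U (\<lambda>z. \<phi> z * \<psi> z)"
  using assms(2,3)
proof (induction k arbitrary: \<phi> \<psi>)
  case 0
  then show ?case by (auto intro: continuous_intros)
next
  case (Suc k)
  have "Ck_on k U (dir_deriv v (\<lambda>z. \<phi> z * \<psi> z)) \<longleftrightarrow>
      Ck_on k U (\<lambda>z. \<phi> z * dir_deriv v \<psi> z + dir_deriv v \<phi> z * \<psi> z)" for v
    using Suc.prems by (intro Ck_on_cong[OF assms(1)] dir_deriv_mult) auto
  moreover have "Ck_on k U (\<lambda>z. \<phi> z * dir_deriv v \<psi> z + dir_deriv v \<phi> z * \<psi> z)" if "v = 1 \<or> v = \<i>" for v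
    using that Suc.prems Suc.IH Ck_on_SucD[OF Suc.prems(1)] Ck_on_SucD[OF Suc.prems(2)]
    by (intro Ck_on_add assms(1)) auto
  ultimately show ?case using Suc.prems by auto
qed

lemma smooth_add: "open U \<Longrightarrow> \<phi> \<in> smooth_functions U \<Longrightarrow> \<psi> \<in> smooth_functions U
    \<Longrightarrow> (\<lambda>z. \<phi> z + \<psi> z) \<in> smooth_functions U"
  unfolding smooth_functions_def using Ck_on_add by blast

lemma smooth_mult: "open U \<Longrightarrow> \<phi> \<in> smooth_functions U \<Longrightarrow> \<psi> \<in> smooth_functions U
    \<Longrightarrow> (\<lambda>z. \<phi> z * \<psi> z) \<in> smooth_functions U"
  unfolding smooth_functions_def using Ck_on_mult by blast

text \<open>Along \<open>v\<close> the real derivative of a holomorphic function is \<open>v\<close>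
  times the complex one, again holomorphic, so the induction runs over all \<open>h\<close>.\<close>

lemma Ck_on_holomorphic:
  assumes "open U" "h holomorphic_on U"
  shows "Ck_on k U h"
  using assms(2)
proof (induction k arbitrary: h)
  case 0
  then show ?case by (simp add: holomorphic_on_imp_continuous_on)
next
  case (Suc k)
  have der: "(h has_derivative (\<lambda>v. deriv h z * v)) (at z)" if "z \<in> U" for z
    using holomorphic_derivI[OF Suc.prems assms(1) that] by (simp add: has_field_derivative_def)
  have dd: "dir_deriv v h z = v * deriv h z" if "z \<in> U" for v z
    unfolding dir_deriv_eq[OF der[OF that]] by (rule mult.commute)
  have "Ck_on k U (dir_deriv v h)" for v
  proof -
    have "Ck_on k U (\<lambda>z. v * deriv h z)"
      by (rule Suc.IH, rule holomorphic_on_mult[OF holomorphic_on_const holomorphic_deriv[OF Suc.prems assms(1)]])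
    then show ?thesis using Ck_on_cong[OF assms(1), of "dir_deriv v h" "\<lambda>z. v * deriv h z"] dd by blast
  qed
  moreover have "\<forall>z\<in>U. h differentiable (at z)" using der unfolding differentiable_def by blast
  ultimately show ?case by simp
qed

lemma smooth_holomorphic: "open U \<Longrightarrow> h holomorphic_on U \<Longrightarrow> h \<in> smooth_functions U"
  unfolding smooth_functions_def using Ck_on_holomorphic by blast

lemma has_derivative_antiholomorphic:
  assumes "open V" "k holomorphic_on V" "cnj z \<in> V"
  shows "((\<lambda>z. k (cnj z)) has_derivative (\<lambda>v. deriv k (cnj z) * cnj v)) (at z)"
proof -
  have *: "(k has_derivative (\<lambda>v. deriv k (cnj z) * v)) (at (cnj z))"
    using holomorphic_derivI[OF assms(2,1,3)] by (simp add: has_field_derivative_def)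
  show ?thesis
    by (rule has_derivative_compose[OF bounded_linear_imp_has_derivative[OF bounded_linear_cnj] *])
qed

text \<open>The derivative along \<open>v\<close> is \<open>cnj v * deriv k (cnj z)\<close>, which
  has the same shape with \<open>deriv k\<close> in place of \<open>k\<close>.\<close>

lemma Ck_on_antiholomorphic:
  assumes "open V" "k holomorphic_on V" "open U" "\<And>z. z \<in> U \<Longrightarrow> cnj z \<in> V"
  shows "Ck_on n U (\<lambda>z. k (cnj z))"
  using assms(2)
proof (induction n arbitrary: k)
  case 0
  have "continuous_on V k" using 0 by (rule holomorphic_on_imp_continuous_on)
  then show ?case using assms(4) unfolding Ck_on.simps(1)
    by (intro continuous_on_compose2[OF _ continuous_on_cnj[OF continuous_on_id]]) auto
next
  case (Suc n)
  note der = has_derivative_antiholomorphic[OF assms(1) Suc.prems assms(4)]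
  have dd: "dir_deriv v (\<lambda>z. k (cnj z)) z = (\<lambda>z. cnj v * deriv k z) (cnj z)" if "z \<in> U" for v z
    unfolding dir_deriv_eq[OF der[OF that]] by (rule mult.commute)
  have "Ck_on n U (dir_deriv v (\<lambda>z. k (cnj z)))" for v
  proof -
    have "Ck_on n U (\<lambda>z. cnj v * deriv k (cnj z))"
      by (rule Suc.IH, rule holomorphic_on_mult[OF holomorphic_on_const holomorphic_deriv[OF Suc.prems assms(1)]])
    then show ?thesis
      using Ck_on_cong[OF assms(3), of "dir_deriv v (\<lambda>z. k (cnj z))" "\<lambda>z. cnj v * deriv k (cnj z)"] dd by blast
  qed
  moreover have "\<forall>z\<in>U. (\<lambda>z. k (cnj z)) differentiable (at z)" using der unfolding differentiable_def by blast
  ultimately show ?case by simp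
qed

lemma smooth_antiholomorphic:
  "open V \<Longrightarrow> k holomorphic_on V \<Longrightarrow> open U \<Longrightarrow> (\<And>z. z \<in> U \<Longrightarrow> cnj z \<in> V) \<Longrightarrow> (\<lambda>z. k (cnj z)) \<in> smooth_functions U"
  unfolding smooth_functions_def using Ck_on_antiholomorphic by blast

lemma smooth_const: "open U \<Longrightarrow> (\<lambda>_. c) \<in> smooth_functions U"
  by (rule smooth_holomorphic) auto

lemma smooth_cmult: "open U \<Longrightarrow> \<phi> \<in> smooth_functions U \<Longrightarrow> (\<lambda>z. c * \<phi> z) \<in> smooth_functions U"
  by (intro smooth_mult smooth_const)

text \<open>A list of triples \<open>(c, m, n)\<close> encodes the differential operator
  \<open>\<Sum> c \<partial>\<^sup>m \<partial>\<^sup>n\<close> (in the complex derivatives) applied to \<open>h(z) k(cnj z)\<close>.\<close>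

definition hk_sum :: "(complex \<times> nat \<times> nat) list \<Rightarrow> (complex \<Rightarrow> complex) \<Rightarrow> (complex \<Rightarrow> complex) \<Rightarrow> complex \<Rightarrow> complex" where
  "hk_sum xs h k z = (\<Sum>(c,m,n)\<leftarrow>xs. c * ((deriv ^^ m) h z * (deriv ^^ n) k (cnj z)))"

text \<open>The derivative along \<open>v\<close> is v times the holomorphic plus
  \<open>cnj v\<close> times the antiholomorphic derivative, so each triple splits in two.\<close>

definition hk_step :: "complex \<Rightarrow> (complex \<times> nat \<times> nat) list \<Rightarrow> (complex \<times> nat \<times> nat) list" where
  "hk_step v xs = concat (map (\<lambda>(c,m,n). [(v * c, Suc m, n), (cnj v * c, m, Suc n)]) xs)"

lemma has_derivative_hk_sum:
  assumes "open U" "h holomorphic_on U" "open V" "k holomorphic_on V" "z \<in> U" "cnj z \<in> V"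
  shows "(hk_sum xs h k has_derivative (\<lambda>v. hk_sum (hk_step v xs) h k z)) (at z)"
proof (induction xs)
  case Nil
  then show ?case by (simp add: hk_sum_def[abs_def] hk_step_def)
next
  case (Cons x xs)
  obtain c m n where x: "x = (c, m, n)" by (cases x) auto
  have h: "((deriv ^^ m) h has_derivative (\<lambda>v. (deriv ^^ Suc m) h z * v)) (at z)"
    using holomorphic_derivI[OF holomorphic_higher_deriv[OF assms(2,1)] assms(1,5), of m]
    by (simp add: has_field_derivative_def)
  have k: "((\<lambda>z. (deriv ^^ n) k (cnj z)) has_derivative (\<lambda>v. (deriv ^^ Suc n) k (cnj z) * cnj v)) (at z)"
    using has_derivative_antiholomorphic[OF assms(3) holomorphic_higher_deriv[OF assms(4,3)] assms(6), of n] by simp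
  have "hk_sum (x # xs) h k = (\<lambda>z. c * ((deriv ^^ m) h z * (deriv ^^ n) k (cnj z)) + hk_sum xs h k z)"
    by (simp add: hk_sum_def fun_eq_iff x)
  then show ?case
    apply (simp only:)
    apply (rule has_derivative_eq_rhs)
     apply (rule has_derivative_add[OF has_derivative_mult_right[OF has_derivative_mult[OF h k]] Cons.IH])
    apply (simp add: x hk_step_def hk_sum_def fun_eq_iff algebra_simps)
    done
qed

text \<open>Each differentiation consumes equality on a neighbourhood, so the inductions carry the
  identity on all of the open set \<open>U\<close>, not at one point.\<close>

lemma mixed_partial_hk:
  assumes "open U" "h holomorphic_on U" "open V" "k holomorphic_on V" "\<And>z. z \<in> U \<Longrightarrow> cnj z \<in> V" "z \<in> U"
  shows "mixed_partial a b (\<lambda>z. h z * k (cnj z)) z = hk_sum ((hk_step 1 ^^ a) ((hk_step \<i> ^^ b) [(1,0,0)])) h k z"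
proof -
  have step: "dir_deriv v \<phi> z = hk_sum (hk_step v xs) h k z"
    if "\<And>z. z \<in> U \<Longrightarrow> \<phi> z = hk_sum xs h k z" "z \<in> U" for v \<phi> xs z
    using dir_deriv_cong[OF assms(1) that(2,1)]
      dir_deriv_eq[OF has_derivative_hk_sum[OF assms(1-4) that(2) assms(5)[OF that(2)]]] by simp
  have pow: "(dir_deriv v ^^ a) \<phi> z = hk_sum ((hk_step v ^^ a) xs) h k z"
    if "\<And>z. z \<in> U \<Longrightarrow> \<phi> z = hk_sum xs h k z" "z \<in> U" for v \<phi> xs z a
    using that(2)
  proof (induction a arbitrary: z)
    case (Suc a)
    then show ?case using step[of "(dir_deriv v ^^ a) \<phi>" "(hk_step v ^^ a) xs" z v] by simp
  qed (use that in simp)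
  show ?thesis unfolding mixed_partial_def
    by (intro pow assms(6)) (simp add: hk_sum_def)
qed

lemma hk_step_orderD:
  "(c,m,n) \<in> set (hk_step v ys) \<Longrightarrow> \<exists>c' m' n'. (c',m',n') \<in> set ys \<and> m + n = Suc (m' + n')"
  unfolding hk_step_def by fastforce

lemma hk_step_order:
  assumes "\<And>c m n. (c,m,n) \<in> set xs \<Longrightarrow> m + n \<le> d" "(c,m,n) \<in> set ((hk_step v ^^ a) xs)"
  shows "m + n \<le> d + a"
  using assms(2)
proof (induction a arbitrary: c m n)
  case (Suc a)
  then obtain c' m' n' where *: "(c',m',n') \<in> set ((hk_step v ^^ a) xs)" "m + n = Suc (m' + n')"
    using hk_step_orderD[of c m n v "(hk_step v ^^ a) xs"] by auto
  from Suc.IH[OF *(1)] *(2) show ?case by simp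
qed (use assms(1) in simp)

text \<open>The sum of the moduli of the coefficients when the mixed real partial is written in
  complex derivatives; it does not depend on the functions differentiated.\<close>

definition hk_const :: "nat \<Rightarrow> nat \<Rightarrow> real" where
  "hk_const a b = (\<Sum>x\<leftarrow>(hk_step 1 ^^ a) ((hk_step \<i> ^^ b) [(1,0,0)]). cmod (fst x))"

lemma hk_const_nonneg: "hk_const a b \<ge> 0"
  unfolding hk_const_def by (rule sum_list_nonneg) auto

lemma hk_mixed_partial_bound:
  assumes *: "open U" "h holomorphic_on U" "open V" "k holomorphic_on V" "\<And>z. z \<in> U \<Longrightarrow> cnj z \<in> V" "z \<in> U"
    and H: "\<And>m. m \<le> a + b \<Longrightarrow> cmod ((deriv ^^ m) h z) \<le> H"
    and L: "\<And>n. n \<le> a + b \<Longrightarrow> cmod ((deriv ^^ n) k (cnj z)) \<le> L"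
  shows "cmod (mixed_partial a b (\<lambda>z. h z * k (cnj z)) z) \<le> hk_const a b * (H * L)"
proof -
  define xs where "xs = (hk_step 1 ^^ a) ((hk_step \<i> ^^ b) [(1,0,0)])"
  have ord: "m + n \<le> a + b" if "(c,m,n) \<in> set xs" for c m n
  proof -
    have "m + n \<le> 0 + b" if "(c,m,n) \<in> set ((hk_step \<i> ^^ b) [(1,0,0)])" for c m n
      by (rule hk_step_order[OF _ that]) auto
    then have "m + n \<le> (0 + b) + a" by (rule hk_step_order) (use that in \<open>auto simp: xs_def\<close>)
    then show ?thesis by simp
  qed
  have "H \<ge> 0" using order_trans[OF norm_ge_zero H[of 0]] by simp
  have "cmod (hk_sum ys h k z) \<le> (\<Sum>x\<leftarrow>ys. cmod (fst x)) * (H * L)" if "set ys \<subseteq> set xs" for ys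
    using that
  proof (induction ys)
    case Nil
    then show ?case by (simp add: hk_sum_def)
  next
    case (Cons y ys)
    obtain c m n where y: "y = (c,m,n)" by (cases y) auto
    have mn: "m + n \<le> a + b" using ord[of c m n] Cons.prems by (simp add: y)
    have "cmod ((deriv ^^ m) h z) * cmod ((deriv ^^ n) k (cnj z)) \<le> H * L"
      using mn \<open>H \<ge> 0\<close> by (intro mult_mono H L) auto
    then have "cmod (c * ((deriv ^^ m) h z * (deriv ^^ n) k (cnj z))) \<le> cmod c * (H * L)"
      by (simp add: norm_mult mult_left_mono)
    moreover have "cmod (hk_sum ys h k z) \<le> (\<Sum>x\<leftarrow>ys. cmod (fst x)) * (H * L)"
      using Cons by auto
    moreover have "hk_sum (y # ys) h k z = c * ((deriv ^^ m) h z * (deriv ^^ n) k (cnj z)) + hk_sum ys h k z"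
      by (simp add: hk_sum_def y)
    ultimately show ?case
      by (simp add: y distrib_right) (rule order_trans[OF norm_triangle_ineq add_mono])
  qed
  then show ?thesis
    using mixed_partial_hk[OF *] by (simp add: xs_def hk_const_def)
qed

section \<open>Compactly supported distributions paired with holomorphic functions\<close>

lemma open_disk_cnj: "z \<in> disk \<Longrightarrow> cnj z \<in> disk"
  by simp

lemma smooth_pairing:
  assumes "h holomorphic_on disk" "k holomorphic_on disk"
  shows "(\<lambda>z. h z * k (cnj z)) \<in> smooth_functions disk"
  by (intro smooth_mult smooth_holomorphic smooth_antiholomorphic[of disk] assms) auto

lemma distribution_add:
  "\<lbrakk>G \<in> compact_distributions; \<phi> \<in> smooth_functions disk; \<psi> \<in> smooth_functions disk\<rbrakk>
    \<Longrightarrow> G (\<lambda>z. \<phi> z + \<psi> z) = G \<phi> + G \<psi>"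
  unfolding compact_distributions_def by blast

lemma distribution_cmult:
  "\<lbrakk>G \<in> compact_distributions; \<phi> \<in> smooth_functions disk\<rbrakk> \<Longrightarrow> G (\<lambda>z. c * \<phi> z) = c * G \<phi>"
  unfolding compact_distributions_def by blast

text \<open>Trades the sum of suprema in the definition for one uniform bound \<open>B\<close> on
  all derivatives. The new constant absorbs the (N+1)^2 terms of the sum, and the absolute value
  makes it nonnegative.\<close>

lemma distribution_bound:
  assumes "G \<in> compact_distributions"
  obtains K N C where "compact K" "K \<subseteq> disk" "C \<ge> 0"
    "\<And>\<phi> B. \<lbrakk>\<phi> \<in> smooth_functions disk;
       \<And>a b z. a \<le> N \<Longrightarrow> b \<le> N \<Longrightarrow> z \<in> K \<Longrightarrow> cmod (mixed_partial a b \<phi> z) \<le> B\<rbrakk> \<Longrightarrow> cmod (G \<phi>) \<le> C * B"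
proof -
  obtain K N C where K: "compact K" "K \<noteq> {}" "K \<subseteq> disk" and
    C: "\<And>\<phi>. \<phi> \<in> smooth_functions disk \<Longrightarrow>
      cmod (G \<phi>) \<le> C * (\<Sum>a\<le>N. \<Sum>b\<le>N. SUP z\<in>K. cmod (mixed_partial a b \<phi> z))"
    using assms unfolding compact_distributions_def by blast
  show ?thesis
  proof (rule that[of K "\<bar>C\<bar> * (real (Suc N) * real (Suc N))" N])
    fix \<phi> B assume \<phi>: "\<phi> \<in> smooth_functions disk"
      and B: "\<And>a b z. a \<le> N \<Longrightarrow> b \<le> N \<Longrightarrow> z \<in> K \<Longrightarrow> cmod (mixed_partial a b \<phi> z) \<le> B"
    have up: "(SUP z\<in>K. cmod (mixed_partial a b \<phi> z)) \<le> B" if "a \<le> N" "b \<le> N" for a b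
      using that K B by (intro cSUP_least) auto
    obtain z0 where z0: "z0 \<in> K" using K by blast
    \<comment> \<open>\<open>B\<close> also supplies boundedness, without which the supremum of a
      set of reals carries no information.\<close>
    have low: "0 \<le> (SUP z\<in>K. cmod (mixed_partial a b \<phi> z))" if "a \<le> N" "b \<le> N" for a b
    proof -
      have "bdd_above ((\<lambda>z. cmod (mixed_partial a b \<phi> z)) ` K)"
        by (rule bdd_aboveI[of _ B]) (use B that in auto)
      from cSUP_upper[OF z0 this] show ?thesis
        by (rule order_trans[OF norm_ge_zero])
    qed
    let ?S = "\<Sum>a\<le>N. \<Sum>b\<le>N. SUP z\<in>K. cmod (mixed_partial a b \<phi> z)"
    have "?S \<le> (\<Sum>a\<le>N. \<Sum>b\<le>N. B)" by (intro sum_mono up) auto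
    then have S: "?S \<le> real (Suc N) * real (Suc N) * B" by (simp add: algebra_simps)
    have S0: "0 \<le> ?S" by (intro sum_nonneg low) auto
    have "cmod (G \<phi>) \<le> C * ?S" by (rule C[OF \<phi>])
    also have "\<dots> \<le> \<bar>C\<bar> * ?S" using S0 by (intro mult_right_mono) auto
    also have "\<dots> \<le> \<bar>C\<bar> * (real (Suc N) * real (Suc N) * B)" by (rule mult_left_mono[OF S]) simp
    finally show "cmod (G \<phi>) \<le> \<bar>C\<bar> * (real (Suc N) * real (Suc N)) * B" by (simp only: mult.assoc)
  qed (use K in auto)
qed

lemma dir_deriv_zero: "dir_deriv v (\<lambda>_. 0) = (\<lambda>_. 0)"
  by (rule ext, rule dir_deriv_eq) (rule has_derivative_const)

lemma mixed_partial_zero: "mixed_partial a b (\<lambda>_. 0) = (\<lambda>_. 0)"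
proof -
  have "(dir_deriv v ^^ n) (\<lambda>_. 0) = (\<lambda>_. 0)" for v n
    by (induction n) (simp_all add: dir_deriv_zero)
  then show ?thesis by (simp add: mixed_partial_def)
qed

text \<open>The difference vanishes on the open disk together with all its partial derivatives, so
  the seminorm bound holds with \<open>B\<close> = 0. This is what allows kernels and polynomials to
  be cut off outside the disk.\<close>

lemma distribution_cong:
  assumes G: "G \<in> compact_distributions" and \<phi>: "\<phi> \<in> smooth_functions disk" and \<psi>: "\<psi> \<in> smooth_functions disk"
    and eq: "\<And>z. z \<in> disk \<Longrightarrow> \<phi> z = \<psi> z"
  shows "G \<phi> = G \<psi>"
proof -
  obtain K N C where K: "K \<subseteq> disk" and
    C: "\<And>\<phi> B. \<lbrakk>\<phi> \<in> smooth_functions disk;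
       \<And>a b z. a \<le> N \<Longrightarrow> b \<le> N \<Longrightarrow> z \<in> K \<Longrightarrow> cmod (mixed_partial a b \<phi> z) \<le> B\<rbrakk> \<Longrightarrow> cmod (G \<phi>) \<le> C * B"
    by (rule distribution_bound[OF G]) blast
  have sm: "(\<lambda>z. \<phi> z + (- 1) * \<psi> z) \<in> smooth_functions disk"
    by (intro smooth_add smooth_cmult \<phi> \<psi> open_ball)
  have "cmod (G (\<lambda>z. \<phi> z + (- 1) * \<psi> z)) \<le> C * 0"
  proof (rule C[OF sm])
    fix a b z assume "z \<in> K"
    then have "mixed_partial a b (\<lambda>z. \<phi> z + (- 1) * \<psi> z) z = mixed_partial a b (\<lambda>z. 0) z"
      using K eq by (intro mixed_partial_cong[of disk]) auto
    then show "cmod (mixed_partial a b (\<lambda>z. \<phi> z + (- 1) * \<psi> z) z) \<le> 0"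
      by (simp add: mixed_partial_zero)
  qed
  moreover have "G (\<lambda>z. \<phi> z + (- 1) * \<psi> z) = G \<phi> + (-1) * G \<psi>"
    unfolding distribution_add[OF G \<phi> smooth_cmult[OF open_ball \<psi>]] distribution_cmult[OF G \<psi>] ..
  ultimately show ?thesis by simp
qed

lemma compact_subset_disk_cball:
  assumes "compact K" "K \<subseteq> disk"
  obtains r where "0 < r" "r < 1" "K \<subseteq> cball 0 r"
proof (cases "K = {}")
  case True
  then show ?thesis using that[of "1/2"] by simp
next
  case False
  obtain z where z: "z \<in> K" "\<And>w. w \<in> K \<Longrightarrow> cmod w \<le> cmod z"
    using continuous_attains_sup[OF assms(1) False, of cmod] by (auto intro: continuous_intros)
  show ?thesis
    by (rule that[of "max (1/2) (cmod z)"]) (use z assms in \<open>auto simp: subset_iff le_max_iff_disj\<close>)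
qed

lemma member_le_double_sum:
  fixes g :: "nat \<Rightarrow> nat \<Rightarrow> real"
  assumes "a \<le> N" "b \<le> N" "\<And>a b. g a b \<ge> 0"
  shows "g a b \<le> (\<Sum>a\<le>N. \<Sum>b\<le>N. g a b)"
proof -
  have "g a b \<le> (\<Sum>b\<le>N. g a b)" using assms by (intro member_le_sum) auto
  also have "\<dots> \<le> (\<Sum>a\<le>N. \<Sum>b\<le>N. g a b)"
    using assms by (intro member_le_sum[of a "{..N}" "\<lambda>a. \<Sum>b\<le>N. g a b"]) (auto intro: sum_nonneg)
  finally show ?thesis .
qed

text \<open>Cauchy's inequality replaces derivatives on the compact set by suprema on a slightly
  larger disk. On products h(z) k(cnj z), G is therefore continuous for locally uniform convergence
  of the two factors.\<close>

lemma distribution_pairing_bound: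
  assumes G: "G \<in> compact_distributions"
  obtains \<rho> C where "0 < \<rho>" "\<rho> < 1" "C \<ge> 0"
    "\<And>h k H L. \<lbrakk>h holomorphic_on disk; k holomorphic_on disk;
       \<And>z. cmod z \<le> \<rho> \<Longrightarrow> cmod (h z) \<le> H; \<And>z. cmod z \<le> \<rho> \<Longrightarrow> cmod (k z) \<le> L\<rbrakk>
     \<Longrightarrow> cmod (G (\<lambda>z. h z * k (cnj z))) \<le> C * (H * L)"
proof -
  obtain K N C where K: "compact K" "K \<subseteq> disk" and C0: "C \<ge> 0" and
    C: "\<And>\<phi> B. \<lbrakk>\<phi> \<in> smooth_functions disk;
       \<And>a b z. a \<le> N \<Longrightarrow> b \<le> N \<Longrightarrow> z \<in> K \<Longrightarrow> cmod (mixed_partial a b \<phi> z) \<le> B\<rbrakk> \<Longrightarrow> cmod (G \<phi>) \<le> C * B"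
    by (rule distribution_bound[OF G]) blast
  obtain r where r: "0 < r" "r < 1" "K \<subseteq> cball 0 r" using compact_subset_disk_cball[OF K] by blast
  \<comment> \<open>Half of the gap between the closed disk of radius \<open>r\<close> and the unit
    circle: Cauchy circles of radius \<delta> around points of \<open>cball 0 r\<close> stay inside
    \<open>cball 0 \<rho>\<close>.\<close>
  define \<delta> where "\<delta> = (1 - r) / 2"
  define \<rho> where "\<rho> = r + \<delta>"
  have \<delta>: "0 < \<delta>" "\<delta> \<le> 1" "\<rho> < 1" using r by (auto simp: \<delta>_def \<rho>_def field_simps)
  define F where "F = fact (2 * N) / \<delta> ^ (2 * N)"
  have F0: "F \<ge> 0" using \<delta> by (simp add: F_def)
  have der: "cmod ((deriv ^^ m) h z) \<le> F * H"
    if h: "h holomorphic_on disk" and H: "\<And>z. cmod z \<le> \<rho> \<Longrightarrow> cmod (h z) \<le> H"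
      and m: "m \<le> 2 * N" and z: "cmod z \<le> r" for h H m z
  proof -
    have sub: "cball z \<delta> \<subseteq> cball 0 \<rho>"
    proof
      fix x assume "x \<in> cball z \<delta>"
      then show "x \<in> cball 0 \<rho>"
        using norm_triangle_sub[of x z] z by (simp add: \<rho>_def dist_norm norm_minus_commute)
    qed
    have sub': "cball z \<delta> \<subseteq> disk" using sub \<delta> by (auto simp: subset_iff)
    have H0: "H \<ge> 0" using order_trans[OF norm_ge_zero H[of 0]] r \<delta> by (simp add: \<rho>_def)
    have "cmod ((deriv ^^ m) h z) \<le> fact m * H / \<delta> ^ m"
    proof (rule Cauchy_inequality)
      show "h holomorphic_on ball z \<delta>"
        by (rule holomorphic_on_subset[OF h]) (use sub' ball_subset_cball in blast)
      show "continuous_on (cball z \<delta>) h"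
        by (rule holomorphic_on_imp_continuous_on, rule holomorphic_on_subset[OF h sub'])
      show "cmod (h x) \<le> H" if "cmod (z - x) = \<delta>" for x
        using sub that by (intro H) (auto simp: subset_iff dist_norm)
    qed (use \<delta> in simp)
    \<comment> \<open>A mixed partial with a, b \<le> N involves complex derivatives up to order 2
      N, and \<open>F\<close> serves all of these orders because \<delta> is at most 1.\<close>
    also have "\<dots> \<le> fact (2 * N) * H / \<delta> ^ (2 * N)"
      using H0 \<delta> m by (intro frac_le mult_right_mono fact_mono power_decreasing mult_nonneg_nonneg) auto
    finally show ?thesis by (simp add: F_def)
  qed
  define A where "A = (\<Sum>a\<le>N. \<Sum>b\<le>N. hk_const a b)"
  have A: "hk_const a b \<le> A" if "a \<le> N" "b \<le> N" for a b
    unfolding A_def by (rule member_le_double_sum) (use that hk_const_nonneg in auto)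
  have A0: "A \<ge> 0" unfolding A_def by (intro sum_nonneg hk_const_nonneg)
  show ?thesis
  proof (rule that[of \<rho> "C * (A * (F * F))"])
    fix h k H L
    assume h: "h holomorphic_on disk" and k: "k holomorphic_on disk"
      and H: "\<And>z. cmod z \<le> \<rho> \<Longrightarrow> cmod (h z) \<le> H" and L: "\<And>z. cmod z \<le> \<rho> \<Longrightarrow> cmod (k z) \<le> L"
    have HL: "H \<ge> 0" "L \<ge> 0" using order_trans[OF norm_ge_zero H[of 0]] order_trans[OF norm_ge_zero L[of 0]] r \<delta> by (simp_all add: \<rho>_def)
    have "cmod (G (\<lambda>z. h z * k (cnj z))) \<le> C * (A * ((F * H) * (F * L)))"
    proof (rule C[OF smooth_pairing[OF h k]])
      fix a b z assume ab: "a \<le> N" "b \<le> N" and z: "z \<in> K"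
      have zr: "cmod z \<le> r" "cmod (cnj z) \<le> r" "z \<in> disk" using z r K by auto
      have "cmod (mixed_partial a b (\<lambda>z. h z * k (cnj z)) z) \<le> hk_const a b * ((F * H) * (F * L))"
        by (rule hk_mixed_partial_bound[OF open_ball h open_ball k open_disk_cnj zr(3)])
          (use ab zr in \<open>auto intro!: der[OF h H] der[OF k L]\<close>)
      also have "\<dots> \<le> A * ((F * H) * (F * L))"
        using A[OF ab] F0 HL by (intro mult_right_mono) auto
      finally show "cmod (mixed_partial a b (\<lambda>z. h z * k (cnj z)) z) \<le> A * ((F * H) * (F * L))" .
    qed
    then show "cmod (G (\<lambda>z. h z * k (cnj z))) \<le> C * (A * (F * F)) * (H * L)"
      by (simp only: mult_ac)
  qed (use r \<delta> C0 A0 F0 in \<open>auto simp: \<rho>_def\<close>)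
qed

section \<open>Growth of G on polynomials times exponentials\<close>

lemma cauchy_exp_bound:
  assumes p: "p holomorphic_on UNIV" and P: "\<And>z. cmod z \<le> 2 \<Longrightarrow> cmod (p z) \<le> P" and z: "cmod z \<le> 1"
  shows "cmod ((deriv ^^ m) (\<lambda>w. p w * exp (s * w)) z) \<le> fact m * (P * (exp 1 * cmod (exp (s * z)))) * (1 + cmod s) ^ m"
proof -
  \<comment> \<open>On a circle of radius 1/(1+|s|) the modulus of exp(s w) changes by at most a
    factor e, so each derivative costs only a factor 1 + |s|. The radius is at most 1 and |z| \<le>
    1, hence the bound on \<open>p\<close> is asked for on the disk of radius 2.\<close>
  define r where "r = 1 / (1 + cmod s)"
  have r: "0 < r" "r \<le> 1" "cmod s * r \<le> 1" by (auto simp: r_def field_simps add_pos_nonneg)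
  have P0: "P \<ge> 0" using order_trans[OF norm_ge_zero P[of 0]] by simp
  have hol: "(\<lambda>w. p w * exp (s * w)) holomorphic_on S" for S
    by (intro holomorphic_on_mult holomorphic_on_subset[OF p] holomorphic_intros) auto
  have "cmod ((deriv ^^ m) (\<lambda>w. p w * exp (s * w)) z) \<le> fact m * (P * (exp 1 * cmod (exp (s * z)))) / r ^ m"
  proof (rule Cauchy_inequality)
    fix x assume x: "cmod (z - x) = r"
    have "cmod x \<le> cmod z + r" using norm_triangle_sub[of x z] x by (simp add: norm_minus_commute)
    then have Px: "cmod (p x) \<le> P" using z r by (intro P) auto
    have "s * x = s * z + s * (x - z)" by (simp add: algebra_simps)
    then have "cmod (exp (s * x)) = cmod (exp (s * z)) * exp (Re (s * (x - z)))"
      by (simp add: exp_add norm_mult)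
    also have "Re (s * (x - z)) \<le> cmod (s * (x - z))" by (rule complex_Re_le_cmod)
    also have "cmod (s * (x - z)) \<le> 1" using r x by (simp add: norm_mult norm_minus_commute)
    finally have "cmod (exp (s * x)) \<le> exp 1 * cmod (exp (s * z))" by (simp add: mult.commute)
    then show "cmod (p x * exp (s * x)) \<le> P * (exp 1 * cmod (exp (s * z)))"
      unfolding norm_mult using Px P0 by (intro mult_mono) auto
  qed (use r hol in \<open>auto intro: holomorphic_on_imp_continuous_on\<close>)
  then show ?thesis by (simp add: r_def power_divide)
qed

lemma holomorphic_UNIV_bounded_cball:
  assumes "p holomorphic_on UNIV"
  obtains P where "P \<ge> 0" "\<And>z. cmod z \<le> r \<Longrightarrow> cmod (p z) \<le> P"
proof -
  have "bounded (p ` cball 0 r)"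
    by (intro compact_imp_bounded compact_continuous_image compact_cball
        holomorphic_on_imp_continuous_on holomorphic_on_subset[OF assms]) auto
  then obtain P where P: "\<forall>z\<in>cball 0 r. cmod (p z) \<le> P" by (auto simp: bounded_iff)
  show ?thesis by (rule that[of "max 0 P"]) (use P in \<open>auto simp: le_max_iff_disj\<close>)
qed

text \<open>The two exponentials multiply to a function of modulus one, so only powers of \<open>s\<close> remain.\<close>

lemma distribution_exp_growth:
  assumes G: "G \<in> compact_distributions"
  obtains N :: nat where "\<And>p q. p holomorphic_on UNIV \<Longrightarrow> q holomorphic_on UNIV \<Longrightarrow>
    \<exists>C. \<forall>s. cmod (G (\<lambda>z. (p z * exp (s * z)) * (q (cnj z) * exp (- cnj s * cnj z)))) \<le> C * (1 + cmod s) ^ N"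
proof -
  obtain K N C where K: "compact K" "K \<subseteq> disk" and
    C: "\<And>\<phi> B. \<lbrakk>\<phi> \<in> smooth_functions disk;
       \<And>a b z. a \<le> N \<Longrightarrow> b \<le> N \<Longrightarrow> z \<in> K \<Longrightarrow> cmod (mixed_partial a b \<phi> z) \<le> B\<rbrakk> \<Longrightarrow> cmod (G \<phi>) \<le> C * B"
    by (rule distribution_bound[OF G]) blast
  define A where "A = (\<Sum>a\<le>N. \<Sum>b\<le>N. hk_const a b)"
  have A: "hk_const a b \<le> A" if "a \<le> N" "b \<le> N" for a b
    unfolding A_def by (rule member_le_double_sum) (use that hk_const_nonneg in auto)
  show ?thesis
  \<comment> \<open>Mixed partials with a, b \<le> N apply up to 2 N complex derivatives to either
    factor, at one power of 1 + |s| each.\<close>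
  proof (rule that[of "2 * N + 2 * N"])
    fix p q :: "complex \<Rightarrow> complex"
    assume p: "p holomorphic_on UNIV" and q: "q holomorphic_on UNIV"
    obtain P where P: "P \<ge> 0" "\<And>z. cmod z \<le> 2 \<Longrightarrow> cmod (p z) \<le> P"
      using holomorphic_UNIV_bounded_cball[OF p] by blast
    obtain Q where Q: "Q \<ge> 0" "\<And>z. cmod z \<le> 2 \<Longrightarrow> cmod (q z) \<le> Q"
      using holomorphic_UNIV_bounded_cball[OF q] by blast
    define F :: real where "F = fact (2 * N)"
    have der: "cmod ((deriv ^^ m) (\<lambda>w. p w * exp (s * w)) z) \<le> F * (P * (exp 1 * cmod (exp (s * z)))) * (1 + cmod s) ^ (2 * N)"
      if "p holomorphic_on UNIV" "P \<ge> 0" "\<And>z. cmod z \<le> 2 \<Longrightarrow> cmod (p z) \<le> P" "m \<le> 2 * N" "cmod z \<le> 1" for p P m s z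
    proof -
      have "fact m * (P * (exp 1 * cmod (exp (s * z)))) * (1 + cmod s) ^ m \<le> F * (P * (exp 1 * cmod (exp (s * z)))) * (1 + cmod s) ^ (2 * N)"
        unfolding F_def using that by (intro mult_mono power_increasing fact_mono mult_nonneg_nonneg) auto
      then show ?thesis using cauchy_exp_bound[OF that(1) that(3) that(5), of m s] by linarith
    qed
    define B where "B s = A * ((F * (P * exp 1) * (1 + cmod s) ^ (2 * N)) * (F * (Q * exp 1) * (1 + cmod s) ^ (2 * N)))" for s :: complex
    have "cmod (G (\<lambda>z. (p z * exp (s * z)) * (q (cnj z) * exp (- cnj s * cnj z)))) \<le> C * B s" for s
    proof (rule C)
      let ?h = "\<lambda>z. p z * exp (s * z)" and ?k = "\<lambda>w. q w * exp (- cnj s * w)"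
      have hol: "?h holomorphic_on disk" "?k holomorphic_on disk"
        by (intro holomorphic_on_mult holomorphic_on_subset[OF p] holomorphic_on_subset[OF q] holomorphic_intros; simp)+
      show "(\<lambda>z. ?h z * (q (cnj z) * exp (- cnj s * cnj z))) \<in> smooth_functions disk"
        using smooth_pairing[OF hol] by simp
      fix a b z assume ab: "a \<le> N" "b \<le> N" and zK: "z \<in> K"
      have z: "z \<in> disk" "cmod z \<le> 1" "cmod (cnj z) \<le> 1" using zK K by (auto simp: subset_iff less_imp_le)
      \<comment> \<open>The exponents s z and - cnj (s z) have opposite real parts.\<close>
      have e1: "cmod (exp (s * z)) * cmod (exp (- cnj s * cnj z)) = 1"
        unfolding norm_exp_eq_Re by (simp flip: exp_add)
      have "cmod (mixed_partial a b (\<lambda>z. ?h z * ?k (cnj z)) z) \<le> hk_const a b *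
          ((F * (P * (exp 1 * cmod (exp (s * z)))) * (1 + cmod s) ^ (2 * N)) *
           (F * (Q * (exp 1 * cmod (exp (- cnj s * cnj z)))) * (1 + cmod (- cnj s)) ^ (2 * N)))"
      proof (rule hk_mixed_partial_bound[OF open_ball hol(1) open_ball hol(2) open_disk_cnj z(1)])
        fix m assume "m \<le> a + b"
        then show "cmod ((deriv ^^ m) ?h z) \<le> F * (P * (exp 1 * cmod (exp (s * z)))) * (1 + cmod s) ^ (2 * N)"
          using ab by (intro der p P z) auto
      next
        fix m assume "m \<le> a + b"
        then show "cmod ((deriv ^^ m) ?k (cnj z)) \<le> F * (Q * (exp 1 * cmod (exp (- cnj s * cnj z)))) * (1 + cmod (- cnj s)) ^ (2 * N)"
          using ab by (intro der q Q z) auto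
      qed
      also have "\<dots> = hk_const a b * ((F * (P * exp 1) * (1 + cmod s) ^ (2 * N)) * (F * (Q * exp 1) * (1 + cmod s) ^ (2 * N))) *
          (cmod (exp (s * z)) * cmod (exp (- cnj s * cnj z)))"
        by (simp only: norm_minus_cancel complex_mod_cnj mult_ac)
      also have "\<dots> = hk_const a b * ((F * (P * exp 1) * (1 + cmod s) ^ (2 * N)) * (F * (Q * exp 1) * (1 + cmod s) ^ (2 * N)))"
        unfolding e1 by simp
      also have "\<dots> \<le> B s"
        unfolding B_def using A[OF ab] P(1) Q(1) by (intro mult_right_mono) (auto simp: F_def)
      finally show "cmod (mixed_partial a b (\<lambda>z. ?h z * (q (cnj z) * exp (- cnj s * cnj z))) z) \<le> B s"
        by simp
    qed
    moreover have "C * B s = (C * (A * ((F * (P * exp 1)) * (F * (Q * exp 1))))) * (1 + cmod s) ^ (2 * N + 2 * N)" for s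
      unfolding B_def power_add by (simp only: mult_ac)
    ultimately show "\<exists>C. \<forall>s. cmod (G (\<lambda>z. (p z * exp (s * z)) * (q (cnj z) * exp (- cnj s * cnj z)))) \<le> C * (1 + cmod s) ^ (2 * N + 2 * N)"
      by metis
  qed
qed


section \<open>Continuity of the pairing and power series in the exponential parameter\<close>

lemma distribution_diff:
  assumes "G \<in> compact_distributions" "\<phi> \<in> smooth_functions disk" "\<psi> \<in> smooth_functions disk"
  shows "G (\<lambda>z. \<phi> z - \<psi> z) = G \<phi> - G \<psi>"
  using distribution_add[OF assms(1,2) smooth_cmult[OF open_ball assms(3), of "-1"]]
    distribution_cmult[OF assms(1,3), of "-1"] by simp

lemma smooth_sum: "finite A \<Longrightarrow> (\<And>i. i \<in> A \<Longrightarrow> \<phi> i \<in> smooth_functions disk) \<Longrightarrow>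
    (\<lambda>z. \<Sum>i\<in>A. \<phi> i z) \<in> smooth_functions disk"
  by (induction A rule: finite_induct) (auto intro: smooth_const smooth_add)

lemma distribution_sum:
  assumes "G \<in> compact_distributions" "finite A" "\<And>i. i \<in> A \<Longrightarrow> \<phi> i \<in> smooth_functions disk"
  shows "G (\<lambda>z. \<Sum>i\<in>A. \<phi> i z) = (\<Sum>i\<in>A. G (\<phi> i))"
  using assms(2,3)
proof (induction A rule: finite_induct)
  case empty
  then show ?case using distribution_cmult[OF assms(1) smooth_const[OF open_ball, of 0], of 0] by simp
next
  case (insert i A)
  then have "G (\<lambda>z. \<phi> i z + (\<Sum>i\<in>A. \<phi> i z)) = G (\<phi> i) + G (\<lambda>z. \<Sum>i\<in>A. \<phi> i z)"
    by (intro distribution_add[OF assms(1)] smooth_sum) auto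
  with insert show ?case by simp
qed

text \<open>Writes the difference of the products as (hn - h) kn + h (kn - k) and estimates both
  parts by sup norms on the disk of radius \<rho>.\<close>

lemma distribution_pairing_tendsto:
  assumes G: "G \<in> compact_distributions"
    and hn: "\<And>n. hn n holomorphic_on disk" and h: "h holomorphic_on disk"
    and kn: "\<And>n. kn n holomorphic_on disk" and k: "k holomorphic_on disk"
    and hlim: "\<And>r. 0 < r \<Longrightarrow> r < 1 \<Longrightarrow> uniform_limit (cball 0 r) hn h sequentially"
    and klim: "\<And>r. 0 < r \<Longrightarrow> r < 1 \<Longrightarrow> uniform_limit (cball 0 r) kn k sequentially"
  shows "(\<lambda>n. G (\<lambda>z. hn n z * kn n (cnj z))) \<longlonglongrightarrow> G (\<lambda>z. h z * k (cnj z))"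
proof -
  obtain \<rho> C where \<rho>: "0 < \<rho>" "\<rho> < 1" and C0: "C \<ge> 0" and
    C: "\<And>h k H L. \<lbrakk>h holomorphic_on disk; k holomorphic_on disk;
       \<And>z. cmod z \<le> \<rho> \<Longrightarrow> cmod (h z) \<le> H; \<And>z. cmod z \<le> \<rho> \<Longrightarrow> cmod (k z) \<le> L\<rbrakk>
     \<Longrightarrow> cmod (G (\<lambda>z. h z * k (cnj z))) \<le> C * (H * L)"
    by (rule distribution_pairing_bound[OF G]) blast
  have bdd: "\<exists>H\<ge>0. \<forall>z. cmod z \<le> \<rho> \<longrightarrow> cmod (h z) \<le> H" if "h holomorphic_on disk" for h
  proof -
    have "bounded (h ` cball 0 \<rho>)"
      by (intro compact_imp_bounded compact_continuous_image compact_cball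
          holomorphic_on_imp_continuous_on holomorphic_on_subset[OF that]) (use \<rho> in auto)
    then obtain P where P: "\<forall>z\<in>cball 0 \<rho>. cmod (h z) \<le> P" by (auto simp: bounded_iff)
    then show ?thesis by (intro exI[of _ "max 0 P"]) (auto simp: le_max_iff_disj)
  qed
  obtain H where H: "H \<ge> 0" "\<And>z. cmod z \<le> \<rho> \<Longrightarrow> cmod (h z) \<le> H" using bdd[OF h] by blast
  obtain L where L: "L \<ge> 0" "\<And>z. cmod z \<le> \<rho> \<Longrightarrow> cmod (k z) \<le> L" using bdd[OF k] by blast
  show ?thesis
  proof (rule tendstoI)
    fix e :: real assume e: "e > 0"
    \<comment> \<open>The two parts add up to at most \<epsilon> * D; \<epsilon> \<le> 1 gives the
      bound L + 1 for the approximants \<open>kn\<close>.\<close>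
    define D where "D = C * (L + 1 + H)"
    define \<epsilon> where "\<epsilon> = min 1 (e / (D + 1))"
    have D: "D \<ge> 0" using C0 H L by (simp add: D_def)
    have \<epsilon>: "0 < \<epsilon>" "\<epsilon> \<le> 1" "\<epsilon> * D < e"
    proof -
      show "0 < \<epsilon>" "\<epsilon> \<le> 1" using e D by (auto simp: \<epsilon>_def)
      have "\<epsilon> * D \<le> e / (D + 1) * D" using D by (intro mult_right_mono) (auto simp: \<epsilon>_def)
      also have "\<dots> < e" using e D by (simp add: field_simps)
      finally show "\<epsilon> * D < e" .
    qed
    from uniform_limitD[OF hlim[OF \<rho>] \<epsilon>(1)] uniform_limitD[OF klim[OF \<rho>] \<epsilon>(1)]
    show "\<forall>\<^sub>F n in sequentially. dist (G (\<lambda>z. hn n z * kn n (cnj z))) (G (\<lambda>z. h z * k (cnj z))) < e"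
    proof eventually_elim
      case (elim n)
      have h1: "cmod (hn n z - h z) \<le> \<epsilon>" if "cmod z \<le> \<rho>" for z
        using elim(1) that by (auto simp: dist_norm less_imp_le)
      have k1: "cmod (kn n z - k z) \<le> \<epsilon>" if "cmod z \<le> \<rho>" for z
        using elim(2) that by (auto simp: dist_norm less_imp_le)
      have k2: "cmod (kn n z) \<le> L + 1" if "cmod z \<le> \<rho>" for z
        using norm_triangle_sub[of "kn n z" "k z"] k1[OF that] L(2)[OF that] \<epsilon> by linarith
      have "G (\<lambda>z. hn n z * kn n (cnj z)) - G (\<lambda>z. h z * k (cnj z)) =
          G (\<lambda>z. hn n z * kn n (cnj z) - h z * k (cnj z))"
        by (rule distribution_diff[OF G, symmetric]) (intro smooth_pairing hn kn h k)+
      also have "(\<lambda>z. hn n z * kn n (cnj z) - h z * k (cnj z)) =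
          (\<lambda>z. (hn n z - h z) * kn n (cnj z) + h z * (kn n (cnj z) - k (cnj z)))"
        by (simp add: algebra_simps)
      also have "G \<dots> = G (\<lambda>z. (hn n z - h z) * kn n (cnj z)) + G (\<lambda>z. h z * (kn n (cnj z) - k (cnj z)))"
        by (rule distribution_add[OF G])
          (intro smooth_pairing[of "\<lambda>z. hn n z - h z"] smooth_pairing[of _ "\<lambda>z. kn n z - k z"] holomorphic_on_diff hn kn h k)+
      also have "cmod \<dots> \<le> C * (\<epsilon> * (L + 1)) + C * (H * \<epsilon>)"
        by (intro order_trans[OF norm_triangle_ineq] add_mono
            C[of "\<lambda>z. hn n z - h z" "kn n"] C[of h "\<lambda>z. kn n z - k z"] holomorphic_on_diff hn kn h k h1 k1 k2 H(2))
      also have "\<dots> = \<epsilon> * D" by (simp add: D_def algebra_simps)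
      finally show ?case using \<epsilon>(3) by (simp add: dist_norm)
    qed
  qed
qed

lemma exp_series_uniform_limit:
  assumes "p holomorphic_on disk" "0 < r" "r < 1"
  shows "uniform_limit (cball 0 r) (\<lambda>n z. \<Sum>j<n. p z * (s ^ j / fact j * z ^ j)) (\<lambda>z. p z * exp (s * z)) sequentially"
proof -
  have "bounded (p ` cball 0 r)"
    by (intro compact_imp_bounded compact_continuous_image compact_cball
        holomorphic_on_imp_continuous_on holomorphic_on_subset[OF assms(1)]) (use assms in auto)
  then obtain P where P: "\<forall>z\<in>cball 0 r. cmod (p z) \<le> P" by (auto simp: bounded_iff)
  have "uniform_limit (cball 0 r) (\<lambda>n z. \<Sum>j<n. p z * (s ^ j / fact j * z ^ j))
      (\<lambda>z. suminf (\<lambda>j. p z * (s ^ j / fact j * z ^ j))) sequentially"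
  proof (rule Weierstrass_m_test)
    show "summable (\<lambda>j. P * (inverse (fact j) * cmod s ^ j))"
      by (intro summable_mult summable_exp)
    fix j z assume z: "z \<in> cball (0::complex) r"
    have "cmod (p z * (s ^ j / fact j * z ^ j)) = cmod (p z) * (inverse (fact j) * cmod s ^ j * cmod z ^ j)"
      by (simp add: norm_mult norm_divide norm_inverse norm_power divide_inverse)
    also have "\<dots> \<le> P * (inverse (fact j) * cmod s ^ j * 1)"
      using z P assms by (intro mult_mono mult_left_mono power_le_one) (auto intro: order_trans[OF norm_ge_zero])
    finally show "cmod (p z * (s ^ j / fact j * z ^ j)) \<le> P * (inverse (fact j) * cmod s ^ j)" by simp
  qed
  moreover have "suminf (\<lambda>j. p z * (s ^ j / fact j * z ^ j)) = p z * exp (s * z)" for z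
  proof -
    have "(\<lambda>j. p z * ((s * z) ^ j /\<^sub>R fact j)) sums (p z * exp (s * z))"
      by (intro sums_mult exp_converges)
    moreover have "p z * ((s * z) ^ j /\<^sub>R fact j) = p z * (s ^ j / fact j * z ^ j)" for j
      by (simp add: scaleR_conv_of_real power_mult_distrib field_simps)
    ultimately show ?thesis by (simp add: sums_iff)
  qed
  ultimately show ?thesis by simp
qed

text \<open>Expands the exponential under G. The Taylor coefficients in \<open>s\<close> are values
  of G without exponential, so identities for the bilinear form carry over to the versions with
  parameters.\<close>

lemma distribution_exp_series_left:
  assumes G: "G \<in> compact_distributions" and p: "p holomorphic_on disk" and k: "k holomorphic_on disk"
  shows "(\<lambda>j. G (\<lambda>z. (p z * z ^ j) * k (cnj z)) / fact j * s ^ j) sums G (\<lambda>z. (p z * exp (s * z)) * k (cnj z))"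
  unfolding sums_def
proof -
  have 1: "(\<lambda>z. \<Sum>j<n. p z * (s ^ j / fact j * z ^ j)) holomorphic_on disk" for n
    by (intro holomorphic_intros p)
  have "(\<lambda>n. G (\<lambda>z. (\<Sum>j<n. p z * (s ^ j / fact j * z ^ j)) * k (cnj z))) \<longlonglongrightarrow> G (\<lambda>z. (p z * exp (s * z)) * k (cnj z))"
    by (rule distribution_pairing_tendsto[OF G, where kn = "\<lambda>_. k"])
      (intro 1 k p exp_series_uniform_limit holomorphic_on_mult holomorphic_intros uniform_limit_const | simp)+
  moreover have "G (\<lambda>z. (\<Sum>j<n. p z * (s ^ j / fact j * z ^ j)) * k (cnj z)) =
      (\<Sum>j<n. G (\<lambda>z. (p z * z ^ j) * k (cnj z)) / fact j * s ^ j)" for n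
  proof -
    have sm: "(\<lambda>z. (p z * z ^ j) * k (cnj z)) \<in> smooth_functions disk" for j
      by (intro smooth_pairing[OF _ k] holomorphic_intros p)
    have "G (\<lambda>z. (\<Sum>j<n. p z * (s ^ j / fact j * z ^ j)) * k (cnj z)) =
        G (\<lambda>z. \<Sum>j<n. (s ^ j / fact j) * ((p z * z ^ j) * k (cnj z)))"
      by (simp add: sum_distrib_left sum_distrib_right mult_ac)
    also have "\<dots> = (\<Sum>j<n. G (\<lambda>z. (s ^ j / fact j) * ((p z * z ^ j) * k (cnj z))))"
      by (intro distribution_sum G smooth_cmult sm) auto
    also have "\<dots> = (\<Sum>j<n. (s ^ j / fact j) * G (\<lambda>z. (p z * z ^ j) * k (cnj z)))"
      by (intro sum.cong refl distribution_cmult G sm)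
    finally show ?thesis by (simp add: mult_ac)
  qed
  ultimately show "(\<lambda>n. \<Sum>j<n. G (\<lambda>z. (p z * z ^ j) * k (cnj z)) / fact j * s ^ j) \<longlonglongrightarrow> G (\<lambda>z. (p z * exp (s * z)) * k (cnj z))"
    by simp
qed

lemma distribution_exp_series_right:
  assumes G: "G \<in> compact_distributions" and h: "h holomorphic_on disk" and q: "q holomorphic_on disk"
  shows "(\<lambda>j. G (\<lambda>z. h z * (q (cnj z) * cnj z ^ j)) / fact j * t ^ j) sums G (\<lambda>z. h z * (q (cnj z) * exp (t * cnj z)))"
  unfolding sums_def
proof -
  have 1: "(\<lambda>z. \<Sum>j<n. q z * (t ^ j / fact j * z ^ j)) holomorphic_on disk" for n
    by (intro holomorphic_intros q)
  have "(\<lambda>n. G (\<lambda>z. h z * (\<Sum>j<n. q (cnj z) * (t ^ j / fact j * cnj z ^ j)))) \<longlonglongrightarrow> G (\<lambda>z. h z * (q (cnj z) * exp (t * cnj z)))"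
    by (rule distribution_pairing_tendsto[OF G, where hn = "\<lambda>_. h" and kn = "\<lambda>n z. \<Sum>j<n. q z * (t ^ j / fact j * z ^ j)" and k = "\<lambda>z. q z * exp (t * z)"])
      (intro 1 h q exp_series_uniform_limit holomorphic_on_mult holomorphic_intros uniform_limit_const | simp)+
  moreover have "G (\<lambda>z. h z * (\<Sum>j<n. q (cnj z) * (t ^ j / fact j * cnj z ^ j))) =
      (\<Sum>j<n. G (\<lambda>z. h z * (q (cnj z) * cnj z ^ j)) / fact j * t ^ j)" for n
  proof -
    have sm: "(\<lambda>z. h z * (q (cnj z) * cnj z ^ j)) \<in> smooth_functions disk" for j
      by (rule smooth_pairing[OF h, of "\<lambda>z. q z * z ^ j"]) (intro holomorphic_intros q)
    have "G (\<lambda>z. h z * (\<Sum>j<n. q (cnj z) * (t ^ j / fact j * cnj z ^ j))) =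
        G (\<lambda>z. \<Sum>j<n. (t ^ j / fact j) * (h z * (q (cnj z) * cnj z ^ j)))"
      by (simp add: sum_distrib_left mult_ac)
    also have "\<dots> = (\<Sum>j<n. G (\<lambda>z. (t ^ j / fact j) * (h z * (q (cnj z) * cnj z ^ j))))"
      by (intro distribution_sum G smooth_cmult sm) auto
    also have "\<dots> = (\<Sum>j<n. (t ^ j / fact j) * G (\<lambda>z. h z * (q (cnj z) * cnj z ^ j)))"
      by (intro sum.cong refl distribution_cmult G sm)
    finally show ?thesis by (simp add: mult_ac)
  qed
  ultimately show "(\<lambda>n. \<Sum>j<n. G (\<lambda>z. h z * (q (cnj z) * cnj z ^ j)) / fact j * t ^ j) \<longlonglongrightarrow> G (\<lambda>z. h z * (q (cnj z) * exp (t * cnj z)))"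
    by simp
qed

lemma entire_power_series:
  assumes "\<And>s. (\<lambda>n. a n * s ^ n) sums f s"
  shows "f holomorphic_on (UNIV :: complex set)"
proof -
  have "f holomorphic_on ball 0 r" for r
    by (rule power_series_holomorphic[of 0 r a]) (use assms in simp)
  then have "f field_differentiable (at z)" for z
    using holomorphic_on_imp_differentiable_at[of f "ball 0 (cmod z + 1)" z] by simp
  then show ?thesis by (simp add: holomorphic_on_def)
qed

text \<open>Zeros are isolated: a nonzero coefficient would produce a punctured disk around 0 on
  which \<open>f\<close> has no zero.\<close>

lemma power_series_coeffs_zero:
  fixes a :: "nat \<Rightarrow> complex"
  assumes sums: "\<And>s. cmod s < 1 \<Longrightarrow> (\<lambda>n. a n * s ^ n) sums f s" and ev: "\<forall>\<^sub>F s in nhds 0. f s = 0"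
  shows "a n = 0"
proof -
  have f0: "f 0 = 0" using ev by (rule eventually_nhds_x_imp_x)
  show ?thesis
  proof (cases "n = 0")
    case True
    then show ?thesis using sums[of 0] f0 by simp
  next
    case False
    show ?thesis
    proof (rule ccontr)
      assume "a n \<noteq> 0"
      obtain r where r: "0 < r" "\<And>z. z \<in> cball 0 r - {0} \<Longrightarrow> f z \<noteq> 0"
        by (rule powser_0_nonzero[of 1 0 a f n]) (use sums f0 \<open>a n \<noteq> 0\<close> False in auto)
      obtain e where e: "e > 0" "\<And>s. dist s 0 < e \<Longrightarrow> f s = 0"
        using ev by (auto simp: eventually_nhds_metric)
      define s :: complex where "s = of_real (min r e / 2)"
      have "f s = 0" "s \<in> cball 0 r - {0}" using r e by (auto simp: s_def min_def)
      with r show False by blast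
    qed
  qed
qed

section \<open>The bilinear form on polynomials and a polynomial that annihilates it\<close>

definition poly_pairing :: "((complex \<Rightarrow> complex) \<Rightarrow> complex) \<Rightarrow> complex poly \<Rightarrow> complex poly \<Rightarrow> complex" where
  "poly_pairing G p q = G (\<lambda>z. poly p z * poly q (cnj z))"

lemma holomorphic_poly [holomorphic_intros]: "poly p holomorphic_on A"
  unfolding poly_altdef by (intro holomorphic_intros)

text \<open>Evaluating \<open>q\<close> at \<open>cnj z\<close> without conjugating its coefficients
  makes the form linear in both arguments, where the operator-theoretic form would be
  sesquilinear.\<close>

lemma poly_pairing_linear:
  assumes G: "G \<in> compact_distributions"
  shows "poly_pairing G (p + p') q = poly_pairing G p q + poly_pairing G p' q"
    "poly_pairing G (Polynomial.smult c p) q = c * poly_pairing G p q"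
    "poly_pairing G p (q + q') = poly_pairing G p q + poly_pairing G p q'"
    "poly_pairing G p (Polynomial.smult c q) = c * poly_pairing G p q"
proof -
  have sm: "(\<lambda>z. poly p z * poly q (cnj z)) \<in> smooth_functions disk" for p q
    by (intro smooth_pairing holomorphic_poly)
  show "poly_pairing G (p + p') q = poly_pairing G p q + poly_pairing G p' q"
    "poly_pairing G p (q + q') = poly_pairing G p q + poly_pairing G p q'"
    unfolding poly_pairing_def by (simp_all add: algebra_simps flip: distribution_add[OF G sm sm])
  show "poly_pairing G (Polynomial.smult c p) q = c * poly_pairing G p q"
    "poly_pairing G p (Polynomial.smult c q) = c * poly_pairing G p q"
    unfolding poly_pairing_def by (simp_all add: algebra_simps flip: distribution_cmult[OF G sm])
qed

text \<open>Finite rank enters only as a bound on the length of biorthogonal systems. The finite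
  decomposition of the form is lifted to exponentials, where the growth estimate applies.\<close>

lemma finite_rank_annihilator:
  assumes G: "G \<in> compact_distributions"
    and bound: "\<And>n u v. (\<And>i j. i < n \<Longrightarrow> j < n \<Longrightarrow> poly_pairing G (u i) (v j) = (if i = j then 1 else 0)) \<Longrightarrow> n \<le> (R::nat)"
  obtains Q where "Q \<noteq> 0" "\<And>p q. poly_pairing G (Q * p) q = 0"
proof -
  let ?B = "poly_pairing G"
  obtain n :: nat and u v where
    uv: "\<And>i j. i < n \<Longrightarrow> j < n \<Longrightarrow> ?B (u i) (v j) = (if i = j then 1 else 0)" and
    dec: "\<And>p q. ?B p q = (\<Sum>i<n. ?B p (v i) * ?B (u i) q)"
    by (rule biorthogonal_decomposition[of ?B R]) (use poly_pairing_linear[OF G] bound in blast)+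
  define \<alpha> where "\<alpha> p i s = G (\<lambda>z. (poly p z * exp (s * z)) * poly (v i) (cnj z))" for p i s
  define \<gamma> where "\<gamma> q i t = G (\<lambda>z. poly (u i) z * (poly q (cnj z) * exp (t * cnj z)))" for q i t
  have Bx: "G (\<lambda>z. (poly p z * z ^ j) * poly q (cnj z)) = ?B (p * monom 1 j) q"
    "G (\<lambda>z. poly p z * (poly q (cnj z) * cnj z ^ j)) = ?B p (q * monom 1 j)" for p q j
    by (simp_all add: poly_pairing_def poly_monom)
  have left: "(\<lambda>j. ?B (p * monom 1 j) q / fact j * s ^ j) sums G (\<lambda>z. (poly p z * exp (s * z)) * poly q (cnj z))" for p q s
    using distribution_exp_series_left[OF G holomorphic_poly holomorphic_poly, of p q s] by (simp only: Bx)
  have \<alpha>: "(\<lambda>j. ?B (p * monom 1 j) (v i) / fact j * s ^ j) sums \<alpha> p i s" for p i s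
    unfolding \<alpha>_def by (rule left)
  have \<gamma>: "(\<lambda>j. ?B (u i) (q * monom 1 j) / fact j * t ^ j) sums \<gamma> q i t" for q i t
    unfolding \<gamma>_def using distribution_exp_series_right[OF G holomorphic_poly holomorphic_poly, of "u i" q t] by (simp only: Bx)
  \<comment> \<open>The decomposition holds for each Taylor coefficient in \<open>s\<close>, hence
    for the sums. The same comparison in the second variable gives \<open>dec2\<close>.\<close>
  have dec1: "G (\<lambda>z. (poly p z * exp (s * z)) * poly q (cnj z)) = (\<Sum>i<n. \<alpha> p i s * ?B (u i) q)" for p q s
  proof (rule sums_unique2[OF left])
    have "(\<lambda>j. \<Sum>i<n. ?B (p * monom 1 j) (v i) / fact j * s ^ j * ?B (u i) q) sums (\<Sum>i<n. \<alpha> p i s * ?B (u i) q)"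
      by (intro sums_sum sums_mult2 \<alpha>)
    moreover have "(\<Sum>i<n. ?B (p * monom 1 j) (v i) / fact j * s ^ j * ?B (u i) q) = ?B (p * monom 1 j) q / fact j * s ^ j" for j
      by (subst dec[of "p * monom 1 j" q]) (simp add: sum_divide_distrib sum_distrib_left sum_distrib_right mult_ac)
    ultimately show "(\<lambda>j. ?B (p * monom 1 j) q / fact j * s ^ j) sums (\<Sum>i<n. \<alpha> p i s * ?B (u i) q)" by simp
  qed
  have dec2: "G (\<lambda>z. (poly p z * exp (s * z)) * (poly q (cnj z) * exp (t * cnj z))) = (\<Sum>i<n. \<alpha> p i s * \<gamma> q i t)" for p q s t
  proof (rule sums_unique2)
    have hol: "(\<lambda>z. poly p z * exp (s * z)) holomorphic_on disk" by (intro holomorphic_intros)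
    show "(\<lambda>j. G (\<lambda>z. (poly p z * exp (s * z)) * (poly q (cnj z) * cnj z ^ j)) / fact j * t ^ j) sums
      G (\<lambda>z. (poly p z * exp (s * z)) * (poly q (cnj z) * exp (t * cnj z)))"
      by (rule distribution_exp_series_right[OF G hol holomorphic_poly])
    have "(\<lambda>j. \<Sum>i<n. \<alpha> p i s * (?B (u i) (q * monom 1 j) / fact j * t ^ j)) sums (\<Sum>i<n. \<alpha> p i s * \<gamma> q i t)"
      by (intro sums_sum sums_mult \<gamma>)
    moreover have "(\<Sum>i<n. \<alpha> p i s * (?B (u i) (q * monom 1 j) / fact j * t ^ j)) =
        G (\<lambda>z. (poly p z * exp (s * z)) * (poly q (cnj z) * cnj z ^ j)) / fact j * t ^ j" for j
      using dec1[of p s "q * monom 1 j"]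
      by (simp add: poly_monom sum_divide_distrib sum_distrib_left sum_distrib_right mult_ac)
    ultimately show "(\<lambda>j. G (\<lambda>z. (poly p z * exp (s * z)) * (poly q (cnj z) * cnj z ^ j)) / fact j * t ^ j) sums
        (\<Sum>i<n. \<alpha> p i s * \<gamma> q i t)" by simp
  qed
  have \<alpha>0: "\<alpha> p i 0 = ?B p (v i)" for p i by (simp add: \<alpha>_def poly_pairing_def)
  have \<gamma>0: "\<gamma> q i 0 = ?B (u i) q" for q i by (simp add: \<gamma>_def poly_pairing_def)
  obtain N :: nat where N: "\<And>p q. p holomorphic_on UNIV \<Longrightarrow> q holomorphic_on UNIV \<Longrightarrow>
    \<exists>C. \<forall>s. cmod (G (\<lambda>z. (p z * exp (s * z)) * (q (cnj z) * exp (- cnj s * cnj z)))) \<le> C * (1 + cmod s) ^ N"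
    by (rule distribution_exp_growth[OF G]) blast
  have sme: "(\<lambda>z. (poly p z * exp (s * z)) * poly q (cnj z)) \<in> smooth_functions disk" for p q s
    by (intro smooth_pairing holomorphic_intros)
  obtain Q where Q: "Q \<noteq> 0" "\<forall>\<^sub>F s in nhds 0. \<forall>i<n. \<alpha> Q i s = 0"
  proof (rule annihilating_polynomial[of \<alpha> n \<gamma> u v N])
    show "\<alpha> (p + q) i s = \<alpha> p i s + \<alpha> q i s" for p q i s
      unfolding \<alpha>_def distribution_add[OF G sme sme, symmetric] by (simp add: algebra_simps)
    show "\<alpha> (Polynomial.smult c p) i s = c * \<alpha> p i s" for c p i s
      unfolding \<alpha>_def distribution_cmult[OF G sme, symmetric] by (simp add: algebra_simps)
    show "\<alpha> p i holomorphic_on UNIV" for p i by (rule entire_power_series[OF \<alpha>])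
    show "\<gamma> p i holomorphic_on UNIV" for p i by (rule entire_power_series[OF \<gamma>])
    show "\<alpha> (u j) i 0 = (if i = j then 1 else 0)" if "i < n" "j < n" for i j
      unfolding \<alpha>0 using uv[OF that(2,1)] by simp
    show "\<gamma> (v j) i 0 = (if i = j then 1 else 0)" if "i < n" "j < n" for i j
      unfolding \<gamma>0 using uv[OF that] by simp
    show "\<exists>C. \<forall>s. cmod (\<Sum>i<n. \<alpha> p i s * \<gamma> q i (- cnj s)) \<le> C * (1 + cmod s) ^ N" for p q
      unfolding dec2[symmetric] by (rule N[OF holomorphic_poly holomorphic_poly])
  qed
  \<comment> \<open>The Taylor coefficients of \<alpha> Q i at 0 are these values divided by
    j!.\<close>
  have zero: "?B (Q * monom 1 j) (v i) = 0" if "i < n" for i j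
  proof -
    have "\<forall>\<^sub>F s in nhds 0. \<alpha> Q i s = 0" using Q(2) by eventually_elim (use that in blast)
    from power_series_coeffs_zero[OF \<alpha> this, of j] show ?thesis by simp
  qed
  \<comment> \<open>\<open>dec\<close> extends the vanishing from the \<open>v i\<close> to every
    \<open>q\<close>. The shift \<open>j\<close> is kept arbitrary because \<open>pCons\<close>
    moves a power of z into it.\<close>
  have "?B (Q * p * monom 1 j) q = 0" for p q j
  proof (induction p arbitrary: j)
    case 0
    then show ?case using poly_pairing_linear(2)[OF G, of 0 0 q] by simp
  next
    case (pCons a p)
    have "Q * pCons a p * monom 1 j = Polynomial.smult a (Q * monom 1 j) + Q * p * monom 1 (Suc j)"
      by (simp add: monom_Suc algebra_simps)
    moreover have "?B (Q * monom 1 j) q = 0" by (subst dec) (simp add: zero)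
    ultimately show ?case using pCons.IH by (simp add: poly_pairing_linear[OF G])
  qed
  from this[of _ 0] have "?B (Q * p) q = 0" for p q by (simp add: monom_0)
  with Q(1) that show ?thesis by blast
qed

section \<open>Approximation of smooth functions by polynomials\<close>

lemma directional_mean_value:
  fixes F :: "complex \<Rightarrow> complex"
  assumes h: "0 \<le> h" and diff: "\<And>t. 0 \<le> t \<Longrightarrow> t \<le> h \<Longrightarrow> F differentiable (at (z + of_real t * v))"
    and bd: "\<And>t. 0 \<le> t \<Longrightarrow> t \<le> h \<Longrightarrow> cmod (dir_deriv v F (z + of_real t * v) - A) \<le> B"
  shows "cmod (F (z + of_real h * v) - F z - of_real h * A) \<le> B * h"
proof (cases "h = 0")
  case False
  then have h: "0 < h" using h by simp
  \<comment> \<open>Subtracting the linear function with slope \<open>A\<close> turns a bound on the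
    deviation of the derivative from \<open>A\<close> into the claim, by the mean value
    inequality.\<close>
  define \<phi> where "\<phi> t = F (z + of_real t * v) - of_real t * A" for t :: real
  have der: "(\<phi> has_derivative (\<lambda>s. of_real s * (dir_deriv v F (z + of_real t * v) - A))) (at t)"
    if "0 \<le> t" "t \<le> h" for t
  proof -
    have 1: "((\<lambda>t::real. z + of_real t * v) has_derivative (\<lambda>s. of_real s * v)) (at t)"
      by (auto intro!: derivative_eq_intros)
    have 2: "((\<lambda>t::real. F (z + of_real t * v)) has_derivative (\<lambda>s. dir_deriv (of_real s * v) F (z + of_real t * v))) (at t)"
      by (rule has_derivative_compose[OF 1 has_derivative_dir_deriv[OF diff[OF that]]])
    have "linear (\<lambda>u. dir_deriv u F (z + of_real t * v))"
      by (rule has_derivative_linear[OF has_derivative_dir_deriv[OF diff[OF that]]])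
    from linear_scale[OF this] have 3: "dir_deriv (of_real s * v) F (z + of_real t * v) = of_real s * dir_deriv v F (z + of_real t * v)" for s
      by (simp add: scaleR_conv_of_real)
    have 4: "((\<lambda>t::real. of_real t * A) has_derivative (\<lambda>s. of_real s * A)) (at t)"
      by (auto intro!: derivative_eq_intros)
    show ?thesis unfolding \<phi>_def right_diff_distrib
      by (rule has_derivative_diff[OF 2[unfolded 3] 4])
  qed
  have "continuous_on {0..h} \<phi>"
    by (intro continuous_at_imp_continuous_on ballI has_derivative_continuous[OF der]) auto
  then obtain t where t: "t \<in> {0<..<h}" and le: "cmod (\<phi> h - \<phi> 0) \<le> cmod (of_real (h - 0) * (dir_deriv v F (z + of_real t * v) - A))"
    using mvt_general[OF h, of \<phi> "\<lambda>t s. of_real s * (dir_deriv v F (z + of_real t * v) - A)"] der by auto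
  have "\<phi> h - \<phi> 0 = F (z + of_real h * v) - F z - of_real h * A" by (simp add: \<phi>_def)
  moreover have "cmod (of_real (h - 0) * (dir_deriv v F (z + of_real t * v) - A)) \<le> h * B"
    using h t bd[of t] by (simp add: norm_mult)
  ultimately show ?thesis using le by (simp add: mult.commute)
qed simp

text \<open>Two applications of the mean value estimate, along \<open>u\<close> to the increment of
  f in direction \<open>v\<close> and along \<open>v\<close> to the derivative in direction
  \<open>u\<close>, show that the second difference is h^2 times the mixed derivative up to
  o(h^2).\<close>

lemma second_difference_bound:
  fixes f :: "complex \<Rightarrow> complex"
  assumes f: "\<And>w. f differentiable (at w)" and fu: "\<And>w. dir_deriv u f differentiable (at w)"
    and cont: "isCont (dir_deriv v (dir_deriv u f)) z" and uv: "cmod u = 1" "cmod v = 1" and e: "e > 0"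
  obtains \<delta> where "\<delta> > 0" "\<And>h. 0 < h \<Longrightarrow> h < \<delta> \<Longrightarrow>
    cmod ((f (z + of_real h * u + of_real h * v) - f (z + of_real h * u)) - (f (z + of_real h * v) - f z)
      - of_real (h\<^sup>2) * dir_deriv v (dir_deriv u f) z) \<le> e * h\<^sup>2"
proof -
  let ?A = "dir_deriv v (dir_deriv u f) z"
  obtain d where d: "d > 0" "\<And>w. dist w z < d \<Longrightarrow> dist (dir_deriv v (dir_deriv u f) w) ?A < e"
    using cont e unfolding continuous_at_eps_delta by blast
  show ?thesis
  \<comment> \<open>Two steps of length h < d/2 in unit directions stay within distance d of
    \<open>z\<close>.\<close>
  proof (rule that[of "d / 2"])
    fix h assume h: "0 < h" "h < d / 2"
    define F where "F w = f (w + of_real h * v) - f w" for w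
    have sh: "(\<lambda>w. f (w + of_real h * v)) differentiable (at w)"
      and shd: "dir_deriv u (\<lambda>w. f (w + of_real h * v)) w = dir_deriv u f (w + of_real h * v)" for w
    proof -
      have "((\<lambda>w. w + of_real h * v) has_derivative (\<lambda>w. w)) (at w)" by (auto intro!: derivative_eq_intros)
      from has_derivative_compose[OF this has_derivative_dir_deriv[OF f]]
      have D: "((\<lambda>w. f (w + of_real h * v)) has_derivative (\<lambda>u. dir_deriv u f (w + of_real h * v))) (at w)" .
      show "(\<lambda>w. f (w + of_real h * v)) differentiable (at w)" using D by (auto simp: differentiable_def)
      show "dir_deriv u (\<lambda>w. f (w + of_real h * v)) w = dir_deriv u f (w + of_real h * v)"
        using dir_deriv_eq[OF D] .
    qed
    have Fd: "F differentiable (at w)" for w unfolding F_def by (intro differentiable_diff sh f)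
    have Fu: "dir_deriv u F w = dir_deriv u f (w + of_real h * v) - dir_deriv u f w" for w
      unfolding F_def
      by (subst dir_deriv_eq[OF has_derivative_diff[OF has_derivative_dir_deriv[OF sh] has_derivative_dir_deriv[OF f]]])
        (simp add: shd)
    have "cmod (F (z + of_real h * u) - F z - of_real h * (of_real h * ?A)) \<le> (e * h) * h"
    proof (rule directional_mean_value)
      fix t assume t: "0 \<le> t" "t \<le> h"
      let ?w = "z + of_real t * u"
      have "cmod (dir_deriv u f (?w + of_real h * v) - dir_deriv u f ?w - of_real h * ?A) \<le> e * h"
      proof (rule directional_mean_value)
        fix s assume s: "0 \<le> s" "s \<le> h"
        have "cmod (of_real t * u + of_real s * v) \<le> t + s"
          by (rule order_trans[OF norm_triangle_ineq]) (use s t uv in \<open>simp add: norm_mult\<close>)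
        then have "dist (?w + of_real s * v) z < d" using s t h by (simp add: dist_norm add.assoc)
        from d(2)[OF this] show "cmod (dir_deriv v (dir_deriv u f) (?w + of_real s * v) - ?A) \<le> e"
          by (simp add: dist_norm less_imp_le)
      qed (use h fu in auto)
      then show "cmod (dir_deriv u F ?w - of_real h * ?A) \<le> e * h" by (simp add: Fu)
    qed (use h Fd in auto)
    then show "cmod ((f (z + of_real h * u + of_real h * v) - f (z + of_real h * u)) - (f (z + of_real h * v) - f z)
      - of_real (h\<^sup>2) * ?A) \<le> e * h\<^sup>2"
      by (simp add: F_def power2_eq_square mult.assoc)
  qed (use d in simp)
qed

text \<open>The second difference is symmetric in its two directions, so both mixed derivatives are
  its limit after division by h^2. With one third of their distance as tolerance, the two estimates
  would give 3 e \<le> 2 e.\<close>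

lemma smooth_UNIV_commute:
  assumes f: "f \<in> smooth_functions UNIV"
  shows "dir_deriv \<i> (dir_deriv 1 f) z = dir_deriv 1 (dir_deriv \<i> f) z"
proof (rule ccontr)
  let ?A = "dir_deriv \<i> (dir_deriv 1 f) z" and ?B = "dir_deriv 1 (dir_deriv \<i> f) z"
  assume "?A \<noteq> ?B"
  define e where "e = cmod (?A - ?B) / 3"
  have e: "e > 0" using \<open>?A \<noteq> ?B\<close> by (simp add: e_def)
  note sm = smooth_dir_deriv[OF f]
  have diff: "f differentiable (at w)" "dir_deriv 1 f differentiable (at w)" "dir_deriv \<i> f differentiable (at w)" for w
    using f sm by (auto intro: smooth_differentiable)
  have cont: "isCont (dir_deriv \<i> (dir_deriv 1 f)) z" "isCont (dir_deriv 1 (dir_deriv \<i> f)) z"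
    using smooth_continuous[OF smooth_dir_deriv(2)[OF sm(1)]] smooth_continuous[OF smooth_dir_deriv(1)[OF sm(2)]]
    by (simp_all add: continuous_on_eq_continuous_at)
  obtain d1 where d1: "d1 > 0" "\<And>h. 0 < h \<Longrightarrow> h < d1 \<Longrightarrow>
    cmod ((f (z + of_real h * 1 + of_real h * \<i>) - f (z + of_real h * 1)) - (f (z + of_real h * \<i>) - f z)
      - of_real (h\<^sup>2) * ?A) \<le> e * h\<^sup>2"
    by (rule second_difference_bound[OF diff(1,2) cont(1) _ _ e]) auto
  obtain d2 where d2: "d2 > 0" "\<And>h. 0 < h \<Longrightarrow> h < d2 \<Longrightarrow>
    cmod ((f (z + of_real h * \<i> + of_real h * 1) - f (z + of_real h * \<i>)) - (f (z + of_real h * 1) - f z)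
      - of_real (h\<^sup>2) * ?B) \<le> e * h\<^sup>2"
    by (rule second_difference_bound[OF diff(1,3) cont(2) _ _ e]) auto
  define h where "h = min d1 d2 / 2"
  have h: "0 < h" "h < d1" "h < d2" using d1 d2 by (auto simp: h_def)
  define S where "S = f (z + of_real h * 1 + of_real h * \<i>) - f (z + of_real h * 1) - (f (z + of_real h * \<i>) - f z)"
  have 1: "cmod (S - of_real (h\<^sup>2) * ?A) \<le> e * h\<^sup>2" using d1(2)[OF h(1,2)] by (simp add: S_def)
  have 2: "cmod (S - of_real (h\<^sup>2) * ?B) \<le> e * h\<^sup>2"
    using d2(2)[OF h(1,3)] by (simp add: S_def add_ac algebra_simps)
  have "of_real (h\<^sup>2) * (?A - ?B) = (S - of_real (h\<^sup>2) * ?B) - (S - of_real (h\<^sup>2) * ?A)" by (simp add: algebra_simps)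
  then have "cmod (of_real (h\<^sup>2) * (?A - ?B)) \<le> e * h\<^sup>2 + e * h\<^sup>2"
    using norm_triangle_ineq4[of "S - of_real (h\<^sup>2) * ?B" "S - of_real (h\<^sup>2) * ?A"] 1 2 by (simp only:)
  moreover have "cmod (of_real (h\<^sup>2) * (?A - ?B)) = h\<^sup>2 * (3 * e)" by (simp add: norm_mult norm_power e_def)
  ultimately have "h\<^sup>2 * (3 * e) \<le> h\<^sup>2 * (2 * e)" by (simp only: mult_2 distrib_left mult.commute[of e])
  then have "3 * e \<le> 2 * e" using h by (simp only: mult_le_cancel_left_pos zero_less_power)
  with e show False by simp
qed

lemma smooth_UNIV_dir_deriv_pow:
  assumes "f \<in> smooth_functions UNIV"
  shows "(dir_deriv 1 ^^ a) f \<in> smooth_functions UNIV" "(dir_deriv \<i> ^^ a) f \<in> smooth_functions UNIV"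
  using assms by (induction a) (auto intro: smooth_dir_deriv)

lemma smooth_mixed_partial:
  "f \<in> smooth_functions UNIV \<Longrightarrow> mixed_partial a b f \<in> smooth_functions UNIV"
  unfolding mixed_partial_def by (intro smooth_UNIV_dir_deriv_pow)

lemma mixed_partial_Suc_left: "mixed_partial (Suc a) b f = dir_deriv 1 (mixed_partial a b f)"
  by (simp add: mixed_partial_def)

text \<open>In \<open>mixed_partial\<close> the vertical derivatives are innermost; moving one to
  the outside is where the symmetry of second derivatives is used.\<close>

lemma mixed_partial_Suc_right:
  assumes "f \<in> smooth_functions UNIV"
  shows "mixed_partial a (Suc b) f = dir_deriv \<i> (mixed_partial a b f)"
proof -
  have "(dir_deriv 1 ^^ a) (dir_deriv \<i> g) = dir_deriv \<i> ((dir_deriv 1 ^^ a) g)" if g: "g \<in> smooth_functions UNIV" for g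
  proof (induction a)
    case (Suc a)
    have "(dir_deriv 1 ^^ Suc a) (dir_deriv \<i> g) = dir_deriv 1 (dir_deriv \<i> ((dir_deriv 1 ^^ a) g))"
      by (simp add: Suc)
    also have "\<dots> = dir_deriv \<i> (dir_deriv 1 ((dir_deriv 1 ^^ a) g))"
      by (rule ext, rule smooth_UNIV_commute[symmetric, OF smooth_UNIV_dir_deriv_pow(1)[OF g]])
    finally show ?case by simp
  qed simp
  from this[OF smooth_UNIV_dir_deriv_pow(2)[OF assms]] show ?thesis by (simp add: mixed_partial_def)
qed

lemma dir_deriv_pow_add:
  assumes "v = 1 \<or> v = \<i>" "f \<in> smooth_functions UNIV" "g \<in> smooth_functions UNIV"
  shows "(dir_deriv v ^^ a) (\<lambda>z. f z + g z) = (\<lambda>z. (dir_deriv v ^^ a) f z + (dir_deriv v ^^ a) g z)"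
proof (induction a)
  case (Suc a)
  have "(dir_deriv v ^^ a) f \<in> smooth_functions UNIV" "(dir_deriv v ^^ a) g \<in> smooth_functions UNIV"
    using assms smooth_UNIV_dir_deriv_pow by blast+
  then show ?case by (simp add: Suc fun_eq_iff dir_deriv_add smooth_differentiable)
qed simp

lemma mixed_partial_add:
  assumes "f \<in> smooth_functions UNIV" "g \<in> smooth_functions UNIV"
  shows "mixed_partial a b (\<lambda>z. f z + g z) z = mixed_partial a b f z + mixed_partial a b g z"
  unfolding mixed_partial_def using assms by (simp add: dir_deriv_pow_add smooth_UNIV_dir_deriv_pow)

lemma dir_deriv_pow_cmult:
  assumes "v = 1 \<or> v = \<i>" "f \<in> smooth_functions UNIV"
  shows "(dir_deriv v ^^ a) (\<lambda>z. c * f z) = (\<lambda>z. c * (dir_deriv v ^^ a) f z)"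
proof (induction a)
  case (Suc a)
  have "(dir_deriv v ^^ a) f \<in> smooth_functions UNIV"
    using assms smooth_UNIV_dir_deriv_pow by blast
  then have "dir_deriv v (\<lambda>z. c * (dir_deriv v ^^ a) f z) z = c * dir_deriv v ((dir_deriv v ^^ a) f) z" for z
    by (intro dir_deriv_eq has_derivative_mult_right has_derivative_dir_deriv smooth_differentiable) auto
  then show ?case by (simp add: Suc fun_eq_iff)
qed simp

lemma mixed_partial_cmult:
  assumes "f \<in> smooth_functions UNIV"
  shows "mixed_partial a b (\<lambda>z. c * f z) z = c * mixed_partial a b f z"
  unfolding mixed_partial_def using assms by (simp add: dir_deriv_pow_cmult smooth_UNIV_dir_deriv_pow)

section \<open>Multiplication by polynomials in the C^N topology\<close>

lemma smooth_ident: "open U \<Longrightarrow> (\<lambda>z. z) \<in> smooth_functions U"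
  by (rule smooth_holomorphic) auto

text \<open>The identity has constant derivative \<open>v\<close>, so the Leibniz sum stops after
  two terms. For a = 0 the truncated index a - 1 carries the factor 0.\<close>

lemma dir_deriv_pow_ident_mult:
  assumes v: "v = 1 \<or> v = \<i>" and f: "f \<in> smooth_functions UNIV"
  shows "(dir_deriv v ^^ a) (\<lambda>z. z * f z) = (\<lambda>z. z * (dir_deriv v ^^ a) f z + (of_nat a * v) * (dir_deriv v ^^ (a - 1)) f z)"
proof (induction a)
  case (Suc a)
  have sm: "(dir_deriv v ^^ n) f \<in> smooth_functions UNIV" for n
    using v f smooth_UNIV_dir_deriv_pow by blast
  have d: "((dir_deriv v ^^ n) f has_derivative (\<lambda>u. dir_deriv u ((dir_deriv v ^^ n) f) z)) (at z)" for n z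
    by (intro has_derivative_dir_deriv smooth_differentiable[OF sm]) auto
  have "((\<lambda>z. z * (dir_deriv v ^^ a) f z + (of_nat a * v) * (dir_deriv v ^^ (a - 1)) f z) has_derivative
      (\<lambda>u. z * dir_deriv u ((dir_deriv v ^^ a) f) z + u * (dir_deriv v ^^ a) f z + (of_nat a * v) * dir_deriv u ((dir_deriv v ^^ (a - 1)) f) z)) (at z)" for z
    by (intro has_derivative_add has_derivative_mult has_derivative_mult_right has_derivative_ident d)
  from dir_deriv_eq[OF this]
  have "dir_deriv v (\<lambda>z. z * (dir_deriv v ^^ a) f z + (of_nat a * v) * (dir_deriv v ^^ (a - 1)) f z) z =
      z * dir_deriv v ((dir_deriv v ^^ a) f) z + v * (dir_deriv v ^^ a) f z + (of_nat a * v) * dir_deriv v ((dir_deriv v ^^ (a - 1)) f) z" for z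
    by simp
  moreover have "(of_nat a * v) * dir_deriv v ((dir_deriv v ^^ (a - 1)) f) z = (of_nat a * v) * (dir_deriv v ^^ a) f z" for z
    by (cases a) auto
  ultimately show ?case by (simp add: Suc fun_eq_iff algebra_simps)
qed simp

lemma mixed_partial_ident_mult:
  assumes f: "f \<in> smooth_functions UNIV"
  shows "mixed_partial a b (\<lambda>z. z * f z) z = z * mixed_partial a b f z + of_nat a * mixed_partial (a - 1) b f z
    + (of_nat b * \<i>) * mixed_partial a (b - 1) f z"
proof -
  note sm = smooth_UNIV_dir_deriv_pow[OF f]
  have "mixed_partial a b (\<lambda>z. z * f z) =
      (dir_deriv 1 ^^ a) (\<lambda>z. z * (dir_deriv \<i> ^^ b) f z + (of_nat b * \<i>) * (dir_deriv \<i> ^^ (b - 1)) f z)"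
    unfolding mixed_partial_def by (subst dir_deriv_pow_ident_mult) (use f in auto)
  also have "\<dots> = (\<lambda>z. (dir_deriv 1 ^^ a) (\<lambda>z. z * (dir_deriv \<i> ^^ b) f z) z + (dir_deriv 1 ^^ a) (\<lambda>z. (of_nat b * \<i>) * (dir_deriv \<i> ^^ (b - 1)) f z) z)"
    by (rule dir_deriv_pow_add) (auto intro!: smooth_mult smooth_ident smooth_const sm)
  finally show ?thesis
    by (simp add: dir_deriv_pow_ident_mult dir_deriv_pow_cmult sm mixed_partial_def)
qed

lemma smooth_poly_mult:
  "f \<in> smooth_functions UNIV \<Longrightarrow> (\<lambda>z. poly Q z * f z) \<in> smooth_functions UNIV"
  by (rule smooth_mult[OF open_UNIV smooth_holomorphic[OF open_UNIV]])
    (auto simp: poly_altdef intro!: holomorphic_intros)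

text \<open>Multiplication by \<open>Q\<close> is bounded in the norm built from the partials of
  order at most \<open>N\<close> in each variable. Horner's form c + z Q reduces this to a constant
  factor and a factor z.\<close>

lemma poly_mult_mixed_partial_bound:
  "\<exists>C\<ge>0. \<forall>f B. f \<in> smooth_functions UNIV \<longrightarrow>
     (\<forall>a\<le>N. \<forall>b\<le>N. \<forall>z\<in>disk. cmod (mixed_partial a b f z) \<le> B) \<longrightarrow>
     (\<forall>a\<le>N. \<forall>b\<le>N. \<forall>z\<in>disk. cmod (mixed_partial a b (\<lambda>z. poly Q z * f z) z) \<le> C * B)"
proof (induction Q)
  case 0
  then show ?case by (intro exI[of _ 0]) (simp add: mixed_partial_cmult[of _ _ _ 0, simplified])
next
  case (pCons c Q)
  then obtain C where C: "C \<ge> 0" "\<And>f B a b z. \<lbrakk>f \<in> smooth_functions UNIV;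
     \<forall>a\<le>N. \<forall>b\<le>N. \<forall>z\<in>disk. cmod (mixed_partial a b f z) \<le> B; a \<le> N; b \<le> N; z \<in> disk\<rbrakk> \<Longrightarrow>
     cmod (mixed_partial a b (\<lambda>z. poly Q z * f z) z) \<le> C * B" by blast
  show ?case
  \<comment> \<open>The three summands in the bracket come from the Leibniz terms for z Q: |z| \<le>
    1 on the disk, and one term with factor at most \<open>N\<close> per coordinate
    direction.\<close>
  proof (intro exI[of _ "cmod c + (1 + real N + real N) * C"] conjI allI impI ballI)
    fix f B a b z
    assume f: "f \<in> smooth_functions UNIV"
      and B: "\<forall>a\<le>N. \<forall>b\<le>N. \<forall>z\<in>disk. cmod (mixed_partial a b f z) \<le> B"
      and ab: "a \<le> N" "b \<le> N" and z: "z \<in> disk"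
    let ?g = "\<lambda>z. poly Q z * f z"
    have g: "?g \<in> smooth_functions UNIV" by (rule smooth_poly_mult[OF f])
    have gB: "cmod (mixed_partial a b ?g z) \<le> C * B" if "a \<le> N" "b \<le> N" for a b
      by (rule C(2)[OF f B that z])
    have B0: "0 \<le> B" using order_trans[OF norm_ge_zero B[rule_format, OF le0 le0 z]] .
    have "mixed_partial a b (\<lambda>z. poly (pCons c Q) z * f z) z = mixed_partial a b (\<lambda>z. c * f z + z * ?g z) z"
      by (simp add: algebra_simps)
    also have "\<dots> = c * mixed_partial a b f z + (z * mixed_partial a b ?g z + of_nat a * mixed_partial (a - 1) b ?g z
        + (of_nat b * \<i>) * mixed_partial a (b - 1) ?g z)"
      by (subst mixed_partial_add) (auto intro!: smooth_mult smooth_ident smooth_const f g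
          simp: mixed_partial_cmult[OF f] mixed_partial_ident_mult[OF g])
    also have "cmod \<dots> \<le> cmod c * B + (1 * (C * B) + real N * (C * B) + real N * (C * B))"
    proof (intro order_trans[OF norm_triangle_ineq] add_mono)
      have CB: "0 \<le> C * B" using C(1) B0 by simp
      show "cmod (c * mixed_partial a b f z) \<le> cmod c * B"
        using B ab z by (simp add: norm_mult mult_left_mono)
      show "cmod (z * mixed_partial a b ?g z) \<le> 1 * (C * B)"
        unfolding norm_mult using z gB[OF ab] CB by (intro mult_mono) auto
      show "cmod (of_nat a * mixed_partial (a - 1) b ?g z) \<le> real N * (C * B)"
        unfolding norm_mult using ab CB by (intro mult_mono gB) auto
      show "cmod ((of_nat b * \<i>) * mixed_partial a (b - 1) ?g z) \<le> real N * (C * B)"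
        unfolding norm_mult using ab CB by (intro mult_mono gB) auto
    qed
    finally show "cmod (mixed_partial a b (\<lambda>z. poly (pCons c Q) z * f z) z) \<le> (cmod c + (1 + real N + real N) * C) * B"
      by (simp add: algebra_simps)
  qed (use C in auto)
qed


section \<open>Polynomials in shifted real coordinates\<close>

abbreviation xco :: "complex \<Rightarrow> complex" where "xco z \<equiv> of_real (Re z + 1)"
abbreviation yco :: "complex \<Rightarrow> complex" where "yco z \<equiv> of_real (Im z + 1)"

text \<open>The shift by 1 makes the coordinates vanish on the left and bottom edges of the square
  [-1,1]^2, so antiderivatives starting from these edges only raise exponents. Lists of
  (coefficient, exponents) let differentiation act on the data.\<close>

definition xy_poly :: "(complex \<times> nat \<times> nat) list \<Rightarrow> complex \<Rightarrow> complex" where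
  "xy_poly xs z = (\<Sum>(c,i,j)\<leftarrow>xs. c * (xco z ^ i * yco z ^ j))"

text \<open>The falling factorial i (i-1) ... (i-a+1). For a > i it contains the factor 0, which
  cancels monomials whose exponent i - a is truncated at 0.\<close>

definition falling :: "nat \<Rightarrow> nat \<Rightarrow> complex" where
  "falling i a = (\<Prod>l<a. of_nat (i - l))"

lemma falling_nonzero: "falling (i + N) N \<noteq> 0"
  unfolding falling_def of_nat_prod[symmetric] of_nat_eq_0_iff by auto

lemma xy_poly_simps:
  "xy_poly [] = (\<lambda>_. 0)"
  "xy_poly ((c,i,j) # xs) = (\<lambda>z. c * (xco z ^ i * yco z ^ j) + xy_poly xs z)"
  "xy_poly (xs @ ys) z = xy_poly xs z + xy_poly ys z"
  by (auto simp: xy_poly_def fun_eq_iff)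

lemma has_derivative_xy_poly:
  "(xy_poly xs has_derivative (\<lambda>v. of_real (Re v) * xy_poly (map (\<lambda>(c,i,j). (c * of_nat i, i - 1, j)) xs) z
      + of_real (Im v) * xy_poly (map (\<lambda>(c,i,j). (c * of_nat j, i, j - 1)) xs) z)) (at z)"
proof (induction xs)
  case Nil
  then show ?case by (simp add: xy_poly_simps)
next
  case (Cons x xs)
  obtain c i j where x: "x = (c,i,j)" by (cases x) auto
  have X: "((\<lambda>z. xco z ^ i) has_derivative (\<lambda>v. of_nat i * of_real (Re v) * xco z ^ (i - 1))) (at z)"
    by (auto intro!: derivative_eq_intros has_derivative_power simp: bounded_linear_Re bounded_linear_of_real)
  have Y: "((\<lambda>z. yco z ^ j) has_derivative (\<lambda>v. of_nat j * of_real (Im v) * yco z ^ (j - 1))) (at z)"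
    by (auto intro!: derivative_eq_intros has_derivative_power simp: bounded_linear_Im bounded_linear_of_real)
  show ?case unfolding x xy_poly_simps
    by (rule has_derivative_eq_rhs[OF has_derivative_add[OF has_derivative_mult_right[OF has_derivative_mult[OF X Y]] Cons.IH]])
      (simp add: fun_eq_iff xy_poly_simps algebra_simps)
qed

lemma dir_deriv_xy_poly:
  "dir_deriv 1 (xy_poly xs) = xy_poly (map (\<lambda>(c,i,j). (c * of_nat i, i - 1, j)) xs)"
  "dir_deriv \<i> (xy_poly xs) = xy_poly (map (\<lambda>(c,i,j). (c * of_nat j, i, j - 1)) xs)"
  by (rule ext, simp add: dir_deriv_eq[OF has_derivative_xy_poly])+

lemma xy_poly_differentiable: "xy_poly xs differentiable (at z)"
  using has_derivative_xy_poly unfolding differentiable_def by blast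

lemma smooth_xy_poly: "xy_poly xs \<in> smooth_functions U"
proof -
  have "Ck_on k U (xy_poly xs)" for k
  proof (induction k arbitrary: xs)
    case 0
    then show ?case
      using xy_poly_differentiable by (auto intro!: continuous_at_imp_continuous_on differentiable_imp_continuous_within)
  next
    case (Suc k)
    then show ?case by (simp add: dir_deriv_xy_poly xy_poly_differentiable)
  qed
  then show ?thesis by (simp add: smooth_functions_def)
qed

lemma mixed_partial_xy_poly:
  "mixed_partial a b (xy_poly xs) = xy_poly (map (\<lambda>(c,i,j). (c * falling i a * falling j b, i - a, j - b)) xs)"
proof -
  have y: "(dir_deriv \<i> ^^ b) (xy_poly xs) = xy_poly (map (\<lambda>(c,i,j). (c * falling j b, i, j - b)) xs)" for xs
  proof (induction b)
    case 0
    then show ?case by (simp add: falling_def case_prod_unfold)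
  next
    case (Suc b)
    then show ?case
      by (simp add: dir_deriv_xy_poly falling_def o_def case_prod_unfold mult.assoc)
  qed
  have x: "(dir_deriv 1 ^^ a) (xy_poly xs) = xy_poly (map (\<lambda>(c,i,j). (c * falling i a, i - a, j)) xs)" for xs
  proof (induction a)
    case 0
    then show ?case by (simp add: falling_def case_prod_unfold)
  next
    case (Suc a)
    then show ?case
      by (simp add: dir_deriv_xy_poly falling_def o_def case_prod_unfold mult.assoc)
  qed
  show ?thesis
    by (simp add: mixed_partial_def x y o_def case_prod_unfold mult_ac)
qed

lemma real_polynomial_function_xy_poly:
  fixes p :: "complex \<Rightarrow> real"
  assumes "real_polynomial_function p"
  shows "\<exists>xs. \<forall>z. of_real (p z) = xy_poly xs z"
  using assms
proof (induction p rule: real_polynomial_function.induct)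
  case (linear f)
  have fz: "f z = Re z * f 1 + Im z * f \<i>" for z
  proof -
    have "z = Re z *\<^sub>R 1 + Im z *\<^sub>R \<i>" by (simp add: complex_eq_iff)
    then have "f z = f (Re z *\<^sub>R 1 + Im z *\<^sub>R \<i>)" by (rule arg_cong)
    also have "\<dots> = Re z * f 1 + Im z * f \<i>"
      by (simp only: linear_add[OF bounded_linear.linear[OF linear]] linear_scale[OF bounded_linear.linear[OF linear]] real_scaleR_def)
    finally show ?thesis .
  qed
  \<comment> \<open>Re z and Im z are the shifted coordinates minus 1, hence the constant
    term.\<close>
  have "of_real (f z) = xy_poly [(of_real (f 1), 1, 0), (of_real (f \<i>), 0, 1), (of_real (- f 1 - f \<i>), 0, 0)] z" for z
    unfolding fz[of z] xy_poly_def by (simp add: algebra_simps)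
  then show ?case by blast
next
  case (const c)
  have "of_real c = xy_poly [(of_real c, 0, 0)] z" for z by (simp add: xy_poly_def)
  then show ?case by blast
next
  case (add f g)
  then obtain xs ys where "\<And>z. of_real (f z) = xy_poly xs z" "\<And>z. of_real (g z) = xy_poly ys z" by blast
  then have "of_real (f z + g z) = xy_poly (xs @ ys) z" for z by (simp add: xy_poly_simps)
  then show ?case by blast
next
  case (mult f g)
  then obtain xs ys where eq: "\<And>z. of_real (f z) = xy_poly xs z" "\<And>z. of_real (g z) = xy_poly ys z" by blast
  have one: "\<exists>zs. \<forall>z. (c * (xco z ^ i * yco z ^ j)) * xy_poly ys z = xy_poly zs z" for c i j
    by (rule exI[of _ "map (\<lambda>(d,k,l). (c * d, i + k, j + l)) ys"], induction ys)
      (auto simp: xy_poly_simps power_add algebra_simps)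
  have "\<exists>zs. \<forall>z. xy_poly xs z * xy_poly ys z = xy_poly zs z"
  proof (induction xs)
    case Nil
    then show ?case by (intro exI[of _ "[]"]) (simp add: xy_poly_simps)
  next
    case (Cons x xs)
    obtain c i j where x: "x = (c,i,j)" by (cases x) auto
    obtain zs where zs: "\<And>z. xy_poly xs z * xy_poly ys z = xy_poly zs z" using Cons.IH by blast
    obtain ws where ws: "\<And>z. (c * (xco z ^ i * yco z ^ j)) * xy_poly ys z = xy_poly ws z" using one[of c i j] by blast
    have "xy_poly (x # xs) z * xy_poly ys z = xy_poly (ws @ zs) z" for z
      unfolding x xy_poly_simps distrib_right ws zs ..
    then show ?case by blast
  qed
  then show ?case by (simp add: eq)
qed

lemma xy_poly_uniform_approx:
  assumes "compact S" "continuous_on S g" "e > 0"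
  obtains xs where "\<And>z. z \<in> S \<Longrightarrow> cmod (g z - xy_poly xs z) < e"
proof -
  obtain p where p: "polynomial_function p" "\<And>z. z \<in> S \<Longrightarrow> cmod (g z - p z) < e"
    using Stone_Weierstrass_polynomial_function[OF assms] by blast
  note rp = p(1)[unfolded polynomial_function_def, rule_format]
  obtain xs where xs: "\<forall>z. of_real (Re (p z)) = xy_poly xs z"
    using real_polynomial_function_xy_poly[OF rp[OF bounded_linear_Re]] unfolding o_def by (rule exE)
  obtain ys where ys: "\<forall>z. of_real (Im (p z)) = xy_poly ys z"
    using real_polynomial_function_xy_poly[OF rp[OF bounded_linear_Im]] unfolding o_def by (rule exE)
  note xy = xs[rule_format] ys[rule_format]
  have "xy_poly (map (\<lambda>(c,i,j). (\<i> * c, i, j)) ys) z = \<i> * xy_poly ys z" for z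
    by (induction ys) (auto simp: xy_poly_simps algebra_simps)
  then have "p z = xy_poly (xs @ map (\<lambda>(c,i,j). (\<i> * c, i, j)) ys) z" for z
    by (simp only: xy_poly_simps xy[symmetric] complex_eq[symmetric])
  with p(2) show ?thesis by (intro that[of "xs @ map (\<lambda>(c,i,j). (\<i> * c, i, j)) ys"]) simp
qed

text \<open>Approximating \<psi> itself gives no control of derivatives. Instead the derivative of
  order (N,N) is approximated by Stone-Weierstrass and integrated back N times in each variable.
  \<psi> vanishes on the left and bottom edges of the square, so no boundary terms arise.\<close>

lemma smooth_compact_support_approx:
  fixes N :: nat
  assumes \<psi>: "\<psi> \<in> smooth_functions UNIV" and K: "compact K" "K \<subseteq> disk" and zero: "\<And>z. z \<notin> K \<Longrightarrow> \<psi> z = 0" and e: "\<epsilon> > 0"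
  obtains xs where "\<And>a b z. a \<le> N \<Longrightarrow> b \<le> N \<Longrightarrow> z \<in> disk \<Longrightarrow>
    cmod (mixed_partial a b (\<lambda>z. \<psi> z + xy_poly xs z) z) \<le> \<epsilon>"
proof -
  \<comment> \<open>In a square, unlike the disk, horizontal and vertical paths from the edges stay
    inside.\<close>
  define S where "S = cbox (Complex (-1) (-1)) (Complex 1 1)"
  have S_iff: "z \<in> S \<longleftrightarrow> -1 \<le> Re z \<and> Re z \<le> 1 \<and> -1 \<le> Im z \<and> Im z \<le> 1" for z
    by (auto simp: S_def in_cbox_complex_iff)
  \<comment> \<open>Each of at most N + N integrations runs over a length of at most 2 and so at
    most doubles the error.\<close>
  define \<delta> where "\<delta> = \<epsilon> / 2 ^ (N + N)"
  have \<delta>: "\<delta> > 0" using e by (simp add: \<delta>_def)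
  have "continuous_on S (mixed_partial N N \<psi>)"
    using smooth_continuous[OF smooth_mixed_partial[OF \<psi>]] by (rule continuous_on_subset) simp
  then obtain ys where ys: "\<And>z. z \<in> S \<Longrightarrow> cmod (mixed_partial N N \<psi> z - xy_poly ys z) < \<delta>"
    using xy_poly_uniform_approx[of S _ \<delta>] \<delta> by (auto simp: S_def)
  \<comment> \<open>The negative of the N-fold antiderivative in both variables of the approximating
    polynomial; it vanishes to order \<open>N\<close> on both edges.\<close>
  define xs where "xs = map (\<lambda>(c,i,j). (- c / (falling (i + N) N * falling (j + N) N), i + N, j + N)) ys"
  define E where "E = (\<lambda>z. \<psi> z + xy_poly xs z)"
  have E: "E \<in> smooth_functions UNIV" unfolding E_def by (intro smooth_add \<psi> smooth_xy_poly) simp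
  have mpE: "mixed_partial a b E z = mixed_partial a b \<psi> z + mixed_partial a b (xy_poly xs) z" for a b z
    unfolding E_def by (rule mixed_partial_add[OF \<psi> smooth_xy_poly])
  have "mixed_partial N N (xy_poly xs) z = - xy_poly ys z" for z
  proof -
    have "mixed_partial N N (xy_poly xs) z = xy_poly (map (\<lambda>(c,i,j). (- c, i, j)) ys) z"
      by (simp add: mixed_partial_xy_poly xs_def o_def case_prod_unfold falling_nonzero)
    also have "\<dots> = - xy_poly ys z" by (induction ys) (auto simp: xy_poly_simps)
    finally show ?thesis .
  qed
  then have top: "cmod (mixed_partial N N E z) \<le> \<delta>" if "z \<in> S" for z
    using ys[OF that] by (simp add: mpE)
  have \<psi>0: "mixed_partial a b \<psi> z = 0" if "z \<notin> disk" for a b z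
  proof -
    have "mixed_partial a b \<psi> z = mixed_partial a b (\<lambda>_. 0) z"
      by (rule mixed_partial_cong[of "- K"]) (use K that zero in \<open>auto simp: compact_imp_closed\<close>)
    then show ?thesis by (simp add: mixed_partial_zero)
  qed
  have left0: "mixed_partial a b E z = 0" if "Re z = -1" "a < N" for a b z
  proof -
    have "\<bar>Re z\<bar> \<le> cmod z" by (rule abs_Re_le_cmod)
    then have "z \<notin> disk" using that by simp
    moreover have "mixed_partial a b (xy_poly xs) z = 0"
      unfolding mixed_partial_xy_poly xs_def
      by (induction ys) (use that in \<open>auto simp: xy_poly_simps\<close>)
    ultimately show ?thesis by (simp add: mpE \<psi>0)
  qed
  have bottom0: "mixed_partial a b E z = 0" if "Im z = -1" "b < N" for a b z
  proof -
    have "\<bar>Im z\<bar> \<le> cmod z" by (rule abs_Im_le_cmod)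
    then have "z \<notin> disk" using that by simp
    moreover have "mixed_partial a b (xy_poly xs) z = 0"
      unfolding mixed_partial_xy_poly xs_def
      by (induction ys) (use that in \<open>auto simp: xy_poly_simps\<close>)
    ultimately show ?thesis by (simp add: mpE \<psi>0)
  qed
  have diff: "mixed_partial a b E differentiable (at z)" for a b z
    by (rule smooth_differentiable[OF smooth_mixed_partial[OF E]]) simp
  \<comment> \<open>One integration step: from a zero of \<open>F\<close> on an edge, move a
    distance of at most 2 along \<open>v\<close>.\<close>
  have walk: "cmod (F (z0 + of_real h * v)) \<le> 2 * B"
    if "\<And>z. F differentiable (at z)" "0 \<le> h" "h \<le> 2" "F z0 = 0"
      "\<And>t. 0 \<le> t \<Longrightarrow> t \<le> h \<Longrightarrow> cmod (dir_deriv v F (z0 + of_real t * v)) \<le> B" for F z0 v h B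
  proof -
    have "cmod (F (z0 + of_real h * v) - F z0 - of_real h * 0) \<le> B * h"
      by (rule directional_mean_value) (use that in auto)
    moreover have "B \<ge> 0" using order_trans[OF norm_ge_zero that(5)[of 0]] that(2) by simp
    then have "B * h \<le> B * 2" using that(3) by (intro mult_left_mono) auto
    ultimately show ?thesis using that(4) by simp
  qed
  have down_y: "d \<le> N \<Longrightarrow> z \<in> S \<Longrightarrow> cmod (mixed_partial N (N - d) E z) \<le> 2 ^ d * \<delta>" for d z
  proof (induction d arbitrary: z)
    case 0
    then show ?case using top by simp
  next
    case (Suc d)
    have b: "Suc (N - Suc d) = N - d" using Suc.prems by simp
    have dd: "dir_deriv \<i> (mixed_partial N (N - Suc d) E) = mixed_partial N (N - d) E"
      using mixed_partial_Suc_right[OF E, of N "N - Suc d"] b by simp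
    have "cmod (mixed_partial N (N - Suc d) E (Complex (Re z) (-1) + of_real (Im z + 1) * \<i>)) \<le> 2 * (2 ^ d * \<delta>)"
    proof (rule walk)
      show "mixed_partial N (N - Suc d) E (Complex (Re z) (-1)) = 0" using Suc.prems by (intro bottom0) auto
      fix t assume t: "0 \<le> t" "t \<le> Im z + 1"
      show "cmod (dir_deriv \<i> (mixed_partial N (N - Suc d) E) (Complex (Re z) (-1) + of_real t * \<i>)) \<le> 2 ^ d * \<delta>"
        unfolding dd by (rule Suc.IH) (use Suc.prems t in \<open>auto simp: S_iff\<close>)
    qed (use Suc.prems diff in \<open>auto simp: S_iff\<close>)
    moreover have "Complex (Re z) (-1) + of_real (Im z + 1) * \<i> = z" by (simp add: complex_eq_iff)
    ultimately show ?case by simp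
  qed
  \<comment> \<open>The order matters: \<open>bottom0\<close> lowers the second index with the first
    one fixed at \<open>N\<close>, after which \<open>left0\<close> lowers the first index for every
    value of the second.\<close>
  have down_x: "c \<le> N \<Longrightarrow> d \<le> N \<Longrightarrow> z \<in> S \<Longrightarrow> cmod (mixed_partial (N - c) (N - d) E z) \<le> 2 ^ c * (2 ^ d * \<delta>)" for c d z
  proof (induction c arbitrary: z)
    case 0
    then show ?case using down_y by simp
  next
    case (Suc c)
    have a: "Suc (N - Suc c) = N - c" using Suc.prems by simp
    have dd: "dir_deriv 1 (mixed_partial (N - Suc c) (N - d) E) = mixed_partial (N - c) (N - d) E"
      using mixed_partial_Suc_left[of "N - Suc c" "N - d" E] a by simp
    have "cmod (mixed_partial (N - Suc c) (N - d) E (Complex (-1) (Im z) + of_real (Re z + 1) * 1)) \<le> 2 * (2 ^ c * (2 ^ d * \<delta>))"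
    proof (rule walk)
      show "mixed_partial (N - Suc c) (N - d) E (Complex (-1) (Im z)) = 0" using Suc.prems by (intro left0) auto
      fix t assume t: "0 \<le> t" "t \<le> Re z + 1"
      show "cmod (dir_deriv 1 (mixed_partial (N - Suc c) (N - d) E) (Complex (-1) (Im z) + of_real t * 1)) \<le> 2 ^ c * (2 ^ d * \<delta>)"
        unfolding dd by (rule Suc.IH) (use Suc.prems t in \<open>auto simp: S_iff\<close>)
    qed (use Suc.prems diff in \<open>auto simp: S_iff\<close>)
    moreover have "Complex (-1) (Im z) + of_real (Re z + 1) * 1 = z" by (simp add: complex_eq_iff)
    ultimately show ?case by simp
  qed
  show ?thesis
  proof (rule that[of xs])
    fix a b z assume ab: "a \<le> N" "b \<le> N" and z: "z \<in> disk"
    have "\<bar>Re z\<bar> \<le> 1" "\<bar>Im z\<bar> \<le> 1"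
      using order_trans[OF abs_Re_le_cmod[of z]] order_trans[OF abs_Im_le_cmod[of z]] z by auto
    then have zS: "z \<in> S" by (auto simp: S_iff)
    have "cmod (mixed_partial (N - (N - a)) (N - (N - b)) E z) \<le> 2 ^ (N - a) * (2 ^ (N - b) * \<delta>)"
      by (rule down_x) (use zS in auto)
    also have "\<dots> \<le> 2 ^ N * (2 ^ N * \<delta>)"
      using \<delta> by (intro mult_mono power_increasing) auto
    also have "\<dots> = \<epsilon>" by (simp add: \<delta>_def power_add)
    finally show "cmod (mixed_partial a b (\<lambda>z. \<psi> z + xy_poly xs z) z) \<le> \<epsilon>"
      using ab by (simp add: E_def)
  qed
qed

section \<open>From annihilated polynomials to the support of G\<close>

lemma annihilates_xy_poly:
  assumes G: "G \<in> compact_distributions" and ann: "\<And>p q. poly_pairing G (Q * p) q = 0"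
  shows "G (\<lambda>z. poly Q z * xy_poly xs z) = 0"
proof -
  have sm: "(\<lambda>z. poly (Q * p) z * poly q (cnj z) * (xco z ^ i * yco z ^ j)) \<in> smooth_functions disk" for p q i j
  proof -
    have "xy_poly [(1,i,j)] = (\<lambda>z. xco z ^ i * yco z ^ j)" by (simp add: xy_poly_def fun_eq_iff)
    with smooth_xy_poly[of "[(1,i,j)]" disk] have "(\<lambda>z. xco z ^ i * yco z ^ j) \<in> smooth_functions disk" by simp
    from smooth_mult[OF open_ball smooth_pairing[OF holomorphic_poly holomorphic_poly] this] show ?thesis .
  qed
  have x: "xco z = 1 + (1/2) * z + (1/2) * cnj z" and y: "yco z = 1 - (\<i>/2) * z + (\<i>/2) * cnj z" for z
    by (auto simp: complex_eq_iff)
  \<comment> \<open>Each shifted coordinate is an affine combination of z and \<open>cnj z\<close>.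
    The induction strips off one coordinate factor at a time, absorbing z into \<open>p\<close> and
    \<open>cnj z\<close> into \<open>q\<close>.\<close>
  have zero: "G (\<lambda>z. poly (Q * p) z * poly q (cnj z) * (xco z ^ i * yco z ^ j)) = 0" for p q i j
  proof (induction i arbitrary: p q)
    case 0
    show ?case
    proof (induction j arbitrary: p q)
      case 0
      then show ?case using ann[of p q] by (simp add: poly_pairing_def)
    next
      case (Suc j)
      have "(\<lambda>z. poly (Q * p) z * poly q (cnj z) * (xco z ^ 0 * yco z ^ Suc j)) =
         (\<lambda>z. poly (Q * (p + Polynomial.smult (- \<i>/2) (pCons 0 p))) z * poly q (cnj z) * (xco z ^ 0 * yco z ^ j)
           + poly (Q * p) z * poly (Polynomial.smult (\<i>/2) (pCons 0 q)) (cnj z) * (xco z ^ 0 * yco z ^ j))"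
        unfolding power_Suc y by (simp add: fun_eq_iff algebra_simps)
      then show ?case
        by (simp only: distribution_add[OF G sm sm] Suc.IH add_0)
    qed
  next
    case (Suc i)
    have "(\<lambda>z. poly (Q * p) z * poly q (cnj z) * (xco z ^ Suc i * yco z ^ j)) =
       (\<lambda>z. poly (Q * (p + Polynomial.smult (1/2) (pCons 0 p))) z * poly q (cnj z) * (xco z ^ i * yco z ^ j)
         + poly (Q * p) z * poly (Polynomial.smult (1/2) (pCons 0 q)) (cnj z) * (xco z ^ i * yco z ^ j))"
      unfolding power_Suc x by (simp add: fun_eq_iff algebra_simps)
    then show ?case
      by (simp only: distribution_add[OF G sm sm] Suc.IH add_0)
  qed
  have smQ: "(\<lambda>z. poly Q z * xy_poly xs z) \<in> smooth_functions disk" for xs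
    by (intro smooth_mult smooth_holomorphic holomorphic_poly smooth_xy_poly) auto
  show ?thesis
  proof (induction xs)
    case Nil
    then show ?case using distribution_cmult[OF G smQ[of "[]"], of 0] by (simp add: xy_poly_simps)
  next
    case (Cons x xs)
    obtain c i j where x: "x = (c,i,j)" by (cases x) auto
    have eq: "(\<lambda>z. poly Q z * xy_poly (x # xs) z) =
      (\<lambda>z. poly (Q * [:c:]) z * poly 1 (cnj z) * (xco z ^ i * yco z ^ j) + poly Q z * xy_poly xs z)"
      by (simp add: x xy_poly_simps fun_eq_iff algebra_simps)
    show ?case unfolding eq
      by (subst distribution_add[OF G sm smQ]) (simp only: zero Cons.IH add_0)
  qed
qed

text \<open>Away from the zeros of \<open>Q\<close> a test function is divisible by
  \<open>Q\<close>. The quotient is approximated by polynomials, multiplication by \<open>Q\<close>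
  keeps the error small, and G annihilates \<open>Q\<close> times every polynomial.\<close>

lemma annihilated_test_function:
  assumes G: "G \<in> compact_distributions" and ann: "\<And>p q. poly_pairing G (Q * p) q = 0"
    and \<phi>: "\<phi> \<in> test_functions (disk - {z. poly Q z = 0})"
  shows "G \<phi> = 0"
proof -
  obtain K where K: "compact K" "K \<subseteq> disk - {z. poly Q z = 0}" "\<And>z. z \<in> disk \<Longrightarrow> z \<notin> K \<Longrightarrow> \<phi> z = 0"
    and sm: "\<phi> \<in> smooth_functions disk"
    using \<phi> unfolding test_functions_def by auto
  define U where "U = disk \<inter> {z. poly Q z \<noteq> 0}"
  have "open {z. poly Q z \<noteq> 0}"
    by (rule open_Collect_neq) (auto intro!: continuous_intros)
  then have U: "open U" unfolding U_def by (intro open_Int open_ball)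
  have KU: "K \<subseteq> U" using K(2) by (auto simp: U_def)
  \<comment> \<open>Outside \<open>K\<close> the value is set to 0, which also discards the
    arbitrary values of \<phi> beyond the disk. Smoothness is glued from the open sets
    \<open>U\<close>, where \<psi> is \<phi> / Q, and - K, where it is 0; they cover the plane since
    K \<subseteq> U.\<close>
  define \<psi> where "\<psi> z = (if z \<in> K then \<phi> z / poly Q z else 0)" for z
  have \<psi>sm: "\<psi> \<in> smooth_functions UNIV"
  proof -
    have sm1: "(\<lambda>z. \<phi> z * inverse (poly Q z)) \<in> smooth_functions U"
      by (intro smooth_mult U smooth_subset[OF sm] smooth_holomorphic holomorphic_on_inverse holomorphic_poly)
        (auto simp: U_def)
    have eqU: "\<psi> w = \<phi> w * inverse (poly Q w)" if "w \<in> U" for w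
      using K(3)[of w] that by (auto simp: \<psi>_def U_def divide_inverse)
    note 1 = iffD2[OF smooth_cong[of U \<psi> "\<lambda>z. \<phi> z * inverse (poly Q z)", OF U eqU] sm1]
    have op: "open (- K)" using K(1) by (simp add: compact_imp_closed open_Compl)
    have eqK: "\<psi> w = 0" if "w \<in> - K" for w using that by (simp add: \<psi>_def)
    note 2 = iffD2[OF smooth_cong[of "- K" \<psi> "\<lambda>_. 0", OF op eqK] smooth_const[OF op]]
    have "\<psi> \<in> smooth_functions (U \<union> - K)" by (rule smooth_Un[OF U op 1 2])
    moreover have "U \<union> - K = UNIV" using KU by auto
    ultimately show ?thesis by simp
  qed
  have Q\<psi>: "poly Q z * \<psi> z = \<phi> z" if "z \<in> disk" for z
    using K(2,3) that by (auto simp: \<psi>_def)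
  have smQ\<psi>: "(\<lambda>z. poly Q z * \<psi> z) \<in> smooth_functions disk"
    by (rule smooth_subset[OF smooth_poly_mult[OF \<psi>sm]]) simp
  have eq: "G \<phi> = G (\<lambda>z. poly Q z * \<psi> z)"
    by (rule distribution_cong[OF G sm smQ\<psi>]) (simp add: Q\<psi>)
  obtain K' N C where K': "K' \<subseteq> disk" and C0: "C \<ge> 0" and
    C: "\<And>\<phi> B. \<lbrakk>\<phi> \<in> smooth_functions disk;
       \<And>a b z. a \<le> N \<Longrightarrow> b \<le> N \<Longrightarrow> z \<in> K' \<Longrightarrow> cmod (mixed_partial a b \<phi> z) \<le> B\<rbrakk> \<Longrightarrow> cmod (G \<phi>) \<le> C * B"
    by (rule distribution_bound[OF G]) blast
  obtain D where D0: "D \<ge> 0" and D: "\<forall>f B. f \<in> smooth_functions UNIV \<longrightarrow>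
     (\<forall>a\<le>N. \<forall>b\<le>N. \<forall>z\<in>disk. cmod (mixed_partial a b f z) \<le> B) \<longrightarrow>
     (\<forall>a\<le>N. \<forall>b\<le>N. \<forall>z\<in>disk. cmod (mixed_partial a b (\<lambda>z. poly Q z * f z) z) \<le> D * B)"
    using poly_mult_mixed_partial_bound[of N Q] by blast
  have small: "cmod (G \<phi>) \<le> (C * D) * \<epsilon>" if e: "\<epsilon> > 0" for \<epsilon>
  proof -
    have Kd: "K \<subseteq> disk" using K(2) by blast
    obtain xs where xs: "\<And>a b z. a \<le> N \<Longrightarrow> b \<le> N \<Longrightarrow> z \<in> disk \<Longrightarrow>
        cmod (mixed_partial a b (\<lambda>z. \<psi> z + xy_poly xs z) z) \<le> \<epsilon>"
      by (rule smooth_compact_support_approx[OF \<psi>sm K(1) Kd _ e, of N]) (auto simp: \<psi>_def)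
    let ?E = "\<lambda>z. \<psi> z + xy_poly xs z"
    have Esm: "?E \<in> smooth_functions UNIV" by (intro smooth_add \<psi>sm smooth_xy_poly open_UNIV)
    have "G (\<lambda>z. poly Q z * ?E z) = G (\<lambda>z. poly Q z * \<psi> z + poly Q z * xy_poly xs z)"
      by (simp add: algebra_simps)
    also have "\<dots> = G \<phi>"
      unfolding eq distribution_add[OF G smQ\<psi> smooth_subset[OF smooth_poly_mult[OF smooth_xy_poly] subset_UNIV]]
        annihilates_xy_poly[OF G ann] by simp
    finally have GE: "G \<phi> = G (\<lambda>z. poly Q z * ?E z)" by simp
    have "cmod (G (\<lambda>z. poly Q z * ?E z)) \<le> C * (D * \<epsilon>)"
    proof (rule C)
      show "(\<lambda>z. poly Q z * ?E z) \<in> smooth_functions disk"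
        by (rule smooth_subset[OF smooth_poly_mult[OF Esm]]) simp
      fix a b z assume "a \<le> N" "b \<le> N" "z \<in> K'"
      then show "cmod (mixed_partial a b (\<lambda>z. poly Q z * ?E z) z) \<le> D * \<epsilon>"
        using D[rule_format, OF Esm xs] K' by blast
    qed
    then show ?thesis by (simp add: GE mult.assoc)
  qed
  show ?thesis
  proof (rule ccontr)
    assume "G \<phi> \<noteq> 0"
    define \<epsilon> where "\<epsilon> = cmod (G \<phi>) / (2 * (C * D + 1))"
    have CD: "C * D \<ge> 0" using C0 D0 by simp
    have "\<epsilon> > 0" using \<open>G \<phi> \<noteq> 0\<close> CD by (simp add: \<epsilon>_def)
    from small[OF this] have "cmod (G \<phi>) \<le> (C * D) * \<epsilon>" .
    also have "\<dots> < (2 * (C * D + 1)) * \<epsilon>" using \<open>\<epsilon> > 0\<close> CD by (intro mult_strict_right_mono) auto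
    also have "\<dots> = cmod (G \<phi>)" using CD by (simp add: \<epsilon>_def)
    finally show False by simp
  qed
qed

lemma finite_support_of_annihilator:
  assumes G: "G \<in> compact_distributions" and Q: "Q \<noteq> 0" and ann: "\<And>p q. poly_pairing G (Q * p) q = 0"
  shows "finite (distr_support G)"
proof (rule finite_subset)
  show "finite {z. poly Q z = 0}" using Q by (rule poly_roots_finite)
  have "open {z. poly Q z \<noteq> 0}"
    by (rule open_Collect_neq) (auto intro!: continuous_intros)
  then have "open (disk \<inter> {z. poly Q z \<noteq> 0})" by (intro open_Int open_ball)
  moreover have "disk \<inter> {z. poly Q z \<noteq> 0} = disk - {z. poly Q z = 0}" by auto
  ultimately have "open (disk - {z. poly Q z = 0})" by simp
  then show "distr_support G \<subseteq> {z. poly Q z = 0}"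
    unfolding distr_support_def using annihilated_test_function[OF G ann] by blast
qed

section \<open>Lebesgue measure on the disk\<close>

text \<open>Both measures agree on boxes. The identification with a product makes Fubini's theorem
  available on the complex plane.\<close>

lemma lborel_complex_pair:
  "distr (lborel \<Otimes>\<^sub>M lborel) borel (\<lambda>(x,y). of_real x + \<i> * of_real y) = (lborel :: complex measure)"
proof (rule lborel_eqI[symmetric])
  fix l u :: complex
  assume le: "\<And>b. b \<in> Basis \<Longrightarrow> l \<bullet> b \<le> u \<bullet> b"
  have le': "Re l \<le> Re u" "Im l \<le> Im u"
    using le[of 1] le[of \<i>] by (auto simp: Basis_complex_def)
  have pre: "(\<lambda>(x,y). of_real x + \<i> * of_real y) -` box l u \<inter> space (lborel \<Otimes>\<^sub>M lborel) = {Re l<..<Re u} \<times> {Im l<..<Im u}"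
    by (auto simp: in_box_complex_iff space_pair_measure)
  have "emeasure (distr (lborel \<Otimes>\<^sub>M lborel) borel (\<lambda>(x,y). of_real x + \<i> * of_real y)) (box l u)
      = emeasure (lborel \<Otimes>\<^sub>M lborel) ({Re l<..<Re u} \<times> {Im l<..<Im u})"
    by (subst emeasure_distr) (auto simp: pre)
  also have "\<dots> = emeasure lborel {Re l<..<Re u} * emeasure lborel {Im l<..<Im u}"
    by (intro lborel.emeasure_pair_measure_Times) auto
  also have "\<dots> = ennreal ((Re u - Re l) * (Im u - Im l))"
    using le' by (simp add: ennreal_mult)
  finally show "emeasure (distr (lborel \<Otimes>\<^sub>M lborel) borel (\<lambda>(x,y). of_real x + \<i> * of_real y)) (box l u) = (\<Prod>b\<in>Basis. (u - l) \<bullet> b)"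
    by (simp add: Basis_complex_def)
qed simp

lemma nn_integral_lborel_complex:
  fixes f :: "complex \<Rightarrow> ennreal"
  assumes f[measurable]: "f \<in> borel_measurable borel"
  shows "(\<integral>\<^sup>+ z. f z \<partial>lborel) = (\<integral>\<^sup>+ y. \<integral>\<^sup>+ x. f (of_real x + \<i> * of_real y) \<partial>lborel \<partial>lborel)" (is ?A)
    and "(\<integral>\<^sup>+ z. f z \<partial>lborel) = (\<integral>\<^sup>+ x. \<integral>\<^sup>+ y. f (of_real x + \<i> * of_real y) \<partial>lborel \<partial>lborel)" (is ?B)
proof -
  have 1: "(\<integral>\<^sup>+ z. f z \<partial>lborel) = (\<integral>\<^sup>+ p. f (case p of (x,y) \<Rightarrow> of_real x + \<i> * of_real y) \<partial>(lborel \<Otimes>\<^sub>M lborel))"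
    by (subst lborel_complex_pair[symmetric], subst nn_integral_distr) auto
  show ?A unfolding 1 by (subst lborel_pair.nn_integral_snd[symmetric]) auto
  show ?B unfolding 1 by (subst lborel.nn_integral_fst[symmetric]) auto
qed

section \<open>Rotation invariance of the area measure\<close>

lemma lborel_shear_real:
  "distr lborel borel (\<lambda>z. z + of_real (a * Im z)) = (lborel :: complex measure)"
proof (rule measure_eqI)
  fix A assume "A \<in> sets (distr lborel borel (\<lambda>z. z + of_real (a * Im z)) :: complex measure)"
  then have A[measurable]: "A \<in> sets (borel :: complex measure)" by simp
  have ind[measurable]: "(\<lambda>z. indicator A (z + of_real (a * Im z)) :: ennreal) \<in> borel_measurable borel"
    by measurable
  have "emeasure (distr lborel borel (\<lambda>z. z + of_real (a * Im z))) A = (\<integral>\<^sup>+ z. indicator A (z + of_real (a * Im z)) \<partial>lborel)"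
    by (subst nn_integral_indicator[symmetric], simp, subst nn_integral_distr) auto
  also have "\<dots> = (\<integral>\<^sup>+ y. \<integral>\<^sup>+ x. indicator A (of_real (a * y + 1 * x) + \<i> * of_real y) \<partial>lborel \<partial>lborel)"
    by (subst nn_integral_lborel_complex(1)) (auto simp: add_ac)
  \<comment> \<open>On each horizontal line the shear is a translation.\<close>
  also have "\<dots> = (\<integral>\<^sup>+ y. \<integral>\<^sup>+ x. indicator A (of_real x + \<i> * of_real y) \<partial>lborel \<partial>lborel)"
  proof (rule nn_integral_cong)
    fix y :: real
    have [measurable]: "(\<lambda>x::real. indicator A (of_real x + \<i> * of_real y) :: ennreal) \<in> borel_measurable borel"
      by measurable
    show "(\<integral>\<^sup>+ x. indicator A (of_real (a * y + 1 * x) + \<i> * of_real y) \<partial>lborel) = (\<integral>\<^sup>+ x. indicator A (of_real x + \<i> * of_real y) \<partial>lborel)"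
      using nn_integral_real_affine[of "\<lambda>x. indicator A (of_real x + \<i> * of_real y)" 1 "a * y"] by simp
  qed
  also have "\<dots> = emeasure lborel A"
    by (subst nn_integral_lborel_complex(1)[symmetric]) auto
  finally show "emeasure (distr lborel borel (\<lambda>z. z + of_real (a * Im z))) A = emeasure lborel A" .
qed simp

lemma lborel_shear_imag:
  "distr lborel borel (\<lambda>z. z + \<i> * of_real (a * Re z)) = (lborel :: complex measure)"
proof (rule measure_eqI)
  fix A assume "A \<in> sets (distr lborel borel (\<lambda>z. z + \<i> * of_real (a * Re z)) :: complex measure)"
  then have A[measurable]: "A \<in> sets (borel :: complex measure)" by simp
  have ind[measurable]: "(\<lambda>z. indicator A (z + \<i> * of_real (a * Re z)) :: ennreal) \<in> borel_measurable borel"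
    by measurable
  have "emeasure (distr lborel borel (\<lambda>z. z + \<i> * of_real (a * Re z))) A = (\<integral>\<^sup>+ z. indicator A (z + \<i> * of_real (a * Re z)) \<partial>lborel)"
    by (subst nn_integral_indicator[symmetric], simp, subst nn_integral_distr) auto
  also have "\<dots> = (\<integral>\<^sup>+ x. \<integral>\<^sup>+ y. indicator A (of_real x + \<i> * of_real (a * x + 1 * y)) \<partial>lborel \<partial>lborel)"
    by (subst nn_integral_lborel_complex(2)) (auto simp: algebra_simps)
  also have "\<dots> = (\<integral>\<^sup>+ x. \<integral>\<^sup>+ y. indicator A (of_real x + \<i> * of_real y) \<partial>lborel \<partial>lborel)"
  proof (rule nn_integral_cong)
    fix x :: real
    have [measurable]: "(\<lambda>y::real. indicator A (of_real x + \<i> * of_real y) :: ennreal) \<in> borel_measurable borel"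
      by measurable
    show "(\<integral>\<^sup>+ y. indicator A (of_real x + \<i> * of_real (a * x + 1 * y)) \<partial>lborel) = (\<integral>\<^sup>+ y. indicator A (of_real x + \<i> * of_real y) \<partial>lborel)"
      using nn_integral_real_affine[of "\<lambda>y. indicator A (of_real x + \<i> * of_real y)" 1 "a * x"] by simp
  qed
  also have "\<dots> = emeasure lborel A"
    by (subst nn_integral_lborel_complex(2)[symmetric]) auto
  finally show "emeasure (distr lborel borel (\<lambda>z. z + \<i> * of_real (a * Re z))) A = emeasure lborel A" .
qed simp

text \<open>A rotation by an angle other than \<open>\<pi>\<close> is a product of three shears.\<close>

lemma lborel_rotation:
  assumes c: "cmod c = 1" "c \<noteq> -1"
  shows "distr lborel borel (\<lambda>z. c * z) = (lborel :: complex measure)"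
proof -
  have sq: "(Re c)\<^sup>2 + (Im c)\<^sup>2 = 1" using c(1) by (simp add: cmod_def)
  have ne: "1 + Re c \<noteq> 0"
  proof
    assume "1 + Re c = 0"
    then have "Re c = -1" by simp
    with sq have "Im c = 0" by simp
    with \<open>Re c = -1\<close> c(2) show False by (simp add: complex_eq_iff)
  qed
  \<comment> \<open>For c = cis \<theta> this is tan(\<theta>/2), which is why c = -1 is excluded.
    The rotation factors as the horizontal shear with - t, the vertical shear with sin \<theta>, and
    the horizontal shear again.\<close>
  define t where "t = Im c / (1 + Re c)"
  have t1: "t * (1 + Re c) = Im c" using ne by (simp add: t_def)
  have t2: "Im c * t = 1 - Re c"
  proof -
    have "(Im c)\<^sup>2 = (1 - Re c) * (1 + Re c)" using sq by (simp add: algebra_simps power2_eq_square)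
    then show ?thesis using ne by (simp add: t_def power2_eq_square field_simps)
  qed
  let ?X = "\<lambda>z. z + of_real (- t * Im z) :: complex" and ?Y = "\<lambda>z. z + \<i> * of_real (Im c * Re z) :: complex"
  have comp: "?X (?Y (?X z)) = c * z" for z
  proof -
    obtain x y where z: "z = Complex x y" by (cases z)
    have "y + Im c * (x - t * y) = Im c * x + (1 - Im c * t) * y" by (simp add: algebra_simps)
    then have y: "y + Im c * (x - t * y) = Im c * x + Re c * y" by (simp add: t2)
    have "x - t * y - t * (Im c * x + Re c * y) = (1 - Im c * t) * x - (t * (1 + Re c)) * y"
      by (simp add: algebra_simps)
    then have x: "x - t * y - t * (Im c * x + Re c * y) = Re c * x - Im c * y" by (simp only: t1 t2) simp
    have "?X z = Complex (x - t * y) y" by (simp add: z complex_eq_iff)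
    moreover have "?Y (Complex (x - t * y) y) = Complex (x - t * y) (Im c * x + Re c * y)"
      using y by (simp add: complex_eq_iff)
    moreover have "?X (Complex (x - t * y) (Im c * x + Re c * y)) = Complex (Re c * x - Im c * y) (Im c * x + Re c * y)"
      using x by (simp add: complex_eq_iff)
    moreover have "Complex (Re c * x - Im c * y) (Im c * x + Re c * y) = c * z"
      by (simp add: z complex_eq_iff)
    ultimately show ?thesis by (simp only:)
  qed
  have mX: "?X \<in> borel_measurable borel" and mY: "?Y \<in> borel_measurable borel" by measurable
  have "lborel = distr (distr (distr lborel borel ?X) borel ?Y) borel ?X"
    by (simp only: lborel_shear_real lborel_shear_imag)
  also have "\<dots> = distr lborel borel (\<lambda>z. ?X (?Y (?X z)))"
    using mX mY by (simp add: distr_distr o_def)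
  also have "\<dots> = distr lborel borel (\<lambda>z. c * z)" by (simp only: comp)
  finally show ?thesis by simp
qed

text \<open>Invariance of the Borel measure passes to its completion, since null sets pull back to
  null sets.\<close>

lemma lebesgue_rotation:
  assumes c: "cmod c = 1" "c \<noteq> -1"
  shows "(\<lambda>z. c * z) \<in> lebesgue \<rightarrow>\<^sub>M lebesgue" "distr lebesgue lebesgue (\<lambda>z. c * z) = (lebesgue :: complex measure)"
proof -
  have m: "(\<lambda>z. c * z) \<in> lebesgue \<rightarrow>\<^sub>M lborel" by (simp add: measurable_completion)
  have d: "distr lebesgue lborel (\<lambda>z. c * z) = lborel"
    using lborel_rotation[OF c] by (simp add: distr_completion cong: distr_cong)
  show "(\<lambda>z. c * z) \<in> lebesgue \<rightarrow>\<^sub>M lebesgue"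
    by (rule completion.measurable_completion2[OF m]) (simp add: d)
  have "completion (distr lebesgue lborel (\<lambda>z. c * z)) = distr lebesgue lebesgue (\<lambda>z. c * z)"
    by (rule completion.completion_distr_eq[OF m]) (simp add: d)
  then show "distr lebesgue lebesgue (\<lambda>z. c * z) = lebesgue" by (simp add: d)
qed

lemma integral_disk_rotation:
  fixes g :: "complex \<Rightarrow> complex"
  assumes c: "cmod c = 1" "c \<noteq> -1" and g: "g \<in> borel_measurable disk_measure"
  shows "(LINT z|disk_measure. g (c * z)) = (LINT z|disk_measure. g z)"
proof -
  have dl: "disk \<inter> space lebesgue \<in> sets lebesgue" by simp
  have g': "(\<lambda>z. indicator disk z *\<^sub>R g z) \<in> borel_measurable lebesgue"
    using g by (simp add: borel_measurable_restrict_space_iff)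
  have "(LINT z|disk_measure. g z) = (LINT z|lebesgue. indicator disk z *\<^sub>R g z)"
    by (rule integral_restrict_space[OF dl])
  also have "\<dots> = (LINT z|distr lebesgue lebesgue (\<lambda>z. c * z). indicator disk z *\<^sub>R g z)"
    by (simp only: lebesgue_rotation(2)[OF c])
  also have "\<dots> = (LINT z|lebesgue. indicator disk (c * z) *\<^sub>R g (c * z))"
    by (rule integral_distr[OF lebesgue_rotation(1)[OF c] g'])
  also have "\<dots> = (LINT z|lebesgue. indicator disk z *\<^sub>R g (c * z))"
    using c(1) by (intro Bochner_Integration.integral_cong) (auto simp: indicator_def norm_mult)
  also have "\<dots> = (LINT z|disk_measure. g (c * z))"
    by (rule integral_restrict_space[OF dl, symmetric])
  finally show ?thesis by simp
qed

text \<open>Rotating the variable multiplies the integral I by \<open>d\<close>, so I = d I and I =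
  0. Homogeneity is asked for only off the origin, because polar terms have no meaningful angle
  there.\<close>

lemma integral_disk_rotation_zero:
  fixes g :: "complex \<Rightarrow> complex"
  assumes c: "cmod c = 1" "c \<noteq> -1" and g: "\<And>z. z \<noteq> 0 \<Longrightarrow> g (c * z) = d * g z" and d: "d \<noteq> 1"
  shows "(LINT z|disk_measure. g z) = 0"
proof (cases "integrable disk_measure g")
  \<comment> \<open>A function that is not integrable has integral 0 by convention.\<close>
  case False
  then show ?thesis by (rule not_integrable_integral_eq)
next
  case True
  then have gm: "g \<in> borel_measurable disk_measure" by auto
  have dl: "disk \<inter> space lebesgue \<in> sets lebesgue" by simp
  have ae0: "AE z in disk_measure. z \<noteq> (0::complex)"
    unfolding AE_restrict_space_iff[OF dl]
    using AE_completion[OF AE_lborel_singleton[of "0::complex"]] by eventually_elim simp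
  have gc: "(\<lambda>z. g (c * z)) \<in> borel_measurable disk_measure"
  proof -
    have "(\<lambda>z. indicator disk z *\<^sub>R g z) \<in> borel_measurable lebesgue"
      using gm by (simp add: borel_measurable_restrict_space_iff)
    from measurable_compose[OF lebesgue_rotation(1)[OF c] this]
    have "(\<lambda>z. indicator disk (c * z) *\<^sub>R g (c * z)) \<in> borel_measurable lebesgue" .
    moreover have "indicator disk (c * z) = (indicator disk z :: real)" for z
      using c(1) by (auto simp: indicator_def norm_mult)
    ultimately show ?thesis by (simp add: borel_measurable_restrict_space_iff)
  qed
  have "(LINT z|disk_measure. g z) = (LINT z|disk_measure. g (c * z))"
    by (rule integral_disk_rotation[OF c gm, symmetric])
  also have "\<dots> = (LINT z|disk_measure. d * g z)"
    by (rule integral_cong_AE[OF gc]) (use gm ae0 g in \<open>auto elim!: eventually_mono\<close>)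
  also have "\<dots> = d * (LINT z|disk_measure. g z)" by simp
  finally show ?thesis using d by simp
qed


section \<open>Polar coordinates for radial integrands\<close>

lemma disk_cmod_distr:
  "distr (restrict_space lborel disk) borel cmod = density lborel (\<lambda>r. ennreal (2 * pi * r * indicator {0..1} r))"
proof (rule measure_eqI_lessThan)
  have mc: "cmod \<in> borel_measurable (restrict_space lborel disk)"
    by (rule measurable_restrict_space1) simp
  have pre: "emeasure (distr (restrict_space lborel disk) borel cmod) {x<..} = emeasure lborel (disk - cball 0 x)" for x :: real
  proof -
    have "cmod -` {x<..} \<inter> space (restrict_space lborel disk) = disk - cball 0 x"
      by (auto simp: space_restrict_space)
    then show ?thesis
      by (subst emeasure_distr[OF mc]) (auto simp: emeasure_restrict_space)
  qed
  have v: "emeasure lborel (disk :: complex set) = ennreal pi"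
    by (subst emeasure_ball) (auto simp: unit_ball_vol_2)
  show "emeasure (distr (restrict_space lborel disk) borel cmod) {x<..} < \<infinity>" for x :: real
  proof -
    have "emeasure lborel (disk - cball 0 x) \<le> emeasure lborel (disk :: complex set)"
      by (rule emeasure_mono) auto
    then show ?thesis unfolding pre v by (rule le_less_trans) simp
  qed
  fix x :: real
  \<comment> \<open>A finite measure on the line is determined by its rays, and here a ray is the
    radius range of an annulus. Clipping \<open>x\<close> to [0,1] gives the inner radius, so the
    area is pi (1 - a^2).\<close>
  define a where "a = max 0 (min 1 x)"
  have a: "0 \<le> a" "a \<le> 1" by (auto simp: a_def)
  have "emeasure lborel (disk - cball 0 x) = ennreal (pi * (1 - a\<^sup>2))"
  proof -
    consider "x < 0" | "0 \<le> x" "x \<le> 1" | "x > 1" by linarith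
    then show ?thesis
    proof cases
      case 1
      then show ?thesis using v by (simp add: a_def)
    next
      case 2
      show ?thesis
      proof (cases "x = 1")
        case True
        have e: "disk - cball 0 x = ({} :: complex set)" using True by auto
        show ?thesis unfolding e using True by (simp add: a_def)
      next
        case False
        then have x: "x < 1" using 2 by simp
        have "emeasure lborel (disk - cball 0 x :: complex set) = emeasure lborel (disk :: complex set) - emeasure lborel (cball 0 x :: complex set)"
          by (rule emeasure_Diff) (use x 2 in \<open>auto simp: emeasure_lborel_cball_finite[THEN less_imp_neq, unfolded infinity_ennreal_def]\<close>)
        also have "\<dots> = ennreal pi - ennreal (pi * x\<^sup>2)"
          using 2 by (subst emeasure_cball) (auto simp: unit_ball_vol_2 v)
        also have "\<dots> = ennreal (pi - pi * x\<^sup>2)"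
          by (rule ennreal_minus) (use 2 in auto)
        finally show ?thesis using 2 by (simp add: a_def algebra_simps)
      qed
    next
      case 3
      then have e: "disk - cball 0 x = ({} :: complex set)" by auto
      show ?thesis unfolding e using 3 by (simp add: a_def)
    qed
  qed
  also have "ennreal (pi * (1 - a\<^sup>2)) = (\<integral>\<^sup>+ r. ennreal (2 * pi * r) * indicator {a..1} r \<partial>lborel)"
  proof -
    have "(\<integral>\<^sup>+ r. ennreal (2 * pi * r) * indicator {a..1} r \<partial>lborel) = ennreal (pi * 1\<^sup>2 - pi * a\<^sup>2)"
      by (rule nn_integral_FTC_Icc[where F = "\<lambda>r. pi * r\<^sup>2"])
        (use a in \<open>auto intro!: derivative_eq_intros\<close>)
    then show ?thesis by (simp add: algebra_simps)
  qed
  also have "\<dots> = (\<integral>\<^sup>+ r. ennreal (2 * pi * r * indicator {0..1} r) * indicator {x<..} r \<partial>lborel)"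
  proof (rule nn_integral_cong_AE)
    show "AE r in lborel. ennreal (2 * pi * r) * indicator {a..1} r = ennreal (2 * pi * r * indicator {0..1} r) * indicator {x<..} r"
      using AE_lborel_singleton[of x] AE_lborel_singleton[of 1]
      by eventually_elim (auto simp: a_def indicator_def max_def min_def split: if_splits)
  qed
  also have "\<dots> = emeasure (density lborel (\<lambda>r. ennreal (2 * pi * r * indicator {0..1} r))) {x<..}"
    by (subst emeasure_density) auto
  finally show "emeasure (distr (restrict_space lborel disk) borel cmod) {x<..} =
      emeasure (density lborel (\<lambda>r. ennreal (2 * pi * r * indicator {0..1} r))) {x<..}"
    by (simp add: pre)
qed auto

lemma integral_disk_radial:
  fixes H :: "real \<Rightarrow> complex"
  assumes H[measurable]: "H \<in> borel_measurable borel"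
  shows "(LINT z|disk_measure. H (cmod z)) = (LINT r|lborel. (2 * pi * r * indicator {0..1} r) *\<^sub>R H r)"
proof -
  have mc: "cmod \<in> borel_measurable (restrict_space lborel disk)"
    by (rule measurable_restrict_space1) simp
  have "(LINT z|disk_measure. H (cmod z)) = (LINT z|lebesgue. indicator disk z *\<^sub>R H (cmod z))"
    by (rule integral_restrict_space) simp
  also have "\<dots> = (LINT z|lborel. indicator disk z *\<^sub>R H (cmod z))"
  proof (rule integral_completion)
    have [measurable]: "disk \<in> sets (borel :: complex measure)" by simp
    have "(\<lambda>z. indicator disk z *\<^sub>R H (cmod z)) \<in> borel_measurable borel" by measurable
    then show "(\<lambda>z. indicator disk z *\<^sub>R H (cmod z)) \<in> borel_measurable lborel" by simp
  qed
  also have "\<dots> = (LINT z|restrict_space lborel disk. H (cmod z))"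
    by (rule integral_restrict_space[symmetric]) simp
  also have "\<dots> = (LINT r|distr (restrict_space lborel disk) borel cmod. H r)"
    by (rule integral_distr[OF mc H, symmetric])
  also have "\<dots> = (LINT r|lborel. (2 * pi * r * indicator {0..1} r) *\<^sub>R H r)"
    unfolding disk_cmod_distr
    by (rule integral_density) (auto simp: indicator_def)
  finally show ?thesis .
qed

text \<open>The distribution of the modulus has a density, so a null set of radii pulls back to a
  null set of the disk.\<close>

lemma AE_disk_cmod:
  assumes "AE r in lborel. P r"
  shows "AE z in disk_measure. P (cmod z)"
proof -
  obtain N where N: "{r. \<not> P r} \<subseteq> N" "N \<in> null_sets lborel"
    using AE_E[OF assms] by (auto simp: null_sets_def)
  have mc: "cmod \<in> borel_measurable (restrict_space lborel disk)"
    by (rule measurable_restrict_space1) simp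
  have "AE r in density lborel (\<lambda>r. ennreal (2 * pi * r * indicator {0..1} r)). r \<notin> N"
    using AE_not_in[OF N(2)] by (subst AE_density) auto
  then have "AE r in distr (restrict_space lborel disk) borel cmod. r \<notin> N"
    unfolding disk_cmod_distr .
  then have "AE z in restrict_space lborel disk. cmod z \<notin> N"
    by (subst (asm) AE_distr_iff[OF mc]) (use N(2) in auto)
  then have "AE z in lborel. z \<in> disk \<longrightarrow> cmod z \<notin> N"
    by (subst (asm) AE_restrict_space_iff) auto
  then have "AE z in lebesgue. z \<in> disk \<longrightarrow> cmod z \<notin> N" by (rule AE_completion)
  then have "AE z in disk_measure. cmod z \<notin> N"
    by (subst AE_restrict_space_iff) auto
  then show ?thesis by eventually_elim (use N(1) in auto)
qed

lemma completion_ex_borel_measurable_complex: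
  fixes g :: "'a \<Rightarrow> complex"
  assumes "g \<in> borel_measurable (completion M)"
  obtains g' where "g' \<in> borel_measurable M" "AE x in M. g x = g' x"
proof -
  have "(\<lambda>x. Re (g x)) \<in> borel_measurable (completion M)" "(\<lambda>x. Im (g x)) \<in> borel_measurable (completion M)"
    using assms by auto
  from this[THEN completion_ex_borel_measurable_real] obtain u v where
    uv: "u \<in> borel_measurable M" "AE x in M. Re (g x) = u x" "v \<in> borel_measurable M" "AE x in M. Im (g x) = v x"
    by blast
  show ?thesis
  proof (rule that[of "\<lambda>x. of_real (u x) + \<i> * of_real (v x)"])
    show "(\<lambda>x. of_real (u x) + \<i> * of_real (v x)) \<in> borel_measurable M" using uv by measurable
    show "AE x in M. g x = of_real (u x) + \<i> * of_real (v x)"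
      using uv(2,4) by eventually_elim (simp add: complex_eq_iff)
  qed
qed

text \<open>The division by |z| cancels the factor r of the area element. Since \<open>q\<close> is
  only Lebesgue measurable, a Borel version is integrated and the difference removed by
  almost-everywhere equality on both sides.\<close>

lemma radial_integral:
  fixes q :: "real \<Rightarrow> complex" and g :: "complex \<Rightarrow> complex"
  assumes q: "integrable (lebesgue_on {0<..<1}) q" and g: "g \<in> borel_measurable disk_measure"
    and gq: "\<And>z. z \<in> disk \<Longrightarrow> z \<noteq> 0 \<Longrightarrow> g z = q (cmod z) / of_real (cmod z)"
  shows "(LINT z|disk_measure. g z) = 2 * pi * (LINT r|lebesgue_on {0<..<1}. q r)"
proof -
  let ?I = "{0<..<1::real}"
  have "(\<lambda>r. indicator ?I r *\<^sub>R q r) \<in> borel_measurable lebesgue"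
    using borel_measurable_integrable[OF q] by (simp add: borel_measurable_restrict_space_iff)
  then obtain q' where q': "q' \<in> borel_measurable lborel" "AE r in lborel. indicator ?I r *\<^sub>R q r = q' r"
    by (rule completion_ex_borel_measurable_complex)
  have q'm[measurable]: "q' \<in> borel_measurable borel" using q'(1) by simp
  define H where "H r = q' r / of_real r" for r :: real
  have Hm[measurable]: "H \<in> borel_measurable borel" unfolding H_def[abs_def] by measurable
  have ae0: "AE z in disk_measure. z \<noteq> (0::complex)"
    by (subst AE_restrict_space_iff) (auto intro: AE_mp[OF AE_completion[OF AE_lborel_singleton[of "0::complex"]]])
  have aed: "AE z in disk_measure. z \<in> disk" by (subst AE_restrict_space_iff) auto
  have "(LINT z|disk_measure. g z) = (LINT z|disk_measure. H (cmod z))"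
  proof (rule integral_cong_AE[OF g])
    show "(\<lambda>z. H (cmod z)) \<in> borel_measurable disk_measure"
      by (rule measurable_restrict_space1, rule measurable_completion) measurable
    show "AE z in disk_measure. g z = H (cmod z)"
      using AE_disk_cmod[OF q'(2)] ae0 aed
      by eventually_elim (auto simp: H_def gq)
  qed
  also have "\<dots> = (LINT r|lborel. (2 * pi * r * indicator {0..1} r) *\<^sub>R H r)"
    by (rule integral_disk_radial) simp
  also have "\<dots> = (LINT r|lborel. (2 * pi) * (indicator ?I r *\<^sub>R q' r))"
  proof (rule integral_cong_AE)
    show "AE r in lborel. (2 * pi * r * indicator {0..1} r) *\<^sub>R H r = (2 * pi) * (indicator ?I r *\<^sub>R q' r)"
      using AE_lborel_singleton[of "0::real"] AE_lborel_singleton[of "1::real"]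
      by eventually_elim (auto simp: H_def indicator_def scaleR_conv_of_real)
  qed measurable
  also have "\<dots> = 2 * pi * (LINT r|lborel. indicator ?I r *\<^sub>R q' r)"
    by (rule integral_mult_right_zero)
  also have "(LINT r|lborel. indicator ?I r *\<^sub>R q' r) = (LINT r|lebesgue. indicator ?I r *\<^sub>R q' r)"
    by (rule integral_completion[symmetric]) measurable
  also have "\<dots> = (LINT r|lebesgue_on ?I. q' r)"
    by (rule integral_restrict_space[symmetric]) simp
  also have "\<dots> = (LINT r|lebesgue_on ?I. q r)"
  proof (rule integral_cong_AE)
    show "q' \<in> borel_measurable (lebesgue_on ?I)"
      by (rule measurable_restrict_space1, rule measurable_completion) simp
    show "q \<in> borel_measurable (lebesgue_on ?I)" using q by (rule borel_measurable_integrable)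
    show "AE r in lebesgue_on ?I. q' r = q r"
      using AE_completion[OF q'(2)] by (subst AE_restrict_space_iff) (auto elim!: eventually_mono)
  qed
  finally show ?thesis .
qed

section \<open>The Bergman projection and the Bergman kernel\<close>

lemma finite_disk_measure: "finite_measure disk_measure"
  by (rule finite_measure_lebesgue_on) simp

lemma measurable_disk_continuous: "continuous_on disk g \<Longrightarrow> g \<in> borel_measurable disk_measure"
  for g :: "complex \<Rightarrow> complex"
  by (rule continuous_imp_measurable_on_sets_lebesgue) simp_all

lemma L2_measurable: "f \<in> L2_disk \<Longrightarrow> f \<in> borel_measurable disk_measure"
  and L2_sq_integrable: "f \<in> L2_disk \<Longrightarrow> integrable disk_measure (\<lambda>z. (cmod (f z))\<^sup>2)"
  by (simp_all add: L2_disk_def)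

lemma L2_dominated:
  assumes g: "g \<in> borel_measurable disk_measure" and f: "integrable disk_measure h"
    and le: "\<And>z. z \<in> disk \<Longrightarrow> (cmod (g z))\<^sup>2 \<le> h z"
  shows "g \<in> L2_disk"
proof -
  have "integrable disk_measure (\<lambda>z. (cmod (g z))\<^sup>2)"
    by (rule Bochner_Integration.integrable_bound[OF f])
      (use g le in \<open>auto intro!: AE_I2 order_trans[OF le abs_ge_self]\<close>)
  with g show ?thesis by (simp add: L2_disk_def)
qed

lemma L2_bounded_mult:
  assumes f: "f \<in> L2_disk" and g: "g \<in> borel_measurable disk_measure" and B: "\<And>z. z \<in> disk \<Longrightarrow> cmod (g z) \<le> B"
  shows "(\<lambda>z. f z * g z) \<in> L2_disk"
proof (rule L2_dominated)
  show "(\<lambda>z. f z * g z) \<in> borel_measurable disk_measure"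
    using L2_measurable[OF f] g by measurable
  show "integrable disk_measure (\<lambda>z. B\<^sup>2 * (cmod (f z))\<^sup>2)"
    by (rule integrable_mult_right) (rule L2_sq_integrable[OF f])
  fix z :: complex assume "z \<in> disk"
  then have "cmod (g z) ^ 2 \<le> B ^ 2" using B by (intro power_mono) auto
  then show "(cmod (f z * g z))\<^sup>2 \<le> B\<^sup>2 * (cmod (f z))\<^sup>2"
    using mult_right_mono[of "(cmod (g z))\<^sup>2" "B\<^sup>2" "(cmod (f z))\<^sup>2"]
    by (simp add: norm_mult power_mult_distrib mult.commute)
qed

lemma L2_one: "(\<lambda>_. 1) \<in> L2_disk"
proof -
  interpret finite_measure disk_measure by (rule finite_disk_measure)
  show ?thesis by (simp add: L2_disk_def)
qed

lemma L2_bounded: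
  assumes "g \<in> borel_measurable disk_measure" "\<And>z. z \<in> disk \<Longrightarrow> cmod (g z) \<le> B"
  shows "g \<in> L2_disk"
  using L2_bounded_mult[OF L2_one assms] by simp

lemma L2_add:
  assumes f: "f \<in> L2_disk" and g: "g \<in> L2_disk"
  shows "(\<lambda>z. f z + g z) \<in> L2_disk"
proof (rule L2_dominated)
  show "(\<lambda>z. f z + g z) \<in> borel_measurable disk_measure"
    using L2_measurable[OF f] L2_measurable[OF g] by measurable
  show "integrable disk_measure (\<lambda>z. 2 * (cmod (f z))\<^sup>2 + 2 * (cmod (g z))\<^sup>2)"
    using L2_sq_integrable[OF f] L2_sq_integrable[OF g] by auto
  fix z
  have "(cmod (f z + g z))\<^sup>2 \<le> (cmod (f z) + cmod (g z))\<^sup>2" by (intro power_mono norm_triangle_ineq) auto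
  also have "\<dots> \<le> 2 * (cmod (f z))\<^sup>2 + 2 * (cmod (g z))\<^sup>2"
    using sum_squares_bound[of "cmod (f z)" "cmod (g z)"] by (simp add: power2_sum)
  finally show "(cmod (f z + g z))\<^sup>2 \<le> 2 * (cmod (f z))\<^sup>2 + 2 * (cmod (g z))\<^sup>2" .
qed

lemma L2_cmult: "f \<in> L2_disk \<Longrightarrow> (\<lambda>z. c * f z) \<in> L2_disk"
  using L2_bounded_mult[of f "\<lambda>_. c" "cmod c"] by (simp add: mult.commute)

lemma L2_diff: "f \<in> L2_disk \<Longrightarrow> g \<in> L2_disk \<Longrightarrow> (\<lambda>z. f z - g z) \<in> L2_disk"
  using L2_add[of f "\<lambda>z. (-1) * g z"] L2_cmult[of g "-1"] by simp

lemma L2_sum: "finite A \<Longrightarrow> (\<And>i. i \<in> A \<Longrightarrow> f i \<in> L2_disk) \<Longrightarrow> (\<lambda>z. \<Sum>i\<in>A. f i z) \<in> L2_disk"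
  by (induction A rule: finite_induct) (use L2_cmult[OF L2_one, of 0] in \<open>auto intro: L2_add\<close>)

lemma L2_monomial: "(\<lambda>z. z ^ k) \<in> L2_disk"
  by (rule L2_bounded[of _ 1], rule measurable_disk_continuous)
    (auto intro!: continuous_intros power_le_one simp: norm_power)

lemma L2_mult_integrable:
  assumes f: "f \<in> L2_disk" and g: "g \<in> L2_disk"
  shows "integrable disk_measure (\<lambda>z. f z * cnj (g z))"
proof (rule Bochner_Integration.integrable_bound)
  show "integrable disk_measure (\<lambda>z. (cmod (f z))\<^sup>2 + (cmod (g z))\<^sup>2)"
    using L2_sq_integrable[OF f] L2_sq_integrable[OF g] by auto
  have [measurable]: "cnj \<in> borel_measurable borel"
    by (intro borel_measurable_continuous_onI continuous_intros)
  show "(\<lambda>z. f z * cnj (g z)) \<in> borel_measurable disk_measure"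
    using L2_measurable[OF f] L2_measurable[OF g] by measurable
  have "cmod (f z * cnj (g z)) \<le> norm ((cmod (f z))\<^sup>2 + (cmod (g z))\<^sup>2)" for z
  proof -
    have "2 * (cmod (f z) * cmod (g z)) \<le> (cmod (f z))\<^sup>2 + (cmod (g z))\<^sup>2"
      using sum_squares_bound[of "cmod (f z)" "cmod (g z)"] by simp
    moreover have "0 \<le> cmod (f z) * cmod (g z)" by simp
    ultimately have "cmod (f z) * cmod (g z) \<le> (cmod (f z))\<^sup>2 + (cmod (g z))\<^sup>2" by linarith
    then show ?thesis by (simp add: norm_mult)
  qed
  then show "AE z in disk_measure. cmod (f z * cnj (g z)) \<le> norm ((cmod (f z))\<^sup>2 + (cmod (g z))\<^sup>2)" by simp
qed

lemma L2_integrable: "f \<in> L2_disk \<Longrightarrow> integrable disk_measure f"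
  using L2_mult_integrable[OF _ L2_one, of f] by simp

lemma L2_inner_diff_left:
  "\<lbrakk>f \<in> L2_disk; f' \<in> L2_disk; g \<in> L2_disk\<rbrakk> \<Longrightarrow> L2_inner (\<lambda>z. f z - f' z) g = L2_inner f g - L2_inner f' g"
  unfolding L2_inner_def by (simp add: left_diff_distrib L2_mult_integrable Bochner_Integration.integral_diff)

lemma L2_inner_diff_right:
  "\<lbrakk>f \<in> L2_disk; g \<in> L2_disk; g' \<in> L2_disk\<rbrakk> \<Longrightarrow> L2_inner f (\<lambda>z. g z - g' z) = L2_inner f g - L2_inner f g'"
  unfolding L2_inner_def by (simp add: right_diff_distrib L2_mult_integrable Bochner_Integration.integral_diff)

lemma L2_inner_sum_left:
  assumes "finite A" "\<And>i. i \<in> A \<Longrightarrow> f i \<in> L2_disk" "g \<in> L2_disk"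
  shows "L2_inner (\<lambda>z. \<Sum>i\<in>A. a i * f i z) g = (\<Sum>i\<in>A. a i * L2_inner (f i) g)"
proof -
  have "L2_inner (\<lambda>z. \<Sum>i\<in>A. a i * f i z) g = (LINT z|disk_measure. (\<Sum>i\<in>A. a i * (f i z * cnj (g z))))"
    unfolding L2_inner_def by (simp add: sum_distrib_right mult.assoc)
  also have "\<dots> = (\<Sum>i\<in>A. (LINT z|disk_measure. a i * (f i z * cnj (g z))))"
    by (rule Bochner_Integration.integral_sum) (use assms in \<open>auto intro!: integrable_mult_right L2_mult_integrable\<close>)
  finally show ?thesis by (simp add: L2_inner_def)
qed

lemma L2_inner_commute: "L2_inner g f = cnj (L2_inner f g)"
proof -
  have "(\<lambda>z. g z * cnj (f z)) = (\<lambda>z. cnj (f z * cnj (g z)))" by (simp add: mult.commute)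
  then show ?thesis unfolding L2_inner_def by (simp only: Bochner_Integration.integral_cnj)
qed

lemma L2_inner_sum_right:
  assumes "finite A" "\<And>i. i \<in> A \<Longrightarrow> f i \<in> L2_disk" "g \<in> L2_disk"
  shows "L2_inner g (\<lambda>z. \<Sum>i\<in>A. a i * f i z) = (\<Sum>i\<in>A. cnj (a i) * L2_inner g (f i))"
proof -
  have "L2_inner g (\<lambda>z. \<Sum>i\<in>A. a i * f i z) = cnj (\<Sum>i\<in>A. a i * L2_inner (f i) g)"
    by (subst L2_inner_commute, subst L2_inner_sum_left[OF assms]) simp_all
  also have "\<dots> = (\<Sum>i\<in>A. cnj (a i) * cnj (L2_inner (f i) g))" by simp
  also have "\<dots> = (\<Sum>i\<in>A. cnj (a i) * L2_inner g (f i))" by (simp only: L2_inner_commute[of g])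
  finally show ?thesis .
qed

lemma L2_inner_self: "L2_inner f f = of_real (LINT z|disk_measure. (cmod (f z))\<^sup>2)"
  unfolding L2_inner_def complex_norm_square[symmetric] by (rule integral_complex_of_real)

text \<open>Cauchy-Schwarz in the form 2 x y \<le> t x^2 + y^2 / t, obtained by integrating a
  square. The free weight \<open>t\<close> is tuned in each application.\<close>

lemma L2_inner_le:
  assumes f: "f \<in> L2_disk" and g: "g \<in> L2_disk" and t: "t > 0"
  shows "2 * cmod (L2_inner f g) \<le> t * (LINT z|disk_measure. (cmod (f z))\<^sup>2) + (LINT z|disk_measure. (cmod (g z))\<^sup>2) / t"
proof -
  have int: "integrable disk_measure (\<lambda>z. t * (cmod (f z))\<^sup>2 + (cmod (g z))\<^sup>2 / t)"
    using L2_sq_integrable[OF f] L2_sq_integrable[OF g] by auto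
  have pt: "cmod (2 * (f z * cnj (g z))) \<le> t * (cmod (f z))\<^sup>2 + (cmod (g z))\<^sup>2 / t" for z
  proof -
    define x y where "x = cmod (f z)" and "y = cmod (g z)"
    have "0 \<le> (t * x - y)\<^sup>2 / t" using t by simp
    also have "\<dots> = t * x\<^sup>2 + y\<^sup>2 / t - 2 * (x * y)" using t by (simp add: power2_eq_square field_simps)
    finally show ?thesis by (simp add: norm_mult x_def y_def)
  qed
  have "2 * cmod (L2_inner f g) = cmod (LINT z|disk_measure. 2 * (f z * cnj (g z)))"
    unfolding L2_inner_def by (simp add: norm_mult)
  also have "\<dots> \<le> (LINT z|disk_measure. t * (cmod (f z))\<^sup>2 + (cmod (g z))\<^sup>2 / t)"
    by (rule Bochner_Integration.integral_norm_bound_integral) (use int L2_mult_integrable[OF f g] pt in auto)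
  also have "\<dots> = t * (LINT z|disk_measure. (cmod (f z))\<^sup>2) + (LINT z|disk_measure. (cmod (g z))\<^sup>2) / t"
    using L2_sq_integrable[OF f] L2_sq_integrable[OF g] by simp
  finally show ?thesis .
qed

section \<open>Orthogonality of the monomials\<close>

lemma rotation_detecting_character:
  assumes "n \<noteq> (0::int)"
  obtains c where "cmod c = 1" "c \<noteq> -1" "c powi n \<noteq> 1"
proof -
  \<comment> \<open>A quarter turn divided by |n|: the n-th power is \<i> or - \<i>, so it differs
    from 1, and \<open>c\<close> differs from -1, whose powers are real.\<close>
  define c where "c = cis (pi / (2 * of_int \<bar>n\<bar>))"
  have "c powi n = cis (of_int n * (pi / (2 * of_int \<bar>n\<bar>)))" by (simp add: c_def cis_power_int)
  also have "of_int n * (pi / (2 * of_int \<bar>n\<bar>)) = (if n > 0 then pi / 2 else - (pi / 2))"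
    using assms by (simp add: field_simps)
  finally have p: "c powi n = (if n > 0 then \<i> else - \<i>)" by (simp flip: cis_cnj)
  have "c \<noteq> -1"
  proof
    assume "c = -1"
    then have "c powi n = 1 \<or> c powi n = -1" by (simp add: power_int_minus_left)
    with p show False by (auto simp: complex_eq_iff split: if_splits)
  qed
  with p show ?thesis by (intro that[of c]) (auto simp: c_def complex_eq_iff)
qed

lemma monomial_rotate:
  assumes "cmod c = 1"
  shows "(c * z) ^ j * cnj (c * z) ^ k = c powi (int j - int k) * (z ^ j * cnj z ^ k)"
proof -
  have c: "c \<noteq> 0" using assms by auto
  have "c * cnj c = 1" using complex_norm_square[of c] assms by simp
  then have "cnj c = inverse c" using c by (simp add: field_simps)
  then show ?thesis using c
    by (simp add: power_mult_distrib power_int_diff power_inverse divide_inverse)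
qed

text \<open>Off the diagonal rotation invariance forces 0; on the diagonal the integrand is radial.
  Radii R < 1 are included because a Taylor series can be integrated termwise only on smaller
  disks.\<close>

lemma truncated_monomial_integral:
  assumes R: "0 < R" "R \<le> 1"
  shows "(LINT z|disk_measure. indicator (ball 0 R) z *\<^sub>R (z ^ j * cnj z ^ k)) =
    (if j = k then of_real (pi * R ^ (2 * k + 2) / (real k + 1)) else 0)"
proof (cases "j = k")
  case False
  then obtain c where c: "cmod c = 1" "c \<noteq> -1" "c powi (int j - int k) \<noteq> 1"
    using rotation_detecting_character[of "int j - int k"] by auto
  have "(LINT z|disk_measure. indicator (ball 0 R) z *\<^sub>R (z ^ j * cnj z ^ k)) = 0"
  proof (rule integral_disk_rotation_zero[OF c(1,2) _ c(3)])
    fix z :: complex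
    have "indicator (ball 0 R) (c * z) = (indicator (ball 0 R) z :: real)"
      using c(1) by (auto simp: indicator_def norm_mult)
    then show "indicator (ball 0 R) (c * z) *\<^sub>R ((c * z) ^ j * cnj (c * z) ^ k) =
        c powi (int j - int k) * (indicator (ball 0 R) z *\<^sub>R (z ^ j * cnj z ^ k))"
      unfolding monomial_rotate[OF c(1)] by simp
  qed
  with False show ?thesis by simp
next
  case True
  define H :: "real \<Rightarrow> complex" where "H r = of_real (indicator {..<R} r * r ^ (2 * k))" for r
  have [measurable]: "H \<in> borel_measurable borel" unfolding H_def[abs_def] by measurable
  have "(LINT z|disk_measure. indicator (ball 0 R) z *\<^sub>R (z ^ j * cnj z ^ k)) = (LINT z|disk_measure. H (cmod z))"
  proof (rule Bochner_Integration.integral_cong[OF refl])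
    fix z :: complex
    have "z ^ k * cnj z ^ k = of_real (cmod z ^ (2 * k))"
      unfolding power_mult_distrib[symmetric] complex_norm_square[symmetric] by (simp add: power_mult)
    then show "indicator (ball 0 R) z *\<^sub>R (z ^ j * cnj z ^ k) = H (cmod z)"
      by (simp add: True H_def indicator_def scaleR_conv_of_real)
  qed
  also have "\<dots> = (LINT r|lborel. (2 * pi * r * indicator {0..1} r) *\<^sub>R H r)" by (rule integral_disk_radial) simp
  also have "\<dots> = (LINT r|lborel. of_real (2 * pi * (r ^ (2 * k + 1) * indicator {0..R} r)))"
  proof (rule integral_cong_AE)
    show "AE r in lborel. (2 * pi * r * indicator {0..1} r) *\<^sub>R H r = of_real (2 * pi * (r ^ (2 * k + 1) * indicator {0..R} r))"
      using AE_lborel_singleton[of R]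
      by eventually_elim (use R in \<open>auto simp: H_def indicator_def scaleR_conv_of_real\<close>)
  qed measurable
  also have "\<dots> = of_real (LINT r|lborel. 2 * pi * (r ^ (2 * k + 1) * indicator {0..R} r))"
    by (rule integral_complex_of_real)
  also have "(LINT r|lborel. 2 * pi * (r ^ (2 * k + 1) * indicator {0..R} r)) = 2 * pi * (R ^ Suc (2 * k + 1) / Suc (2 * k + 1))"
    using integral_power[of 0 R "2 * k + 1"] R by simp
  also have "\<dots> = pi * R ^ (2 * k + 2) / (real k + 1)" by (simp add: field_simps)
  finally show ?thesis using True by simp
qed

lemma monomial_inner:
  "L2_inner (\<lambda>z. z ^ j) (\<lambda>z. z ^ k) = (if j = k then of_real (pi / (real k + 1)) else 0)"
proof -
  have "L2_inner (\<lambda>z. z ^ j) (\<lambda>z. z ^ k) = (LINT z|disk_measure. indicator (ball 0 1) z *\<^sub>R (z ^ j * cnj z ^ k))"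
    unfolding L2_inner_def by (rule Bochner_Integration.integral_cong) auto
  then show ?thesis by (simp only: truncated_monomial_integral[of 1 j k]) simp
qed


section \<open>Taylor coefficients, moments and the integral operator of the kernel\<close>

definition disk_kernel :: "complex \<Rightarrow> complex \<Rightarrow> complex" where
  "disk_kernel z w = (if z \<in> disk \<and> w \<in> disk then 1 / (of_real pi * (1 - z * cnj w)\<^sup>2) else 0)"

definition disk_moment :: "(complex \<Rightarrow> complex) \<Rightarrow> nat \<Rightarrow> complex" where
  "disk_moment f k = L2_inner f (\<lambda>z. z ^ k)"

definition projected :: "(complex \<Rightarrow> complex) \<Rightarrow> complex \<Rightarrow> complex" where
  "projected f z = (LINT w|disk_measure. disk_kernel z w * f w)"

text \<open>The monomial z^k has squared norm pi / (k + 1), so this is its Fourier coefficient and,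
  once \<open>projected\<close> is known to be the projection, the k-th Taylor coefficient of the
  projection.\<close>

definition projection_coeff :: "(complex \<Rightarrow> complex) \<Rightarrow> nat \<Rightarrow> complex" where
  "projection_coeff f k = of_real ((real k + 1) / pi) * disk_moment f k"

text \<open>On a disk of radius R < 1 the series is integrated termwise and only the k-th term
  survives; R tends to 1 by dominated convergence with majorant |v|.\<close>

lemma integral_L2_taylor:
  fixes a :: "nat \<Rightarrow> complex"
  assumes v: "integrable disk_measure v" and s: "\<And>z. z \<in> disk \<Longrightarrow> (\<lambda>n. a n * z ^ n) sums v z"
  shows "(LINT z|disk_measure. v z * cnj z ^ k) = of_real (pi / (real k + 1)) * a k"
proof -
  interpret finite_measure disk_measure by (rule finite_disk_measure)
  have meas: "(\<lambda>z. indicator (ball 0 R) z *\<^sub>R (c * (z ^ j * cnj z ^ k))) \<in> borel_measurable disk_measure" for R j c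
  proof (rule measurable_restrict_space1, rule measurable_completion)
    have [measurable]: "ball 0 R \<in> sets (borel :: complex measure)" by simp
    have [measurable]: "cnj \<in> borel_measurable borel"
      by (intro borel_measurable_continuous_onI continuous_intros)
    have "(\<lambda>z. indicator (ball 0 R) z *\<^sub>R (c * (z ^ j * cnj z ^ k))) \<in> borel_measurable borel" by measurable
    then show "(\<lambda>z. indicator (ball 0 R) z *\<^sub>R (c * (z ^ j * cnj z ^ k))) \<in> borel_measurable lborel" by simp
  qed
  have trunc: "(LINT z|disk_measure. indicator (ball 0 R) z *\<^sub>R (v z * cnj z ^ k)) = a k * of_real (pi * R ^ (2 * k + 2) / (real k + 1))"
    if R: "0 < R" "R < 1" for R
  proof -
    let ?f = "\<lambda>j z. indicator (ball 0 R) z *\<^sub>R (a j * (z ^ j * cnj z ^ k))"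
    have bd: "cmod (?f j z) \<le> cmod (a j) * R ^ j" if "z \<in> disk" for j z
    proof (cases "cmod z < R")
      case True
      have "cmod z ^ j * cmod z ^ k \<le> R ^ j * 1"
        using True R by (intro mult_mono power_mono power_le_one) auto
      then show ?thesis using True by (simp add: norm_mult norm_power mult_left_mono)
    qed (use R in auto)
    have int: "integrable disk_measure (?f j)" for j
    proof (rule integrable_const_bound[where B = "cmod (a j) * R ^ j"])
      show "AE z in disk_measure. cmod (?f j z) \<le> cmod (a j) * R ^ j"
        by (subst AE_restrict_space_iff) (use bd in auto)
    qed (rule meas)
    \<comment> \<open>Convergence at this point between R and 1 gives absolute convergence at radius
      R.\<close>
    define w :: complex where "w = of_real ((1 + R) / 2)"
    have w: "cmod w = (1 + R) / 2" unfolding w_def norm_of_real using R by simp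
    have "summable (\<lambda>j. a j * w ^ j)"
      by (rule sums_summable[OF s]) (use R in \<open>simp add: w\<close>)
    then have "summable (\<lambda>j. norm (a j * of_real R ^ j))"
      by (rule powser_insidea) (use R in \<open>simp add: w\<close>)
    then have sumR: "summable (\<lambda>j. cmod (a j) * R ^ j)"
      using R by (simp add: norm_mult norm_power)
    have "(\<lambda>j. LINT z|disk_measure. ?f j z) sums (LINT z|disk_measure. (\<Sum>j. ?f j z))"
    proof (rule sums_integral)
      show "integrable disk_measure (?f j)" for j by (rule int)
      have "summable (\<lambda>j. norm (?f j z))" if "z \<in> disk" for z
        by (rule summable_comparison_test'[OF sumR, of 0]) (use bd[OF that] in auto)
      then show "AE z in disk_measure. summable (\<lambda>j. norm (?f j z))"
        by (subst AE_restrict_space_iff) auto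
      have "norm (LINT z|disk_measure. norm (?f j z)) \<le> (cmod (a j) * R ^ j) * measure disk_measure (space disk_measure)" for j
      proof -
        have "(LINT z|disk_measure. norm (?f j z)) \<le> (LINT z|disk_measure. cmod (a j) * R ^ j)"
          by (rule Bochner_Integration.integral_mono[OF integrable_norm[OF int]]) (use bd in auto)
        moreover have "0 \<le> (LINT z|disk_measure. norm (?f j z))" by (rule Bochner_Integration.integral_nonneg) simp
        ultimately show ?thesis by (simp add: mult_ac)
      qed
      then show "summable (\<lambda>j. LINT z|disk_measure. norm (?f j z))"
        by (intro summable_comparison_test'[OF summable_mult2[OF sumR], of 0]) auto
    qed
    moreover have "(LINT z|disk_measure. ?f j z) = (if j = k then a k * of_real (pi * R ^ (2 * k + 2) / (real k + 1)) else 0)" for j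
    proof -
      have "(LINT z|disk_measure. ?f j z) = (LINT z|disk_measure. a j * (indicator (ball 0 R) z *\<^sub>R (z ^ j * cnj z ^ k)))"
        by (simp add: scaleR_conv_of_real mult_ac)
      also have "\<dots> = a j * (LINT z|disk_measure. indicator (ball 0 R) z *\<^sub>R (z ^ j * cnj z ^ k))" by (rule integral_mult_right_zero)
      finally show ?thesis using R by (simp add: truncated_monomial_integral)
    qed
    ultimately have "(\<lambda>j. if j = k then a k * of_real (pi * R ^ (2 * k + 2) / (real k + 1)) else 0) sums (LINT z|disk_measure. (\<Sum>j. ?f j z))"
      by (simp only:)
    then have "(LINT z|disk_measure. (\<Sum>j. ?f j z)) = a k * of_real (pi * R ^ (2 * k + 2) / (real k + 1))"
      using sums_unique2 sums_single[of k "\<lambda>_. a k * of_real (pi * R ^ (2 * k + 2) / (real k + 1))"] by blast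
    moreover have "(LINT z|disk_measure. (\<Sum>j. ?f j z)) = (LINT z|disk_measure. indicator (ball 0 R) z *\<^sub>R (v z * cnj z ^ k))"
    proof (rule Bochner_Integration.integral_cong[OF refl])
      fix z assume "z \<in> space disk_measure"
      then have "(\<lambda>j. indicator (ball 0 R) z *\<^sub>R (a j * z ^ j * cnj z ^ k)) sums (indicator (ball 0 R) z *\<^sub>R (v z * cnj z ^ k))"
        by (intro sums_scaleR_right sums_mult2 s) simp
      then show "(\<Sum>j. ?f j z) = indicator (ball 0 R) z *\<^sub>R (v z * cnj z ^ k)"
        by (simp add: sums_iff mult.assoc)
    qed
    ultimately show ?thesis by simp
  qed
  define R where "R n = 1 - 1 / real (n + 2)" for n
  have R: "0 < R n" "R n < 1" for n by (auto simp: R_def field_simps)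
  have Rlim: "R \<longlonglongrightarrow> 1" unfolding R_def by real_asymp
  have vm: "(\<lambda>z. v z * cnj z ^ k) \<in> borel_measurable disk_measure"
    by (rule borel_measurable_times[OF borel_measurable_integrable[OF v] measurable_disk_continuous])
      (auto intro!: continuous_intros)
  have "(\<lambda>n. LINT z|disk_measure. indicator (ball 0 (R n)) z *\<^sub>R (v z * cnj z ^ k)) \<longlonglongrightarrow> (LINT z|disk_measure. v z * cnj z ^ k)"
  proof (rule integral_dominated_convergence[where w = "\<lambda>z. cmod (v z)"])
    show "integrable disk_measure (\<lambda>z. cmod (v z))" using v by (rule integrable_norm)
    show "(\<lambda>z. indicator (ball 0 (R n)) z *\<^sub>R (v z * cnj z ^ k)) \<in> borel_measurable disk_measure" for n
    proof (rule borel_measurable_scaleR[OF _ vm])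
      have [measurable]: "ball 0 (R n) \<in> sets (borel :: complex measure)" by simp
      have "(indicator (ball 0 (R n)) :: complex \<Rightarrow> real) \<in> borel_measurable borel" by measurable
      then have "(indicator (ball 0 (R n)) :: complex \<Rightarrow> real) \<in> borel_measurable lborel" by simp
      then show "(indicator (ball 0 (R n)) :: complex \<Rightarrow> real) \<in> borel_measurable disk_measure"
        by (intro measurable_restrict_space1 measurable_completion)
    qed
    have "(\<lambda>n. indicator (ball 0 (R n)) z *\<^sub>R (v z * cnj z ^ k)) \<longlonglongrightarrow> v z * cnj z ^ k" if "z \<in> disk" for z
    proof (rule tendsto_eventually)
      have "\<forall>\<^sub>F n in sequentially. cmod z < R n" using order_tendstoD(1)[OF Rlim] that by simp
      then show "\<forall>\<^sub>F n in sequentially. indicator (ball 0 (R n)) z *\<^sub>R (v z * cnj z ^ k) = v z * cnj z ^ k"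
        by eventually_elim simp
    qed
    then show "AE z in disk_measure. (\<lambda>n. indicator (ball 0 (R n)) z *\<^sub>R (v z * cnj z ^ k)) \<longlonglongrightarrow> v z * cnj z ^ k"
      by (subst AE_restrict_space_iff) auto
    have "cmod (indicator (ball 0 (R n)) z *\<^sub>R (v z * cnj z ^ k)) \<le> cmod (v z)" if "z \<in> disk" for n z
    proof -
      have "cmod z ^ k \<le> 1" using that by (intro power_le_one) auto
      then show ?thesis by (auto simp: indicator_def norm_mult norm_power mult_left_le)
    qed
    then show "AE z in disk_measure. cmod (indicator (ball 0 (R n)) z *\<^sub>R (v z * cnj z ^ k)) \<le> cmod (v z)" for n
      by (subst AE_restrict_space_iff) auto
  qed (use vm in auto)
  then have "(\<lambda>n. a k * of_real (pi * R n ^ (2 * k + 2) / (real k + 1))) \<longlonglongrightarrow> (LINT z|disk_measure. v z * cnj z ^ k)"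
    by (simp only: trunc[OF R])
  moreover have "(\<lambda>n. a k * of_real (pi * R n ^ (2 * k + 2) / (real k + 1))) \<longlonglongrightarrow> a k * of_real (pi * 1 ^ (2 * k + 2) / (real k + 1))"
    by (intro tendsto_intros Rlim) auto
  ultimately show ?thesis using LIMSEQ_unique by (fastforce simp: mult.commute)
qed

lemma disk_moment_taylor:
  fixes a :: "nat \<Rightarrow> complex"
  assumes "v \<in> L2_disk" "\<And>z. z \<in> disk \<Longrightarrow> (\<lambda>n. a n * z ^ n) sums v z"
  shows "disk_moment v k = of_real (pi / (real k + 1)) * a k"
  using integral_L2_taylor[OF L2_integrable[OF assms(1)] assms(2)]
  by (simp add: disk_moment_def L2_inner_def)

text \<open>The kernel is the derivative of a geometric series, the sum of (k+1)/pi (z cnj w)^k.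
  Integration is termwise because (k+1) |z|^k is summable and |f| is integrable.\<close>

lemma projected_sums:
  assumes f: "f \<in> L2_disk" and z: "z \<in> disk"
  shows "(\<lambda>k. projection_coeff f k * z ^ k) sums projected f z"
proof -
  let ?g = "\<lambda>k w. of_real ((real k + 1) / pi) * z ^ k * (f w * cnj (w ^ k))"
  have z1: "cmod z < 1" using z by simp
  have int: "integrable disk_measure (?g k)" for k
    by (intro integrable_mult_right L2_mult_integrable f L2_monomial)
  define A where "A = (LINT w|disk_measure. cmod (f w))"
  have sumr: "summable (\<lambda>k. real (Suc k) * cmod z ^ k)"
    using geometric_deriv_sums[of "cmod z"] z1 by (auto simp: sums_iff)
  have bd: "cmod (?g k w) \<le> real (Suc k) / pi * cmod z ^ k * cmod (f w)" if "w \<in> disk" for k w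
  proof -
    have "cmod (f w) * cmod w ^ k \<le> cmod (f w) * 1"
      using that by (intro mult_left_mono power_le_one) auto
    then have "real (Suc k) / pi * cmod z ^ k * (cmod (f w) * cmod w ^ k) \<le> real (Suc k) / pi * cmod z ^ k * (cmod (f w) * 1)"
      by (rule mult_left_mono) auto
    moreover have "cmod (?g k w) = real (Suc k) / pi * cmod z ^ k * (cmod (f w) * cmod w ^ k)"
      unfolding norm_mult norm_power norm_of_real complex_mod_cnj by simp
    ultimately show ?thesis by (simp only: mult_1_right)
  qed
  have "(\<lambda>k. LINT w|disk_measure. ?g k w) sums (LINT w|disk_measure. (\<Sum>k. ?g k w))"
  proof (rule sums_integral)
    show "integrable disk_measure (?g k)" for k by (rule int)
    have "summable (\<lambda>k. norm (?g k w))" if "w \<in> disk" for w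
    proof (rule summable_comparison_test'[of _ 0])
      show "summable (\<lambda>k. (cmod (f w) / pi) * (real (Suc k) * cmod z ^ k))" by (rule summable_mult[OF sumr])
      show "norm (norm (?g k w)) \<le> (cmod (f w) / pi) * (real (Suc k) * cmod z ^ k)" for k
        using bd[OF that, of k] by (simp add: mult_ac)
    qed
    then show "AE w in disk_measure. summable (\<lambda>k. norm (?g k w))"
      by (subst AE_restrict_space_iff) auto
    show "summable (\<lambda>k. LINT w|disk_measure. norm (?g k w))"
    proof (rule summable_comparison_test'[of _ 0])
      show "summable (\<lambda>k. (A / pi) * (real (Suc k) * cmod z ^ k))" by (rule summable_mult[OF sumr])
      fix k
      have "(LINT w|disk_measure. norm (?g k w)) \<le> (LINT w|disk_measure. real (Suc k) / pi * cmod z ^ k * cmod (f w))"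
        by (rule Bochner_Integration.integral_mono[OF integrable_norm[OF int]]) (use bd L2_integrable[OF f] in auto)
      also have "\<dots> = (A / pi) * (real (Suc k) * cmod z ^ k)" by (simp add: A_def mult_ac)
      finally have "(LINT w|disk_measure. norm (?g k w)) \<le> (A / pi) * (real (Suc k) * cmod z ^ k)" .
      moreover have "0 \<le> (LINT w|disk_measure. norm (?g k w))" by (rule Bochner_Integration.integral_nonneg) simp
      ultimately show "norm (LINT w|disk_measure. norm (?g k w)) \<le> (A / pi) * (real (Suc k) * cmod z ^ k)" by simp
    qed
  qed
  moreover have "(LINT w|disk_measure. ?g k w) = projection_coeff f k * z ^ k" for k
  proof -
    have "(LINT w|disk_measure. ?g k w) = of_real ((real k + 1) / pi) * z ^ k * (LINT w|disk_measure. f w * cnj (w ^ k))"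
      by (rule integral_mult_right_zero)
    then show ?thesis by (simp only: projection_coeff_def disk_moment_def L2_inner_def mult_ac)
  qed
  moreover have "(LINT w|disk_measure. (\<Sum>k. ?g k w)) = projected f z"
    unfolding projected_def
  proof (rule Bochner_Integration.integral_cong[OF refl])
    fix w assume "w \<in> space disk_measure"
    then have w: "w \<in> disk" by simp
    have "cmod (z * cnj w) < 1"
      using z1 w mult_strict_mono'[of "cmod z" 1 "cmod w" 1] by (simp add: norm_mult)
    from sums_mult[OF geometric_deriv_sums[OF this], of "f w / of_real pi"]
    have "(\<lambda>k. f w / of_real pi * (of_nat (Suc k) * (z * cnj w) ^ k)) sums (f w / of_real pi * (1 / (1 - z * cnj w)\<^sup>2))" .
    moreover have "f w / of_real pi * (of_nat (Suc k) * (z * cnj w) ^ k) = ?g k w" for k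
      by (simp add: power_mult_distrib field_simps)
    ultimately have "(\<lambda>k. ?g k w) sums (f w / of_real pi * (1 / (1 - z * cnj w)\<^sup>2))" by (simp only:)
    from sums_unique[OF this, symmetric] show "(\<Sum>k. ?g k w) = disk_kernel z w * f w"
      using w z by (simp only: disk_kernel_def) simp
  qed
  ultimately show ?thesis by simp
qed


lemma polynomial_norm:
  fixes a :: "nat \<Rightarrow> complex"
  assumes "finite A"
  shows "(LINT z|disk_measure. (cmod (\<Sum>k\<in>A. a k * z ^ k))\<^sup>2) = (\<Sum>k\<in>A. pi / (real k + 1) * (cmod (a k))\<^sup>2)"
proof -
  let ?p = "\<lambda>z. \<Sum>k\<in>A. a k * z ^ k"
  have p: "?p \<in> L2_disk" by (intro L2_sum assms L2_cmult L2_monomial)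
  have "of_real (LINT z|disk_measure. (cmod (?p z))\<^sup>2) = L2_inner ?p ?p" by (rule L2_inner_self[symmetric])
  also have "\<dots> = (\<Sum>k\<in>A. a k * L2_inner (\<lambda>z. z ^ k) ?p)"
    by (rule L2_inner_sum_left[OF assms L2_monomial p])
  also have "\<dots> = (\<Sum>k\<in>A. a k * (\<Sum>j\<in>A. cnj (a j) * L2_inner (\<lambda>z. z ^ k) (\<lambda>z. z ^ j)))"
    by (simp only: L2_inner_sum_right[OF assms L2_monomial L2_monomial])
  also have "\<dots> = (\<Sum>k\<in>A. of_real (pi / (real k + 1) * (cmod (a k))\<^sup>2))"
  proof (rule sum.cong[OF refl])
    fix k assume "k \<in> A"
    have "(\<Sum>j\<in>A. cnj (a j) * L2_inner (\<lambda>z. z ^ k) (\<lambda>z. z ^ j)) = (\<Sum>j\<in>A. if j = k then cnj (a k) * of_real (pi / (real k + 1)) else 0)"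
      by (intro sum.cong refl) (auto simp: monomial_inner)
    also have "\<dots> = cnj (a k) * of_real (pi / (real k + 1))" using assms \<open>k \<in> A\<close> by (simp add: sum.delta)
    finally have "a k * (\<Sum>j\<in>A. cnj (a j) * L2_inner (\<lambda>z. z ^ k) (\<lambda>z. z ^ j)) = of_real (pi / (real k + 1)) * (a k * cnj (a k))" by simp
    also have "\<dots> = of_real (pi / (real k + 1) * (cmod (a k))\<^sup>2)" by (simp only: complex_norm_square[symmetric] of_real_mult)
    finally show "a k * (\<Sum>j\<in>A. cnj (a j) * L2_inner (\<lambda>z. z ^ k) (\<lambda>z. z ^ j)) = of_real (pi / (real k + 1) * (cmod (a k))\<^sup>2)" .
  qed
  also have "\<dots> = of_real (\<Sum>k\<in>A. pi / (real k + 1) * (cmod (a k))\<^sup>2)" by simp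
  finally show ?thesis using of_real_eq_iff by blast
qed

lemma coeff_moment:
  "of_real (pi / (real k + 1)) * projection_coeff f k = disk_moment f k"
proof -
  have "real k + 1 \<noteq> 0" by linarith
  then have "(pi / (real k + 1)) * ((real k + 1) / pi) = 1" by simp
  then have "complex_of_real (pi / (real k + 1)) * complex_of_real ((real k + 1) / pi) = 1"
    unfolding of_real_mult[symmetric] by simp
  then show ?thesis
    unfolding projection_coeff_def by (simp only: mult.assoc[symmetric] of_nat_add of_nat_1 mult_1 add.commute)
qed

text \<open>Bessel's inequality: the squared norm of \<open>f\<close> minus its partial sum is
  nonnegative and equals the squared norm of \<open>f\<close> minus the partial sum of the
  series.\<close>

lemma bessel_summable:
  assumes f: "f \<in> L2_disk"
  shows "summable (\<lambda>k. pi / (real k + 1) * (cmod (projection_coeff f k))\<^sup>2)"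
proof (rule summableI_nonneg_bounded[of _ "LINT z|disk_measure. (cmod (f z))\<^sup>2"])
  let ?b = "\<lambda>k. pi / (real k + 1) * (cmod (projection_coeff f k))\<^sup>2"
  show "0 \<le> pi / (real k + 1) * (cmod (projection_coeff f k))\<^sup>2" for k :: nat by simp
  fix n
  define s where "s = (\<lambda>z. \<Sum>k<n. projection_coeff f k * z ^ k)"
  define S where "S = (\<Sum>k<n. ?b k)"
  have s: "s \<in> L2_disk" unfolding s_def by (intro L2_sum L2_cmult L2_monomial) auto
  have ss: "L2_inner s s = of_real S"
    unfolding L2_inner_self s_def S_def by (subst polynomial_norm) (auto simp: add.commute)
  have "L2_inner f s = (\<Sum>k<n. cnj (projection_coeff f k) * disk_moment f k)"
    unfolding s_def disk_moment_def by (rule L2_inner_sum_right) (auto intro: L2_monomial f)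
  also have "\<dots> = (\<Sum>k<n. of_real (?b k))"
  proof (rule sum.cong[OF refl])
    fix k
    have "disk_moment f k = of_real (pi / (real k + 1)) * projection_coeff f k"
      by (rule coeff_moment[symmetric])
    then have "cnj (projection_coeff f k) * disk_moment f k = of_real (pi / (real k + 1)) * (projection_coeff f k * cnj (projection_coeff f k))" by simp
    then show "cnj (projection_coeff f k) * disk_moment f k = of_real (?b k)"
      by (simp only: complex_norm_square[symmetric] of_real_mult)
  qed
  also have "\<dots> = of_real S" by (simp add: S_def)
  finally have fs: "L2_inner f s = of_real S" .
  have sf: "L2_inner s f = of_real S" by (subst L2_inner_commute) (simp add: fs)
  have "of_real (LINT z|disk_measure. (cmod (f z - s z))\<^sup>2) = L2_inner (\<lambda>z. f z - s z) (\<lambda>z. f z - s z)"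
    by (rule L2_inner_self[symmetric])
  also have "\<dots> = L2_inner f f - L2_inner s f - (L2_inner f s - L2_inner s s)"
    using f s by (simp add: L2_inner_diff_left L2_inner_diff_right L2_diff)
  also have "\<dots> = of_real ((LINT z|disk_measure. (cmod (f z))\<^sup>2) - S)"
    by (simp add: fs sf L2_inner_self ss[unfolded L2_inner_self of_real_eq_iff])
  finally have "(LINT z|disk_measure. (cmod (f z - s z))\<^sup>2) = (LINT z|disk_measure. (cmod (f z))\<^sup>2) - S"
    using of_real_eq_iff by blast
  moreover have "0 \<le> (LINT z|disk_measure. (cmod (f z - s z))\<^sup>2)" by (rule Bochner_Integration.integral_nonneg) simp
  ultimately show "(\<Sum>k<n. pi / (real k + 1) * (cmod (projection_coeff f k))\<^sup>2) \<le> (LINT z|disk_measure. (cmod (f z))\<^sup>2)"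
    by (simp add: S_def add.commute)
qed

text \<open>Parseval for differences of Taylor polynomials, carried to the pointwise limit by
  Fatou's lemma; square integrability of \<open>v\<close> is a by-product.\<close>

lemma taylor_L2_estimate:
  fixes a :: "nat \<Rightarrow> complex"
  assumes v: "v \<in> borel_measurable disk_measure" and s: "\<And>z. z \<in> disk \<Longrightarrow> (\<lambda>n. a n * z ^ n) sums v z"
    and b: "summable (\<lambda>k. pi / (real k + 1) * (cmod (a k))\<^sup>2)"
  shows "v \<in> L2_disk"
    "(LINT z|disk_measure. (cmod (v z - (\<Sum>k<n. a k * z ^ k)))\<^sup>2) \<le> (\<Sum>k. pi / (real (k + n) + 1) * (cmod (a (k + n)))\<^sup>2)"
proof -
  define p where "p n z = (\<Sum>k<n. a k * z ^ k)" for n and z :: complex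
  define b' where "b' k = pi / (real k + 1) * (cmod (a k))\<^sup>2" for k
  have b0: "0 \<le> b' k" for k by (simp add: b'_def)
  have sumb: "summable b'" using b by (simp add: b'_def[abs_def] add.commute)
  have sumbn: "summable (\<lambda>k. b' (k + n))" for n using sumb by (simp add: summable_iff_shift)
  have pL2: "p n \<in> L2_disk" for n
    unfolding p_def by (intro L2_sum L2_cmult L2_monomial) auto
  have key: "v \<in> L2_disk \<and> (LINT z|disk_measure. (cmod (v z - p n z))\<^sup>2) \<le> (\<Sum>k. b' (k + n))" for n
  proof -
    let ?T = "\<Sum>k. b' (k + n)"
    have T0: "0 \<le> ?T" by (intro suminf_nonneg sumbn b0)
    have diffm: "(\<lambda>z. v z - p n z) \<in> borel_measurable disk_measure"
      using v L2_measurable[OF pL2] by measurable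
    have nm: "(\<integral>\<^sup>+ z. ennreal ((cmod (p m z - p n z))\<^sup>2) \<partial>disk_measure) \<le> ennreal ?T" if "m \<ge> n" for m
    proof -
      have "p m z - p n z = (\<Sum>k\<in>{n..<m}. a k * z ^ k)" for z
        using that sum_diff[of "{..<m}" "{..<n}" "\<lambda>k. a k * z ^ k"]
        by (simp add: p_def lessThan_minus_lessThan)
      then have eq: "(LINT z|disk_measure. (cmod (p m z - p n z))\<^sup>2) = (\<Sum>k\<in>{n..<m}. b' k)"
        by (simp add: polynomial_norm b'_def add.commute)
      have "(\<Sum>k\<in>{n..<m}. b' k) = (\<Sum>k<m - n. b' (k + n))"
        using sum.shift_bounds_nat_ivl[of b' 0 n "m - n"] that by (simp add: lessThan_atLeast0)
      also have "\<dots> \<le> ?T" by (intro sum_le_suminf sumbn b0) auto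
      finally have "(LINT z|disk_measure. (cmod (p m z - p n z))\<^sup>2) \<le> ?T" unfolding eq .
      moreover have "(\<integral>\<^sup>+ z. ennreal ((cmod (p m z - p n z))\<^sup>2) \<partial>disk_measure) = ennreal (LINT z|disk_measure. (cmod (p m z - p n z))\<^sup>2)"
        by (rule nn_integral_eq_integral) (rule L2_sq_integrable[OF L2_diff[OF pL2 pL2]], simp)
      ultimately show ?thesis by (simp add: ennreal_leI)
    qed
    have lim: "(\<lambda>m. ennreal ((cmod (p m z - p n z))\<^sup>2)) \<longlonglongrightarrow> ennreal ((cmod (v z - p n z))\<^sup>2)" if "z \<in> disk" for z
    proof -
      have "(\<lambda>m. p m z) \<longlonglongrightarrow> v z" using s[OF that] by (simp add: sums_def p_def)
      then show ?thesis by (intro tendsto_intros)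
    qed
    have "(\<integral>\<^sup>+ z. ennreal ((cmod (v z - p n z))\<^sup>2) \<partial>disk_measure) =
        (\<integral>\<^sup>+ z. liminf (\<lambda>m. ennreal ((cmod (p m z - p n z))\<^sup>2)) \<partial>disk_measure)"
      by (intro nn_integral_cong lim_imp_Liminf[symmetric] lim) auto
    also have "\<dots> \<le> liminf (\<lambda>m. \<integral>\<^sup>+ z. ennreal ((cmod (p m z - p n z))\<^sup>2) \<partial>disk_measure)"
    proof (rule nn_integral_liminf)
      show "(\<lambda>z. ennreal ((cmod (p m z - p n z))\<^sup>2)) \<in> borel_measurable disk_measure" for m
        using L2_measurable[OF pL2] by measurable
    qed
    also have "\<dots> \<le> ennreal ?T"
    proof (rule Liminf_le)
      show "\<forall>\<^sub>F m in sequentially. (\<integral>\<^sup>+ z. ennreal ((cmod (p m z - p n z))\<^sup>2) \<partial>disk_measure) \<le> ennreal ?T"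
        using nm by (auto simp: eventually_sequentially)
    qed simp
    finally have le: "(\<integral>\<^sup>+ z. ennreal ((cmod (v z - p n z))\<^sup>2) \<partial>disk_measure) \<le> ennreal ?T" .
    have int: "integrable disk_measure (\<lambda>z. (cmod (v z - p n z))\<^sup>2)"
      by (rule integrableI_nonneg) (use diffm le in \<open>auto intro: le_less_trans\<close>)
    then have L2d: "(\<lambda>z. v z - p n z) \<in> L2_disk" using diffm by (simp add: L2_disk_def)
    have "v \<in> L2_disk" using L2_add[OF L2d pL2[of n]] by simp
    moreover have "(LINT z|disk_measure. (cmod (v z - p n z))\<^sup>2) \<le> ?T"
      using le nn_integral_eq_integral[OF int] T0 by simp
    ultimately show ?thesis by blast
  qed
  show "v \<in> L2_disk" using key by blast
  show "(LINT z|disk_measure. (cmod (v z - (\<Sum>k<n. a k * z ^ k)))\<^sup>2) \<le> (\<Sum>k. pi / (real (k + n) + 1) * (cmod (a (k + n)))\<^sup>2)"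
    using key[of n] by (simp add: p_def b'_def add.commute)
qed

lemma projected_holomorphic:
  assumes "f \<in> L2_disk"
  shows "projected f holomorphic_on disk"
  by (rule power_series_holomorphic[of 0 1 "projection_coeff f"]) (use projected_sums[OF assms] in simp)

lemma projected_bergman:
  assumes f: "f \<in> L2_disk"
  shows "projected f \<in> bergman_space"
proof -
  have "projected f \<in> borel_measurable disk_measure"
    by (intro measurable_disk_continuous holomorphic_on_imp_continuous_on projected_holomorphic f)
  then have "projected f \<in> L2_disk"
    by (rule taylor_L2_estimate(1)[OF _ projected_sums[OF f] bessel_summable[OF f]])
  then show ?thesis
    using projected_holomorphic[OF f] by (simp add: bergman_space_def projected_def disk_kernel_def)
qed

lemma bergman_space_L2: "v \<in> bergman_space \<Longrightarrow> v \<in> L2_disk"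
  by (simp add: bergman_space_def)

text \<open>The reproducing property: moments determine Taylor coefficients, so the series of
  \<open>projected v\<close> is the Taylor series of \<open>v\<close>.\<close>

lemma bergman_projected_self:
  assumes v: "v \<in> bergman_space"
  shows "projected v = v"
proof
  fix z
  show "projected v z = v z"
  proof (cases "z \<in> disk")
    case False
    then show ?thesis using v by (auto simp: bergman_space_def projected_def disk_kernel_def)
  next
    case True
    define a where "a n = (deriv ^^ n) v 0 / fact n" for n
    have tay: "(\<lambda>n. a n * z ^ n) sums v z" if "z \<in> disk" for z
      using holomorphic_power_series[of v 0 1 z] v that by (simp add: bergman_space_def a_def)
    have "projection_coeff v k = a k" for k
    proof -
      have "of_real (pi / (real k + 1)) * projection_coeff v k = of_real (pi / (real k + 1)) * a k"
        unfolding coeff_moment using disk_moment_taylor[OF bergman_space_L2[OF v] tay, of k] by (simp add: add.commute)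
      moreover have "complex_of_real (pi / (real k + 1)) \<noteq> 0"
        unfolding of_real_eq_0_iff using pi_neq_zero by (simp add: add_nonneg_eq_0_iff)
      ultimately show ?thesis by (simp only: mult_cancel_left) simp
    qed
    then have "(\<lambda>n. a n * z ^ n) sums projected v z"
      using projected_sums[OF bergman_space_L2[OF v] True] by simp
    with tay[OF True] show ?thesis by (rule sums_unique2[symmetric])
  qed
qed

lemma bergman_eqI:
  assumes u: "u \<in> bergman_space" and v: "v \<in> bergman_space" and eq: "\<And>k. disk_moment u k = disk_moment v k"
  shows "u = v"
proof -
  have "projected u z = projected v z" for z
  proof (cases "z \<in> disk")
    case True
    have "projection_coeff u = projection_coeff v" by (simp add: projection_coeff_def fun_eq_iff eq)
    then show ?thesis
      using projected_sums[OF bergman_space_L2[OF u] True] projected_sums[OF bergman_space_L2[OF v] True]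
      by (simp add: sums_unique2)
  qed (simp add: projected_def disk_kernel_def)
  then show ?thesis using bergman_projected_self[OF u] bergman_projected_self[OF v] by (simp add: fun_eq_iff)
qed

lemma disk_moment_projected:
  assumes f: "f \<in> L2_disk"
  shows "disk_moment (projected f) k = disk_moment f k"
  using disk_moment_taylor[OF bergman_space_L2[OF projected_bergman[OF f]] projected_sums[OF f], of k] coeff_moment[of k f]
  by (simp add: add.commute)

text \<open>Taylor polynomials converge to \<open>v\<close> in the L2 norm, so orthogonality to all
  monomials is enough.\<close>

lemma bergman_orthogonal:
  assumes h: "h \<in> L2_disk" and m: "\<And>k. disk_moment h k = 0" and v: "v \<in> bergman_space"
  shows "L2_inner h v = 0"
proof (rule ccontr)
  assume ne: "L2_inner h v \<noteq> 0"
  note vL2 = bergman_space_L2[OF v]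
  define p where "p n = (\<lambda>z. \<Sum>k<n. projection_coeff v k * z ^ k)" for n
  have pL2: "p n \<in> L2_disk" for n unfolding p_def by (intro L2_sum L2_cmult L2_monomial) auto
  have hp: "L2_inner h (p n) = 0" for n
  proof -
    have "L2_inner h (p n) = (\<Sum>k<n. cnj (projection_coeff v k) * L2_inner h (\<lambda>z. z ^ k))"
      unfolding p_def by (rule L2_inner_sum_right) (auto intro: L2_monomial h)
    then show ?thesis using m by (simp add: disk_moment_def)
  qed
  have eq: "L2_inner h v = L2_inner h (\<lambda>z. v z - p n z)" for n
    using L2_inner_diff_right[OF h vL2 pL2, of n] hp by simp
  define c where "c = cmod (L2_inner h v)"
  have c: "c > 0" using ne by (simp add: c_def)
  define A where "A = (LINT z|disk_measure. (cmod (h z))\<^sup>2)"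
  have A0: "A \<ge> 0" unfolding A_def by (rule Bochner_Integration.integral_nonneg) simp
  \<comment> \<open>With this weight the first term of \<open>L2_inner_le\<close> is at most
    \<open>c\<close>; a tail below t c makes the second one smaller than \<open>c\<close>, against
    the lower bound 2 c.\<close>
  define t where "t = c / (A + 1)"
  have t: "t > 0" using c A0 by (simp add: t_def)
  have tA: "t * A \<le> c" using c A0 by (simp add: t_def field_simps)
  let ?b = "\<lambda>k. pi / (real k + 1) * (cmod (projection_coeff v k))\<^sup>2"
  have "summable ?b" using bessel_summable[OF vL2] by (simp add: add.commute)
  then have tail: "(\<lambda>n. \<Sum>k. ?b (k + n)) \<longlonglongrightarrow> 0" by (rule suminf_exist_split2)
  have "t * c > 0" using t c by simp
  from order_tendstoD(2)[OF tail this] obtain n where n: "(\<Sum>k. ?b (k + n)) < t * c"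
    by (auto simp: eventually_sequentially)
  have sv: "(\<lambda>n. projection_coeff v n * z ^ n) sums v z" if "z \<in> disk" for z
    using projected_sums[OF vL2 that] bergman_projected_self[OF v] by simp
  have "(LINT z|disk_measure. (cmod (v z - p n z))\<^sup>2) \<le> (\<Sum>k. ?b (k + n))"
    using taylor_L2_estimate(2)[OF L2_measurable[OF vL2] sv bessel_summable[OF vL2], of n] by (simp add: p_def add.commute)
  with n have "(LINT z|disk_measure. (cmod (v z - p n z))\<^sup>2) / t < c"
    using t by (simp add: divide_less_eq mult.commute)
  moreover have "2 * c \<le> t * A + (LINT z|disk_measure. (cmod (v z - p n z))\<^sup>2) / t"
    using L2_inner_le[OF h L2_diff[OF vL2 pL2[of n]] t] eq[of n] by (simp add: c_def A_def)
  ultimately show False using tA by linarith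
qed

section \<open>Identification of the Bergman projection and the Bergman kernel\<close>

lemma truncated_monomial_bergman: "(\<lambda>z. if z \<in> disk then z ^ k else 0) \<in> bergman_space"
proof -
  have "(\<lambda>z::complex. z ^ k) holomorphic_on disk" by (intro holomorphic_intros)
  then have hol: "(\<lambda>z. if z \<in> disk then z ^ k else 0) holomorphic_on disk"
    by (rule holomorphic_transform) simp
  then have "(\<lambda>z. if z \<in> disk then z ^ k else 0) \<in> L2_disk"
    by (intro L2_bounded[of _ 1] measurable_disk_continuous holomorphic_on_imp_continuous_on)
      (auto simp: norm_power intro!: power_le_one)
  with hol show ?thesis by (simp add: bergman_space_def)
qed

lemma L2_inner_cong:
  "(\<And>z. z \<in> disk \<Longrightarrow> f z = f' z) \<Longrightarrow> (\<And>z. z \<in> disk \<Longrightarrow> g z = g' z) \<Longrightarrow> L2_inner f g = L2_inner f' g'"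
  unfolding L2_inner_def by (rule Bochner_Integration.integral_cong) auto

lemma bergman_proj_eq:
  assumes f: "f \<in> L2_disk"
  shows "bergman_proj f = projected f"
  unfolding bergman_proj_def
proof (rule the_equality)
  have pL2: "projected f \<in> L2_disk" using bergman_space_L2[OF projected_bergman[OF f]] .
  have "disk_moment (\<lambda>z. f z - projected f z) k = 0" for k
    using L2_inner_diff_left[OF f pL2 L2_monomial, of k] disk_moment_projected[OF f, of k]
    by (simp add: disk_moment_def)
  then show "projected f \<in> bergman_space \<and> (\<forall>v\<in>bergman_space. L2_inner (\<lambda>z. f z - projected f z) v = 0)"
    using bergman_orthogonal[OF L2_diff[OF f pL2]] projected_bergman[OF f] by blast
next
  fix g assume g: "g \<in> bergman_space \<and> (\<forall>v\<in>bergman_space. L2_inner (\<lambda>z. f z - g z) v = 0)"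
  then have gL2: "g \<in> L2_disk" by (blast intro: bergman_space_L2)
  show "g = projected f"
  proof (rule bergman_eqI[OF _ projected_bergman[OF f]])
    show "g \<in> bergman_space" using g by blast
    fix k
    have "L2_inner (\<lambda>z. f z - g z) (\<lambda>z. if z \<in> disk then z ^ k else 0) = 0"
      using g truncated_monomial_bergman by blast
    then have "L2_inner (\<lambda>z. f z - g z) (\<lambda>z. z ^ k) = 0"
      using L2_inner_cong[of "\<lambda>z. f z - g z" "\<lambda>z. f z - g z" "\<lambda>z. z ^ k" "\<lambda>z. if z \<in> disk then z ^ k else 0"] by simp
    then show "disk_moment g k = disk_moment (projected f) k"
      using L2_inner_diff_left[OF f gL2 L2_monomial, of k]
      by (simp add: disk_moment_projected[OF f]) (simp add: disk_moment_def)
  qed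
qed

lemma disk_kernel_bergman:
  assumes z: "z \<in> disk"
  shows "(\<lambda>w. cnj (disk_kernel z w)) \<in> bergman_space"
proof -
  have ne: "1 - cnj z * w \<noteq> 0" if "cmod w \<le> 1" for w
  proof
    assume "1 - cnj z * w = 0"
    then have "cmod (cnj z * w) = 1" by simp
    moreover have "cmod (cnj z * w) < 1"
      using z that mult_mono[of "cmod z" "cmod z" "cmod w" 1] by (auto simp: norm_mult)
    ultimately show False by simp
  qed
  let ?k = "\<lambda>w. 1 / (of_real pi * (1 - cnj z * w)\<^sup>2)"
  have kc: "continuous_on (cball 0 1) ?k"
    using ne by (intro continuous_intros) auto
  have "?k holomorphic_on disk"
    using ne by (intro holomorphic_intros) auto
  then have hol: "(\<lambda>w. cnj (disk_kernel z w)) holomorphic_on disk"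
    by (rule holomorphic_transform) (use z in \<open>simp add: disk_kernel_def\<close>)
  have "bounded (?k ` cball 0 1)"
    by (intro compact_imp_bounded compact_continuous_image kc compact_cball)
  then obtain B where B: "\<forall>w\<in>cball 0 1. cmod (?k w) \<le> B" by (auto simp: bounded_iff)
  have "(\<lambda>w. cnj (disk_kernel z w)) \<in> L2_disk"
  proof (rule L2_bounded[of _ B])
    show "(\<lambda>w. cnj (disk_kernel z w)) \<in> borel_measurable disk_measure"
      by (intro measurable_disk_continuous holomorphic_on_imp_continuous_on hol)
    fix w :: complex assume "w \<in> disk"
    then have "cnj (disk_kernel z w) = ?k w" using z by (simp add: disk_kernel_def)
    then show "cmod (cnj (disk_kernel z w)) \<le> B" using bspec[OF B, of w] \<open>w \<in> disk\<close> by simp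
  qed
  with hol show ?thesis by (simp add: bergman_space_def disk_kernel_def)
qed

text \<open>For uniqueness, the projections of the monomials prescribe all moments of the conjugated
  kernel section, and a Bergman function is determined by its moments.\<close>

lemma bergman_kernel_eq: "bergman_kernel = disk_kernel"
  unfolding bergman_kernel_def
proof (rule the_equality)
  show "(\<forall>z\<in>disk. (\<lambda>w. cnj (disk_kernel z w)) \<in> bergman_space) \<and>
     (\<forall>z w. z \<notin> disk \<longrightarrow> disk_kernel z w = 0) \<and>
     (\<forall>f\<in>L2_disk. \<forall>z\<in>disk. bergman_proj f z = (LINT w|disk_measure. disk_kernel z w * f w))"
    by (auto simp: disk_kernel_bergman[simplified] bergman_proj_eq projected_def) (simp add: disk_kernel_def)
next
  fix P assume P: "(\<forall>z\<in>disk. (\<lambda>w. cnj (P z w)) \<in> bergman_space) \<and>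
     (\<forall>z w. z \<notin> disk \<longrightarrow> P z w = 0) \<and>
     (\<forall>f\<in>L2_disk. \<forall>z\<in>disk. bergman_proj f z = (LINT w|disk_measure. P z w * f w))"
  have "P z w = disk_kernel z w" for z w
  proof (cases "z \<in> disk")
    case False
    then show ?thesis using P by (simp add: disk_kernel_def)
  next
    case True
    have mom: "disk_moment (\<lambda>w. cnj (R z w)) k = cnj (LINT w|disk_measure. R z w * w ^ k)" for R :: "complex \<Rightarrow> complex \<Rightarrow> complex" and k
      unfolding disk_moment_def L2_inner_def Bochner_Integration.integral_cnj[symmetric] by simp
    have "(\<lambda>w. cnj (P z w)) = (\<lambda>w. cnj (disk_kernel z w))"
    proof (rule bergman_eqI)
      show "(\<lambda>w. cnj (P z w)) \<in> bergman_space" using P True by blast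
      show "(\<lambda>w. cnj (disk_kernel z w)) \<in> bergman_space" using True by (rule disk_kernel_bergman)
      fix k
      have "(LINT w|disk_measure. P z w * w ^ k) = bergman_proj (\<lambda>w. w ^ k) z"
        using P True L2_monomial by metis
      also have "\<dots> = (LINT w|disk_measure. disk_kernel z w * w ^ k)"
        by (simp add: bergman_proj_eq[OF L2_monomial] projected_def)
      finally show "disk_moment (\<lambda>w. cnj (P z w)) k = disk_moment (\<lambda>w. cnj (disk_kernel z w)) k"
        unfolding mom by simp
    qed
    then show ?thesis by (metis complex_cnj_cancel_iff)
  qed
  then show "P = disk_kernel" by (intro ext)
qed

section \<open>Toeplitz operators\<close>

lemma polar_term_alt:
  "z \<noteq> 0 \<Longrightarrow> polar_term h n z = h (cmod z) * sgn z powi n"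
  by (simp add: polar_term_def cis_power_int[symmetric] cis_Arg)

lemma polar_term_rotate:
  assumes c: "cmod c = 1" and z: "z \<noteq> 0"
  shows "polar_term h n (c * z) = c powi n * polar_term h n z"
proof -
  have "c * z \<noteq> 0" using c z by auto
  moreover have "sgn (c * z) = c * sgn z" using c by (simp add: sgn_div_norm norm_mult)
  ultimately show ?thesis using c z by (simp add: polar_term_alt norm_mult power_int_mult_distrib)
qed

text \<open>The integrand is multiplied by c^(n+m-j) under rotation by \<open>c\<close>. No
  integrability is assumed, since the integral is 0 in either case.\<close>

lemma polar_term_inner_zero:
  assumes "n + int m \<noteq> int j"
  shows "L2_inner (\<lambda>z. polar_term h n z * z ^ m) (\<lambda>z. z ^ j) = 0"
proof -
  obtain c where c: "cmod c = 1" "c \<noteq> -1" "c powi (n + (int m - int j)) \<noteq> 1"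
    using rotation_detecting_character[of "n + (int m - int j)"] assms by auto
  have c0: "c \<noteq> 0" using c(1) by auto
  have "(LINT z|disk_measure. polar_term h n z * (z ^ m * cnj z ^ j)) = 0"
  proof (rule integral_disk_rotation_zero[OF c(1,2) _ c(3)])
    fix z :: complex assume "z \<noteq> 0"
    then show "polar_term h n (c * z) * ((c * z) ^ m * cnj (c * z) ^ j) =
        c powi (n + (int m - int j)) * (polar_term h n z * (z ^ m * cnj z ^ j))"
      unfolding polar_term_rotate[OF c(1) \<open>z \<noteq> 0\<close>] monomial_rotate[OF c(1)] power_int_add[OF disjI1[OF c0]]
      by (simp only: mult_ac)
  qed
  then show ?thesis unfolding L2_inner_def by (simp add: mult.assoc)
qed

lemma monomial_polar:
  assumes "z \<noteq> 0"
  shows "z ^ m * cnj z ^ j = of_real (cmod z ^ (m + j)) * sgn z powi (int m - int j)"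
proof -
  define s where "s = sgn z"
  have s: "cmod s = 1" using assms by (simp add: s_def norm_sgn)
  have z: "z = s * of_real (cmod z)" using assms by (simp add: s_def sgn_div_norm scaleR_conv_of_real)
  have "z ^ m * cnj z ^ j = (s * of_real (cmod z)) ^ m * cnj (s * of_real (cmod z)) ^ j" by (simp only: z[symmetric])
  also have "\<dots> = s powi (int m - int j) * (of_real (cmod z) ^ m * cnj (of_real (cmod z)) ^ j)"
    by (rule monomial_rotate[OF s])
  finally show ?thesis by (simp add: s_def power_add mult_ac)
qed

text \<open>For j = n + m the angular factors cancel. The exponent 2 m + n + 1 is m + j from the two
  monomials plus 1 from the area element.\<close>

lemma polar_term_inner_moment:
  assumes nz: "radial_moment h (2 * int m + n + 1) \<noteq> 0" and L2: "polar_term h n \<in> L2_disk" and j: "n + int m = int j"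
  shows "L2_inner (\<lambda>z. polar_term h n z * z ^ m) (\<lambda>z. z ^ j) = 2 * pi * radial_moment h (2 * int m + n + 1)"
proof -
  have l: "2 * int m + n + 1 = int (m + j + 1)" using j by simp
  define q where "q r = h r * of_real (r powi (2 * int m + n + 1))" for r
  \<comment> \<open>A nonzero moment certifies integrability, because a divergent integral would
    have the value 0.\<close>
  have int: "integrable (lebesgue_on {0<..<1}) q"
    using nz not_integrable_integral_eq unfolding radial_moment_def q_def by blast
  have "(LINT z|disk_measure. polar_term h n z * (z ^ m * cnj z ^ j)) = 2 * pi * (LINT r|lebesgue_on {0<..<1}. q r)"
  proof (rule radial_integral[OF int])
    show "(\<lambda>z. polar_term h n z * (z ^ m * cnj z ^ j)) \<in> borel_measurable disk_measure"
      by (rule borel_measurable_times[OF L2_measurable[OF L2] measurable_disk_continuous]) (auto intro!: continuous_intros)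
    fix z :: complex assume z: "z \<noteq> 0"
    have s: "sgn z powi n * sgn z powi (int m - int j) = 1"
    proof -
      have "n + (int m - int j) = 0" using j by simp
      then have "sgn z powi (n + (int m - int j)) = 1" by simp
      then show ?thesis using z by (simp add: power_int_add sgn_zero_iff)
    qed
    have "polar_term h n z * (z ^ m * cnj z ^ j) =
        h (cmod z) * of_real (cmod z ^ (m + j)) * (sgn z powi n * sgn z powi (int m - int j))"
      unfolding polar_term_alt[OF z] monomial_polar[OF z] by (simp only: mult_ac)
    also have "\<dots> = h (cmod z) * of_real (cmod z ^ (m + j))" by (simp add: s)
    also have "\<dots> = q (cmod z) / of_real (cmod z)"
      unfolding q_def l power_int_of_nat using z by (simp add: field_simps)
    finally show "polar_term h n z * (z ^ m * cnj z ^ j) = q (cmod z) / of_real (cmod z)" .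
  qed
  then show ?thesis unfolding L2_inner_def radial_moment_def q_def by (simp add: mult.assoc)
qed

text \<open>Convergence in L2 passes to inner products, and multiplication by z^m does not increase
  norms on the disk. Partial sums that are eventually constant suffice, since each fixed j meets
  only finitely many frequencies.\<close>

lemma polar_expansion_inner:
  assumes f: "f \<in> L2_disk" and ex: "polar_expansion f F M"
    and ev: "\<forall>\<^sub>F N in sequentially. (\<Sum>n = - int N..M. L2_inner (\<lambda>z. polar_term (F n) n z * z ^ m) (\<lambda>z. z ^ j)) = c"
  shows "L2_inner (\<lambda>z. f z * z ^ m) (\<lambda>z. z ^ j) = c"
proof (rule ccontr)
  assume ne: "L2_inner (\<lambda>z. f z * z ^ m) (\<lambda>z. z ^ j) \<noteq> c"
  define S where "S N = (\<lambda>z. \<Sum>n = - int N..M. polar_term (F n) n z)" for N :: nat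
  have pL2: "polar_term (F n) n \<in> L2_disk" if "n \<le> M" for n using ex that by (simp add: polar_expansion_def)
  have SL2: "S N \<in> L2_disk" for N unfolding S_def by (rule L2_sum) (auto intro: pL2)
  have lim: "(\<lambda>N. LINT z|disk_measure. (cmod (f z - S N z))\<^sup>2) \<longlonglongrightarrow> 0"
    using ex by (simp add: polar_expansion_def S_def)
  have mono: "(\<lambda>z. g z * z ^ m) \<in> L2_disk" if "g \<in> L2_disk" for g
    by (rule L2_bounded_mult[OF that, of _ 1], rule measurable_disk_continuous)
      (auto intro!: continuous_intros power_le_one simp: norm_power)
  define P where "P = (LINT z::complex|disk_measure. (cmod (z ^ j))\<^sup>2)"
  have P0: "P \<ge> 0" unfolding P_def by (rule Bochner_Integration.integral_nonneg) simp
  define \<epsilon> where "\<epsilon> = cmod (L2_inner (\<lambda>z. f z * z ^ m) (\<lambda>z. z ^ j) - c)"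
  have e: "\<epsilon> > 0" using ne by (simp add: \<epsilon>_def)
  \<comment> \<open>Balances the two terms of \<open>L2_inner_le\<close>: P / t is at most
    \<epsilon>, and t times a squared error below \<epsilon> / t is below \<epsilon>, against 2
    \<epsilon> on the left.\<close>
  define t where "t = (P + 1) / \<epsilon>"
  have t: "t > 0" using P0 e by (simp add: t_def)
  have Pt: "P / t \<le> \<epsilon>" using P0 e by (simp add: t_def field_simps)
  have "\<epsilon> / t > 0" using e t by simp
  from eventually_conj[OF order_tendstoD(2)[OF lim this] ev] obtain N where
    N: "(LINT z|disk_measure. (cmod (f z - S N z))\<^sup>2) < \<epsilon> / t"
      "(\<Sum>n = - int N..M. L2_inner (\<lambda>z. polar_term (F n) n z * z ^ m) (\<lambda>z. z ^ j)) = c"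
    by (auto simp: eventually_sequentially)
  have "L2_inner (\<lambda>z. S N z * z ^ m) (\<lambda>z. z ^ j) = L2_inner (\<lambda>z. \<Sum>n = - int N..M. 1 * (polar_term (F n) n z * z ^ m)) (\<lambda>z. z ^ j)"
    by (simp add: S_def sum_distrib_right)
  also have "\<dots> = (\<Sum>n = - int N..M. 1 * L2_inner (\<lambda>z. polar_term (F n) n z * z ^ m) (\<lambda>z. z ^ j))"
    by (rule L2_inner_sum_left) (auto intro: mono pL2 L2_monomial)
  finally have Sc: "L2_inner (\<lambda>z. S N z * z ^ m) (\<lambda>z. z ^ j) = c" using N(2) by simp
  let ?d = "\<lambda>z. (f z - S N z) * z ^ m"
  have dL2: "?d \<in> L2_disk" by (intro mono L2_diff f SL2)
  have "L2_inner ?d (\<lambda>z. z ^ j) = L2_inner (\<lambda>z. f z * z ^ m) (\<lambda>z. z ^ j) - c"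
    using L2_inner_diff_left[OF mono[OF f] mono[OF SL2] L2_monomial, of N j] Sc by (simp add: left_diff_distrib)
  then have "2 * \<epsilon> \<le> t * (LINT z|disk_measure. (cmod (?d z))\<^sup>2) + P / t"
    using L2_inner_le[OF dL2 L2_monomial t, of j] by (simp add: \<epsilon>_def P_def)
  moreover have "(LINT z|disk_measure. (cmod (?d z))\<^sup>2) \<le> (LINT z|disk_measure. (cmod (f z - S N z))\<^sup>2)"
  proof (rule Bochner_Integration.integral_mono[OF L2_sq_integrable[OF dL2] L2_sq_integrable[OF L2_diff[OF f SL2]]])
    fix z assume "z \<in> space disk_measure"
    then have "cmod z ^ m \<le> 1" by (intro power_le_one) auto
    then have "cmod (f z - S N z) * cmod z ^ m \<le> cmod (f z - S N z) * 1" by (rule mult_left_mono) simp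
    then show "(cmod (?d z))\<^sup>2 \<le> (cmod (f z - S N z))\<^sup>2"
      by (intro power_mono) (simp_all add: norm_mult norm_power)
  qed
  then have "t * (LINT z|disk_measure. (cmod (?d z))\<^sup>2) \<le> t * (LINT z|disk_measure. (cmod (f z - S N z))\<^sup>2)"
    using t by (intro mult_left_mono) auto
  moreover have "t * (LINT z|disk_measure. (cmod (f z - S N z))\<^sup>2) < \<epsilon>"
    using N(1) t by (simp add: less_divide_eq mult.commute)
  ultimately show False using Pt by linarith
qed

definition disk_poly :: "complex poly \<Rightarrow> complex \<Rightarrow> complex" where
  "disk_poly p z = (if z \<in> disk then poly p z else 0)"

text \<open>Only the frequency n = j - m contributes to the j-th moment of f z^m. As n \<le> M,
  moments beyond d = m + M vanish, and at \<open>d\<close> the top coefficient \<open>F M\<close>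
  contributes a multiple of its radial moment of order 2 m + M + 1.\<close>

lemma toeplitz_monomial:
  assumes f: "f \<in> L2_disk" and ex: "polar_expansion f F M" and nz: "\<forall>l>l0. radial_moment (F M) l \<noteq> 0"
    and d: "int m + M = int d" and m: "2 * int m + M + 1 > l0"
  obtains q u where "u \<in> toeplitz_domain f" "toeplitz f u = disk_poly q" "degree q = d" "coeff q d \<noteq> 0"
proof -
  define u where "u = disk_poly (monom 1 m)"
  have u: "u \<in> bergman_space"
  proof -
    have "u = (\<lambda>z. if z \<in> disk then z ^ m else 0)"
      by (rule ext) (simp add: u_def disk_poly_def poly_monom)
    then show ?thesis using truncated_monomial_bergman[of m] by (simp only:)
  qed
  let ?g = "\<lambda>z. f z * u z"
  have um: "u \<in> borel_measurable disk_measure" using L2_measurable[OF bergman_space_L2[OF u]] .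
  have g: "?g \<in> L2_disk"
    by (rule L2_bounded_mult[OF f um, of 1])
      (auto simp: u_def disk_poly_def poly_monom norm_power intro!: power_le_one)
  have mom: "disk_moment ?g j = L2_inner (\<lambda>z. f z * z ^ m) (\<lambda>z. z ^ j)" for j
    unfolding disk_moment_def by (rule L2_inner_cong) (auto simp: u_def disk_poly_def poly_monom)
  have high: "disk_moment ?g j = 0" if "j > d" for j
    unfolding mom
  proof (rule polar_expansion_inner[OF f ex], rule always_eventually, rule allI, rule sum.neutral, rule ballI)
    fix N n assume "n \<in> {- int N..M}"
    then show "L2_inner (\<lambda>z. polar_term (F n) n z * z ^ m) (\<lambda>z. z ^ j) = 0"
      using that d by (intro polar_term_inner_zero) auto
  qed
  have nzM: "radial_moment (F M) (2 * int m + M + 1) \<noteq> 0" using nz m by blast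
  have "disk_moment ?g d = 2 * pi * radial_moment (F M) (2 * int m + M + 1)"
    unfolding mom
  proof (rule polar_expansion_inner[OF f ex])
    \<comment> \<open>For M < 0 the range of summation contains \<open>M\<close> only once N \<ge> -
      M.\<close>
    have "(\<Sum>n = - int N..M. L2_inner (\<lambda>z. polar_term (F n) n z * z ^ m) (\<lambda>z. z ^ d)) = 2 * pi * radial_moment (F M) (2 * int m + M + 1)"
      if "N \<ge> nat (- M)" for N
    proof -
      have "(\<Sum>n = - int N..M. L2_inner (\<lambda>z. polar_term (F n) n z * z ^ m) (\<lambda>z. z ^ d)) =
          (\<Sum>n = - int N..M. if n = M then 2 * pi * radial_moment (F M) (2 * int m + M + 1) else 0)"
      proof (rule sum.cong[OF refl])
        fix n assume "n \<in> {- int N..M}"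
        show "L2_inner (\<lambda>z. polar_term (F n) n z * z ^ m) (\<lambda>z. z ^ d) =
            (if n = M then 2 * pi * radial_moment (F M) (2 * int m + M + 1) else 0)"
        proof (cases "n = M")
          case True
          have "polar_term (F M) M \<in> L2_disk" using ex by (simp add: polar_expansion_def)
          then show ?thesis using True polar_term_inner_moment[OF nzM _ , of d] d by simp
        next
          case False
          then show ?thesis using d by (simp add: polar_term_inner_zero)
        qed
      qed
      also have "\<dots> = 2 * pi * radial_moment (F M) (2 * int m + M + 1)"
        using that by (subst sum.delta) auto
      finally show ?thesis .
    qed
    then show "\<forall>\<^sub>F N in sequentially. (\<Sum>n = - int N..M. L2_inner (\<lambda>z. polar_term (F n) n z * z ^ m) (\<lambda>z. z ^ d)) =
        2 * pi * radial_moment (F M) (2 * int m + M + 1)"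
      by (auto simp: eventually_sequentially)
  qed
  then have lead: "disk_moment ?g d \<noteq> 0" using nzM by simp
  define q where "q = (\<Sum>j\<le>d. monom (projection_coeff ?g j) j)"
  have cq: "coeff q j = (if j \<le> d then projection_coeff ?g j else 0)" for j
    unfolding q_def by (simp add: coeff_sum sum.delta)
  have "projection_coeff ?g d \<noteq> 0"
  proof -
    have "(real d + 1) / pi \<noteq> 0" using pi_neq_zero by (simp add: add_nonneg_eq_0_iff)
    then show ?thesis using lead unfolding projection_coeff_def mult_eq_0_iff of_real_eq_0_iff by simp
  qed
  then have cd: "coeff q d \<noteq> 0" by (simp add: cq)
  have "degree q = d"
  proof (rule antisym)
    show "degree q \<le> d" by (rule degree_le) (simp add: cq)
    show "d \<le> degree q" by (rule le_degree[OF cd])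
  qed
  moreover have "toeplitz f u = disk_poly q"
  proof
    fix z
    have t: "toeplitz f u = projected ?g" unfolding toeplitz_def by (rule bergman_proj_eq[OF g])
    show "toeplitz f u z = disk_poly q z"
    proof (cases "z \<in> disk")
      case True
      have "(\<lambda>j. projection_coeff ?g j * z ^ j) sums (\<Sum>j\<le>d. projection_coeff ?g j * z ^ j)"
        by (rule sums_finite) (auto simp: projection_coeff_def high)
      then have "projected ?g z = (\<Sum>j\<le>d. projection_coeff ?g j * z ^ j)"
        using projected_sums[OF g True] sums_unique2 by blast
      then show ?thesis using True by (simp add: t disk_poly_def q_def poly_sum poly_monom)
    next
      case False
      then show ?thesis by (simp add: t disk_poly_def projected_def disk_kernel_def)
    qed
  qed
  moreover have "u \<in> toeplitz_domain f" using u g by (simp add: toeplitz_domain_def)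
  ultimately show ?thesis using cd that by blast
qed

section \<open>The operator of G on polynomials\<close>

lemma kernel_section_holomorphic:
  assumes z: "z \<in> disk"
  shows "(\<lambda>x. 1 / (of_real pi * (1 - z * x)\<^sup>2)) holomorphic_on disk"
proof -
  have "1 - z * x \<noteq> 0" if "x \<in> disk" for x
  proof
    assume "1 - z * x = 0"
    then have "cmod (z * x) = 1" by simp
    moreover have "cmod (z * x) < 1"
      using z that mult_strict_mono'[of "cmod z" 1 "cmod x" 1] by (simp add: norm_mult)
    ultimately show False by simp
  qed
  then show ?thesis by (intro holomorphic_intros) auto
qed

lemma toeplitz_distr_disk_poly:
  assumes G: "G \<in> compact_distributions" and z: "z \<in> disk"
  shows "toeplitz_distr G (disk_poly p) z = G (\<lambda>w. poly p w * (\<lambda>x. 1 / (of_real pi * (1 - z * x)\<^sup>2)) (cnj w))"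
proof -
  let ?\<phi> = "\<lambda>w. bergman_kernel z w * disk_poly p w" and ?\<psi> = "\<lambda>w. poly p w * (\<lambda>x. 1 / (of_real pi * (1 - z * x)\<^sup>2)) (cnj w)"
  have eq: "?\<phi> w = ?\<psi> w" if "w \<in> disk" for w
    using z that by (simp add: bergman_kernel_eq disk_kernel_def disk_poly_def)
  have \<psi>: "?\<psi> \<in> smooth_functions disk"
    by (rule smooth_pairing[OF holomorphic_poly kernel_section_holomorphic[OF z]])
  have \<phi>: "?\<phi> \<in> smooth_functions disk"
    by (rule iffD2[OF smooth_cong[of disk ?\<phi> ?\<psi>, OF open_ball eq] \<psi>])
  show ?thesis
    using z distribution_cong[OF G \<phi> \<psi> eq] by (simp add: toeplitz_distr_def)
qed

text \<open>Expanding the kernel in powers of \<open>cnj w\<close> under G shows that the Taylor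
  coefficients of the image of \<open>p\<close> are positive multiples of the pairings of
  \<open>p\<close> with monomials.\<close>

lemma toeplitz_distr_series:
  assumes G: "G \<in> compact_distributions" and z: "z \<in> disk"
  shows "(\<lambda>k. of_real ((real k + 1) / pi) * poly_pairing G p (monom 1 k) * z ^ k) sums toeplitz_distr G (disk_poly p) z"
proof -
  define \<kappa> where "\<kappa> = (\<lambda>x. 1 / (of_real pi * (1 - z * x)\<^sup>2))"
  define a where "a k = of_real ((real k + 1) / pi) * z ^ k" for k
  have z1: "cmod z < 1" using z by simp
  have \<kappa>: "\<kappa> holomorphic_on disk" unfolding \<kappa>_def by (rule kernel_section_holomorphic[OF z])
  have kn: "(\<lambda>x. \<Sum>k<n. a k * x ^ k) holomorphic_on disk" for n by (intro holomorphic_intros)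
  have lim: "uniform_limit (cball 0 r) (\<lambda>n x. \<Sum>k<n. a k * x ^ k) \<kappa> sequentially" if r: "0 < r" "r < 1" for r
  proof -
    have "uniform_limit (cball 0 r) (\<lambda>n x. \<Sum>k<n. a k * x ^ k) (\<lambda>x. suminf (\<lambda>k. a k * x ^ k)) sequentially"
    proof (rule Weierstrass_m_test)
      show "summable (\<lambda>k. (real (Suc k) * cmod z ^ k) / pi)"
        using geometric_deriv_sums[of "cmod z"] z1 by (intro summable_divide) (auto simp: sums_iff)
      fix k x assume x: "x \<in> cball (0::complex) r"
      have "cmod (a k * x ^ k) = (real (Suc k) * cmod z ^ k) / pi * cmod x ^ k"
        unfolding a_def norm_mult norm_power norm_of_real by simp
      also have "\<dots> \<le> (real (Suc k) * cmod z ^ k) / pi * 1"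
        using x r by (intro mult_left_mono power_le_one) auto
      finally show "cmod (a k * x ^ k) \<le> (real (Suc k) * cmod z ^ k) / pi" by simp
    qed
    moreover have "suminf (\<lambda>k. a k * x ^ k) = \<kappa> x" if "x \<in> cball 0 r" for x
    proof -
      have "cmod (z * x) < 1"
        using z1 that r mult_strict_mono'[of "cmod z" 1 "cmod x" 1] by (simp add: norm_mult)
      from sums_divide[OF geometric_deriv_sums[OF this], of "of_real pi"]
      have "(\<lambda>k. of_nat (Suc k) * (z * x) ^ k / of_real pi) sums (1 / (1 - z * x)\<^sup>2 / of_real pi)" .
      moreover have "of_nat (Suc k) * (z * x) ^ k / of_real pi = a k * x ^ k" for k
        by (simp add: a_def power_mult_distrib add.commute)
      ultimately have "(\<lambda>k. a k * x ^ k) sums (1 / (1 - z * x)\<^sup>2 / of_real pi)" by (simp only:)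
      from sums_unique[OF this] show ?thesis by (simp add: \<kappa>_def mult.commute)
    qed
    ultimately show ?thesis by (simp add: uniform_limit_iff Ball_def)
  qed
  have "(\<lambda>n. G (\<lambda>w. poly p w * (\<Sum>k<n. a k * cnj w ^ k))) \<longlonglongrightarrow> G (\<lambda>w. poly p w * \<kappa> (cnj w))"
    by (rule distribution_pairing_tendsto[OF G, where hn = "\<lambda>_. poly p" and kn = "\<lambda>n x. \<Sum>k<n. a k * x ^ k"])
      (simp_all add: holomorphic_poly kn \<kappa> lim uniform_limit_const)
  moreover have "G (\<lambda>w. poly p w * (\<Sum>k<n. a k * cnj w ^ k)) = (\<Sum>k<n. of_real ((real k + 1) / pi) * poly_pairing G p (monom 1 k) * z ^ k)" for n
  proof -
    have sm: "(\<lambda>w. poly p w * poly (monom 1 k) (cnj w)) \<in> smooth_functions disk" for k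
      by (intro smooth_pairing holomorphic_poly)
    have "G (\<lambda>w. poly p w * (\<Sum>k<n. a k * cnj w ^ k)) = G (\<lambda>w. \<Sum>k<n. a k * (poly p w * poly (monom 1 k) (cnj w)))"
      by (simp add: sum_distrib_left poly_monom mult_ac)
    also have "\<dots> = (\<Sum>k<n. G (\<lambda>w. a k * (poly p w * poly (monom 1 k) (cnj w))))"
      by (intro distribution_sum G smooth_cmult sm) auto
    also have "\<dots> = (\<Sum>k<n. a k * poly_pairing G p (monom 1 k))"
      unfolding poly_pairing_def by (intro sum.cong refl distribution_cmult G sm)
    finally show ?thesis by (simp only: a_def mult_ac)
  qed
  ultimately have "(\<lambda>n. \<Sum>k<n. of_real ((real k + 1) / pi) * poly_pairing G p (monom 1 k) * z ^ k) \<longlonglongrightarrow> G (\<lambda>w. poly p w * \<kappa> (cnj w))"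
    by (simp only:)
  then show ?thesis unfolding sums_def toeplitz_distr_disk_poly[OF G z] \<kappa>_def .
qed

lemma toeplitz_distr_disk_poly_linear:
  assumes G: "G \<in> compact_distributions"
  shows "toeplitz_distr G (disk_poly (p + q)) z = toeplitz_distr G (disk_poly p) z + toeplitz_distr G (disk_poly q) z"
    "toeplitz_distr G (disk_poly (Polynomial.smult c p)) z = c * toeplitz_distr G (disk_poly p) z"
proof -
  have sm: "(\<lambda>w. poly p w * (\<lambda>x. 1 / (of_real pi * (1 - z * x)\<^sup>2)) (cnj w)) \<in> smooth_functions disk" if "z \<in> disk" for p
    by (rule smooth_pairing[OF holomorphic_poly kernel_section_holomorphic[OF that]])
  show "toeplitz_distr G (disk_poly (p + q)) z = toeplitz_distr G (disk_poly p) z + toeplitz_distr G (disk_poly q) z"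
  proof (cases "z \<in> disk")
    case True
    show ?thesis unfolding toeplitz_distr_disk_poly[OF G True] distribution_add[OF G sm[OF True] sm[OF True], symmetric]
      by (simp add: distrib_right add_divide_distrib)
  qed (simp add: toeplitz_distr_def)
  show "toeplitz_distr G (disk_poly (Polynomial.smult c p)) z = c * toeplitz_distr G (disk_poly p) z"
  proof (cases "z \<in> disk")
    case True
    show ?thesis unfolding toeplitz_distr_disk_poly[OF G True] distribution_cmult[OF G sm[OF True], symmetric]
      by (simp add: mult.assoc)
  qed (simp add: toeplitz_distr_def)
qed

text \<open>Converts a vanishing image into a vanishing functional on all \<open>q\<close>: the
  Taylor coefficients give the monomials and linearity the rest.\<close>

lemma toeplitz_distr_kernel:
  assumes G: "G \<in> compact_distributions" and zero: "\<And>z. toeplitz_distr G (disk_poly p) z = 0"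
  shows "poly_pairing G p q = 0"
proof -
  have mono: "poly_pairing G p (monom 1 k) = 0" for k
  proof -
    have "of_real ((real k + 1) / pi) * poly_pairing G p (monom 1 k) = 0"
    proof (rule power_series_coeffs_zero)
      show "(\<lambda>k. of_real ((real k + 1) / pi) * poly_pairing G p (monom 1 k) * s ^ k) sums toeplitz_distr G (disk_poly p) s"
        if "cmod s < 1" for s
        by (rule toeplitz_distr_series[OF G]) (use that in simp)
    qed (simp add: zero)
    moreover have "(real k + 1) / pi \<noteq> 0" using pi_neq_zero by (simp add: add_nonneg_eq_0_iff)
    ultimately show ?thesis unfolding mult_eq_0_iff of_real_eq_0_iff by simp
  qed
  have "poly_pairing G p (q * monom 1 k) = 0" for k
  proof (induction q arbitrary: k)
    case 0
    then show ?case using poly_pairing_linear(4)[OF G, of p 0 0] by simp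
  next
    case (pCons a q)
    have "pCons a q * monom 1 k = Polynomial.smult a (monom 1 k) + q * monom 1 (Suc k)"
      by (simp add: monom_Suc)
    then show ?case by (simp add: poly_pairing_linear[OF G] mono pCons.IH)
  qed
  from this[of 0] show ?thesis by (simp add: monom_0)
qed


section \<open>A bound on the rank of the bilinear form\<close>

lemma span_finite_functions:
  assumes "finite B" "h \<in> complex_fun.span B"
  obtains k where "\<And>z. h z = (\<Sum>b\<in>B. k b * b z)"
proof -
  have sum_apply: "(\<Sum>b\<in>A. (\<lambda>z. k b * b z)) z = (\<Sum>b\<in>A. k b * b z)" if "finite A" for A :: "(complex \<Rightarrow> complex) set" and k z
    using that by (induction A rule: finite_induct) auto
  obtain k where "h = (\<Sum>b\<in>B. (\<lambda>z. k b * b z))"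
    using assms unfolding complex_fun.span_finite[OF assms(1)] by blast
  then show ?thesis using that sum_apply[OF assms(1)] by simp
qed

text \<open>Leading terms of degree at least \<open>d0\<close> are eliminated one by one with
  polynomials whose images lie in the span. Lowness is expressed by coefficients, not by
  \<open>degree\<close>, so that d0 = 0 forces the remainder to be 0.\<close>

lemma reduce_to_low_degree:
  assumes G: "G \<in> compact_distributions"
    and q: "\<And>d. d \<ge> d0 \<Longrightarrow> \<exists>q. degree q = d \<and> coeff q d \<noteq> 0 \<and> toeplitz_distr G (disk_poly q) \<in> complex_fun.span B"
  shows "\<exists>b low. b \<in> complex_fun.span B \<and> (\<forall>i\<ge>d0. coeff low i = 0) \<and>
    (\<forall>z. toeplitz_distr G (disk_poly p) z = b z + toeplitz_distr G (disk_poly low) z)"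
proof -
  have "\<exists>b low. b \<in> complex_fun.span B \<and> (\<forall>i\<ge>d0. coeff low i = 0) \<and>
    (\<forall>z. toeplitz_distr G (disk_poly p) z = b z + toeplitz_distr G (disk_poly low) z)"
    if "\<forall>i\<ge>D. coeff p i = 0" for D p
    using that
  proof (induction D arbitrary: p)
    case 0
    then show ?case
      by (intro exI[of _ "0 :: complex \<Rightarrow> complex"] exI[of _ p] conjI complex_fun.span_zero) auto
  next
    case (Suc D)
    show ?case
    proof (cases "D \<ge> d0")
      case False
      then show ?thesis using Suc.prems
        by (intro exI[of _ "0 :: complex \<Rightarrow> complex"] exI[of _ p] conjI complex_fun.span_zero) auto
    next
      case True
      obtain q where q: "degree q = D" "coeff q D \<noteq> 0" "toeplitz_distr G (disk_poly q) \<in> complex_fun.span B"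
        using q[OF True] by blast
      define c where "c = coeff p D / coeff q D"
      define p' where "p' = p + Polynomial.smult (- c) q"
      have "coeff p' i = 0" if "i \<ge> D" for i
      proof (cases "i = D")
        case True
        then show ?thesis using q by (simp add: p'_def c_def)
      next
        case False
        then have "i \<ge> Suc D" "degree q < i" using that q by auto
        then show ?thesis using Suc.prems by (simp add: p'_def coeff_eq_0)
      qed
      then obtain b low where bl: "b \<in> complex_fun.span B" "\<forall>i\<ge>d0. coeff low i = 0"
        "\<And>z. toeplitz_distr G (disk_poly p') z = b z + toeplitz_distr G (disk_poly low) z"
        using Suc.IH[of p'] by blast
      define b' where "b' = b + (\<lambda>z. c * toeplitz_distr G (disk_poly q) z)"
      have "b' \<in> complex_fun.span B"
        unfolding b'_def by (intro complex_fun.span_add bl complex_fun.span_scale q)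
      moreover have "toeplitz_distr G (disk_poly p) z = b' z + toeplitz_distr G (disk_poly low) z" for z
        using bl(3)[of z] unfolding p'_def toeplitz_distr_disk_poly_linear[OF G] b'_def by (simp add: algebra_simps)
      ultimately show ?thesis using bl(2) by blast
    qed
  qed
  from this[of "Suc (degree p)" p] show ?thesis by (simp add: coeff_eq_0)
qed

text \<open>Modulo the span, the image of each \<open>u i\<close> depends on \<open>d0\<close>
  coefficients. With more than card B + d0 of them, some nontrivial combination has image 0 and
  pairs to 0 with everything; pairing with \<open>v j\<close> returns its j-th coefficient.\<close>

lemma biorthogonal_bound:
  assumes G: "G \<in> compact_distributions" and B: "finite B"
    and q: "\<And>d. d \<ge> d0 \<Longrightarrow> \<exists>q. degree q = d \<and> coeff q d \<noteq> 0 \<and> toeplitz_distr G (disk_poly q) \<in> complex_fun.span B"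
    and uv: "\<And>i j. i < n \<Longrightarrow> j < n \<Longrightarrow> poly_pairing G (u i) (v j) = (if i = j then 1 else 0)"
  shows "n \<le> card B + d0"
proof (rule ccontr)
  assume "\<not> n \<le> card B + d0"
  then have n: "card B + d0 < n" by simp
  let ?T = "\<lambda>p. toeplitz_distr G (disk_poly p)"
  obtain b low where bl: "\<And>i. b i \<in> complex_fun.span B" "\<And>i j. j \<ge> d0 \<Longrightarrow> coeff (low i) j = 0"
    "\<And>i z. ?T (u i) z = b i z + ?T (low i) z"
  proof -
    have "\<forall>i. \<exists>x. fst x \<in> complex_fun.span B \<and> (\<forall>j\<ge>d0. coeff (snd x) j = 0) \<and>
        (\<forall>z. ?T (u i) z = fst x z + ?T (snd x) z)"
      using reduce_to_low_degree[OF G q] by simp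
    from choice[OF this] obtain x where "\<forall>i. fst (x i) \<in> complex_fun.span B \<and> (\<forall>j\<ge>d0. coeff (snd (x i)) j = 0) \<and>
        (\<forall>z. ?T (u i) z = fst (x i) z + ?T (snd (x i)) z)" by blast
    then show ?thesis by (intro that[of "\<lambda>i. fst (x i)" "\<lambda>i. snd (x i)"]) blast+
  qed
  have "\<forall>i. \<exists>k. \<forall>z. b i z = (\<Sum>\<beta>\<in>B. k \<beta> * \<beta> z)"
    using span_finite_functions[OF B bl(1)] by metis
  then obtain k where k: "\<And>i z. b i z = (\<Sum>\<beta>\<in>B. k i \<beta> * \<beta> z)" by metis
  \<comment> \<open>One equation for every element of \<open>B\<close> and one for every low
    coefficient; these are all the conditions for the image of the combination to vanish.\<close>
  define I where "I = B <+> {..<d0}"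
  have "card I < card {..<n}" using n B by (simp add: I_def card_Plus)
  then obtain c where c: "\<exists>j\<in>{..<n}. c j \<noteq> 0"
    "\<And>x. x \<in> I \<Longrightarrow> (\<Sum>j<n. c j * (case x of Inl \<beta> \<Rightarrow> k j \<beta> | Inr e \<Rightarrow> coeff (low j) e)) = 0"
    using homogeneous_system_nontrivial[of I "{..<n}" "\<lambda>x j. case x of Inl \<beta> \<Rightarrow> k j \<beta> | Inr e \<Rightarrow> coeff (low j) e"] B
    by (auto simp: I_def)
  have cB: "(\<Sum>j<n. c j * k j \<beta>) = 0" if "\<beta> \<in> B" for \<beta> using c(2)[of "Inl \<beta>"] that by (auto simp: I_def)
  have cL: "(\<Sum>j<n. c j * coeff (low j) e) = 0" for e
  proof (cases "e < d0")
    case True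
    then show ?thesis using c(2)[of "Inr e"] by (auto simp: I_def)
  qed (simp add: bl(2))
  have zero_T: "?T 0 z = 0" for z using toeplitz_distr_disk_poly_linear(2)[OF G, of 0 0 z] by simp
  have Tsum: "?T (\<Sum>j\<in>A. Polynomial.smult (c j) (w j)) z = (\<Sum>j\<in>A. c j * ?T (w j) z)" if "finite A" for A :: "nat set" and w z
    using that by (induction A rule: finite_induct) (auto simp: toeplitz_distr_disk_poly_linear[OF G] zero_T)
  define p where "p = (\<Sum>j<n. Polynomial.smult (c j) (u j))"
  have low0: "(\<Sum>j<n. Polynomial.smult (c j) (low j)) = 0"
    by (rule poly_eqI) (simp add: coeff_sum cL)
  have "?T p z = 0" for z
  proof -
    have "?T p z = (\<Sum>j<n. c j * b j z) + (\<Sum>j<n. c j * ?T (low j) z)"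
      unfolding p_def Tsum[OF finite_lessThan] by (simp add: bl(3) distrib_left sum.distrib)
    also have "(\<Sum>j<n. c j * ?T (low j) z) = 0"
      unfolding Tsum[OF finite_lessThan, symmetric] low0 by (rule zero_T)
    also have "(\<Sum>j<n. c j * b j z) = (\<Sum>j<n. \<Sum>\<beta>\<in>B. (c j * k j \<beta>) * \<beta> z)"
      by (simp add: k sum_distrib_left mult.assoc)
    also have "\<dots> = (\<Sum>\<beta>\<in>B. (\<Sum>j<n. c j * k j \<beta>) * \<beta> z)"
      by (subst sum.swap) (simp add: sum_distrib_right)
    also have "\<dots> = 0" by (simp add: cB)
    finally show ?thesis by simp
  qed
  then have pz: "poly_pairing G p q = 0" for q by (rule toeplitz_distr_kernel[OF G])
  obtain j where j: "j < n" "c j \<noteq> 0" using c(1) by auto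
  have zero_pp: "poly_pairing G 0 q = 0" for q using poly_pairing_linear(2)[OF G, of 0 0 q] by simp
  have psum: "poly_pairing G (\<Sum>i\<in>A. Polynomial.smult (c i) (u i)) q = (\<Sum>i\<in>A. c i * poly_pairing G (u i) q)" if "finite A" for A q
    using that by (induction A rule: finite_induct) (auto simp: poly_pairing_linear[OF G] zero_pp)
  have "0 = (\<Sum>i<n. c i * poly_pairing G (u i) (v j))"
    using pz[of "v j"] unfolding p_def psum[OF finite_lessThan] by simp
  also have "\<dots> = (\<Sum>i<n. if i = j then c j else 0)" using uv j by (intro sum.cong) auto
  also have "\<dots> = c j" using j by simp
  finally show False using j by simp
qed

section \<open>The case of a regular distribution\<close>

lemma continuous_sgn_approx:
  fixes h :: "complex \<Rightarrow> complex"
  assumes h: "h \<in> borel_measurable disk_measure"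
  obtains g where "\<And>n. continuous_on UNIV (g n)" "\<And>(n::nat) z. cmod (g n z) \<le> 1"
    "AE z in disk_measure. (\<lambda>n. g n z) \<longlonglongrightarrow> cnj (sgn (h z))"
proof -
  have "(\<lambda>z. cnj (sgn (h z))) \<in> borel_measurable disk_measure"
  proof -
    have [measurable]: "cnj \<in> borel_measurable borel"
      by (intro borel_measurable_continuous_onI continuous_intros)
    have "(\<lambda>z. cnj (h z /\<^sub>R cmod (h z))) \<in> borel_measurable disk_measure"
      using h by measurable
    then show ?thesis by (simp add: sgn_div_norm)
  qed
  then have "(\<lambda>z. cnj (sgn (h z))) measurable_on disk"
    by (subst measurable_on_iff_borel_measurable) auto
  then obtain N g where N: "negligible N" and g: "\<And>n. continuous_on UNIV (g n)"
    and lim: "\<And>z. z \<notin> N \<Longrightarrow> (\<lambda>n. g n z) \<longlonglongrightarrow> (if z \<in> disk then cnj (sgn (h z)) else 0)"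
    unfolding measurable_on_def by blast
  \<comment> \<open>The radial retraction onto the closed unit disk. It bounds the approximants by
    1, as dominated convergence requires, and fixes the limit, whose modulus is at most 1.\<close>
  define T where "T w = w / of_real (max 1 (cmod w))" for w :: complex
  have T1: "cmod (T w) \<le> 1" for w by (auto simp: T_def norm_divide divide_le_eq)
  have Tc: "continuous_on UNIV T" unfolding T_def by (intro continuous_intros) auto
  show ?thesis
  proof (rule that[of "\<lambda>n z. T (g n z)"])
    show "continuous_on UNIV (\<lambda>z. T (g n z))" for n
      by (rule continuous_on_compose2[OF Tc g]) simp
    show "cmod (T (g n z)) \<le> 1" for n z by (rule T1)
    have ae: "AE z in lebesgue. z \<notin> N"
      using N by (intro AE_not_in) (simp add: negligible_iff_null_sets)
    have "(\<lambda>n. T (g n z)) \<longlonglongrightarrow> cnj (sgn (h z))" if "z \<notin> N" "z \<in> disk" for z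
    proof -
      have "(\<lambda>n. T (g n z)) \<longlonglongrightarrow> T (cnj (sgn (h z)))"
        using lim[OF that(1)] that(2) Tc
        by (intro isCont_tendsto_compose[of _ T]) (auto simp: continuous_on_eq_continuous_at)
      moreover have "T (cnj (sgn (h z))) = cnj (sgn (h z))" by (simp add: T_def norm_sgn)
      ultimately show ?thesis by simp
    qed
    then show "AE z in disk_measure. (\<lambda>n. T (g n z)) \<longlonglongrightarrow> cnj (sgn (h z))"
      using ae by (subst AE_restrict_space_iff) (auto elim!: eventually_mono)
  qed
qed

text \<open>The Weierstrass theorem extends the hypothesis to continuous test functions; bounded
  continuous approximants of cnj (sgn h) then show that the integral of |h| is 0.\<close>

lemma AE_zero_of_xy_poly:
  assumes h: "integrable disk_measure h" and zero: "\<And>xs. (LINT z|disk_measure. h z * xy_poly xs z) = 0"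
  shows "AE z in disk_measure. h z = 0"
proof -
  define H where "H = (LINT z|disk_measure. cmod (h z))"
  have H0: "H \<ge> 0" unfolding H_def by (rule Bochner_Integration.integral_nonneg) simp
  have hm: "h \<in> borel_measurable disk_measure" using h by (rule borel_measurable_integrable)
  have bdint: "integrable disk_measure (\<lambda>z. h z * \<phi> z)"
    if "\<phi> \<in> borel_measurable disk_measure" "\<And>z. z \<in> disk \<Longrightarrow> cmod (\<phi> z) \<le> B" for \<phi> B
  proof (rule Bochner_Integration.integrable_bound)
    show "integrable disk_measure (\<lambda>z. B * cmod (h z))" by (intro integrable_mult_right integrable_norm h)
    show "(\<lambda>z. h z * \<phi> z) \<in> borel_measurable disk_measure" using hm that(1) by measurable
    have "cmod (h z * \<phi> z) \<le> norm (B * cmod (h z))" if "z \<in> disk" for z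
    proof -
      have "cmod (h z) * cmod (\<phi> z) \<le> cmod (h z) * \<bar>B\<bar>"
        using \<open>\<And>z. z \<in> disk \<Longrightarrow> cmod (\<phi> z) \<le> B\<close>[OF that] by (intro mult_left_mono) auto
      then show ?thesis by (simp add: norm_mult abs_mult mult.commute)
    qed
    then show "AE z in disk_measure. cmod (h z * \<phi> z) \<le> norm (B * cmod (h z))"
      by (subst AE_restrict_space_iff) auto
  qed
  have cont: "(LINT z|disk_measure. h z * \<phi> z) = 0" if c: "continuous_on UNIV \<phi>" for \<phi>
  proof (rule ccontr)
    assume ne: "(LINT z|disk_measure. h z * \<phi> z) \<noteq> 0"
    define e where "e = cmod (LINT z|disk_measure. h z * \<phi> z) / (H + 1)"
    have e: "e > 0" using ne H0 by (simp add: e_def)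
    obtain xs where xs: "\<And>z. z \<in> cball 0 1 \<Longrightarrow> cmod (\<phi> z - xy_poly xs z) < e"
      using xy_poly_uniform_approx[of "cball 0 1" \<phi> e] e continuous_on_subset[OF c] by (metis compact_cball subset_UNIV)
    have xyc: "continuous_on UNIV (xy_poly xs)" using smooth_continuous[OF smooth_xy_poly] .
    have meas: "\<psi> \<in> borel_measurable disk_measure" if "continuous_on UNIV \<psi>" for \<psi> :: "complex \<Rightarrow> complex"
      by (rule measurable_disk_continuous[OF continuous_on_subset[OF that]]) simp
    have bdd: "\<exists>B. \<forall>z\<in>disk. cmod (\<psi> z) \<le> B" if "continuous_on UNIV \<psi>" for \<psi> :: "complex \<Rightarrow> complex"
    proof -
      have "bounded (\<psi> ` cball 0 1)"
        by (intro compact_imp_bounded compact_continuous_image compact_cball continuous_on_subset[OF that]) simp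
      then obtain B where "\<forall>z\<in>cball 0 1. cmod (\<psi> z) \<le> B" by (auto simp: bounded_iff)
      then show ?thesis by (intro exI[of _ B]) auto
    qed
    have i1: "integrable disk_measure (\<lambda>z. h z * \<phi> z)" using bdint[OF meas[OF c]] bdd[OF c] by blast
    have i2: "integrable disk_measure (\<lambda>z. h z * xy_poly xs z)" using bdint[OF meas[OF xyc]] bdd[OF xyc] by blast
    have "(LINT z|disk_measure. h z * \<phi> z) = (LINT z|disk_measure. h z * \<phi> z - h z * xy_poly xs z)"
      using Bochner_Integration.integral_diff[OF i1 i2] zero by simp
    also have "cmod \<dots> \<le> (LINT z|disk_measure. e * cmod (h z))"
    proof (rule Bochner_Integration.integral_norm_bound_integral)
      show "integrable disk_measure (\<lambda>z. h z * \<phi> z - h z * xy_poly xs z)"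
        by (rule Bochner_Integration.integrable_diff[OF i1 i2])
      show "integrable disk_measure (\<lambda>z. e * cmod (h z))" by (intro integrable_mult_right integrable_norm h)
      fix z assume "z \<in> space disk_measure"
      then have "cmod (\<phi> z - xy_poly xs z) \<le> e" using xs[of z] by (simp add: less_imp_le)
      then have "cmod (h z) * cmod (\<phi> z - xy_poly xs z) \<le> cmod (h z) * e" by (rule mult_left_mono) simp
      then show "cmod (h z * \<phi> z - h z * xy_poly xs z) \<le> e * cmod (h z)"
        unfolding right_diff_distrib[symmetric] norm_mult by (simp add: mult.commute)
    qed
    also have "\<dots> = e * H" by (simp add: H_def)
    also have "\<dots> < e * (H + 1)" using e by simp
    also have "\<dots> = cmod (LINT z|disk_measure. h z * \<phi> z)" using H0 by (simp add: e_def)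
    finally show False by simp
  qed
  obtain g where g: "\<And>n. continuous_on UNIV (g n)" "\<And>n z. cmod (g n z) \<le> 1"
    "AE z in disk_measure. (\<lambda>n. g n z) \<longlonglongrightarrow> cnj (sgn (h z))"
    using continuous_sgn_approx[OF hm] by blast
  have hs: "h z * cnj (sgn (h z)) = of_real (cmod (h z))" for z
  proof (cases "h z = 0")
    case False
    have "h z * cnj (sgn (h z)) = (h z * cnj (h z)) / of_real (cmod (h z))"
      by (simp add: sgn_div_norm scaleR_conv_of_real field_simps)
    also have "\<dots> = of_real (cmod (h z))"
      using False by (simp add: complex_norm_square[symmetric] power2_eq_square)
    finally show ?thesis .
  qed simp
  have "(\<lambda>n. LINT z|disk_measure. h z * g n z) \<longlonglongrightarrow> (LINT z|disk_measure. of_real (cmod (h z)) :: complex)"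
  proof (rule integral_dominated_convergence[where w = "\<lambda>z. cmod (h z)"])
    show "(\<lambda>z. of_real (cmod (h z)) :: complex) \<in> borel_measurable disk_measure" using hm by measurable
    show "(\<lambda>z. h z * g n z) \<in> borel_measurable disk_measure" for n
      by (rule borel_measurable_times[OF hm measurable_disk_continuous[OF continuous_on_subset[OF g(1)]]]) simp
    show "integrable disk_measure (\<lambda>z. cmod (h z))" by (rule integrable_norm[OF h])
    show "AE z in disk_measure. (\<lambda>n. h z * g n z) \<longlonglongrightarrow> of_real (cmod (h z))"
      using g(3)
    proof eventually_elim
      case (elim z)
      from tendsto_mult_left[OF elim, of "h z"] show ?case by (simp add: hs)
    qed
    have "cmod (h z) * cmod (g n z) \<le> cmod (h z) * 1" for n z by (intro mult_left_mono g(2)) simp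
    then show "AE z in disk_measure. cmod (h z * g n z) \<le> cmod (h z)" for n by (simp add: norm_mult)
  qed
  moreover have "(LINT z|disk_measure. h z * g n z) = 0" for n by (rule cont[OF g(1)])
  ultimately have "(LINT z|disk_measure. of_real (cmod (h z)) :: complex) = 0"
    by (simp add: LIMSEQ_const_iff)
  then have "(LINT z|disk_measure. cmod (h z)) = 0"
    unfolding integral_complex_of_real by simp
  then have "AE z in disk_measure. cmod (h z) = 0"
    using integral_nonneg_eq_0_iff_AE[OF integrable_norm[OF h]] by simp
  then show ?thesis by simp
qed

text \<open>The function g Q integrates to 0 against every polynomial in the real coordinates, so it
  vanishes almost everywhere; the zeros of \<open>Q\<close> form a finite, hence null, set.\<close>

lemma regular_annihilator_zero:
  assumes G: "G \<in> compact_distributions" and Q: "Q \<noteq> 0" and ann: "\<And>p q. poly_pairing G (Q * p) q = 0"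
    and g: "is_regular_distr G g"
  shows "AE z in disk_measure. g z = 0"
proof -
  have gi: "integrable disk_measure g" and rep: "\<And>\<phi>. \<phi> \<in> smooth_functions disk \<Longrightarrow> G \<phi> = (LINT z|disk_measure. g z * \<phi> z)"
    using g unfolding is_regular_distr_def by blast+
  have "bounded (poly Q ` cball 0 1)"
    by (intro compact_imp_bounded compact_continuous_image compact_cball) (auto intro: continuous_intros)
  then obtain B where B: "\<forall>z\<in>cball 0 1. cmod (poly Q z) \<le> B" by (auto simp: bounded_iff)
  have gm: "g \<in> borel_measurable disk_measure" using gi by (rule borel_measurable_integrable)
  have Qm: "poly Q \<in> borel_measurable disk_measure" by (rule measurable_disk_continuous) (auto intro: continuous_intros)
  have int: "integrable disk_measure (\<lambda>z. g z * poly Q z)"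
  proof (rule Bochner_Integration.integrable_bound)
    show "integrable disk_measure (\<lambda>z. B * cmod (g z))" by (intro integrable_mult_right integrable_norm gi)
    show "(\<lambda>z. g z * poly Q z) \<in> borel_measurable disk_measure" using gm Qm by measurable
    have "cmod (g z * poly Q z) \<le> norm (B * cmod (g z))" if "z \<in> disk" for z
    proof -
      have "cmod (poly Q z) \<le> B" using B that by simp
      then have "cmod (g z) * cmod (poly Q z) \<le> cmod (g z) * \<bar>B\<bar>" by (intro mult_left_mono) auto
      then show ?thesis by (simp add: norm_mult abs_mult mult.commute)
    qed
    then show "AE z in disk_measure. cmod (g z * poly Q z) \<le> norm (B * cmod (g z))"
      by (subst AE_restrict_space_iff) auto
  qed
  have "(LINT z|disk_measure. (g z * poly Q z) * xy_poly xs z) = 0" for xs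
  proof -
    have "(\<lambda>z. poly Q z * xy_poly xs z) \<in> smooth_functions disk"
      by (intro smooth_mult smooth_holomorphic holomorphic_poly smooth_xy_poly) auto
    from rep[OF this] annihilates_xy_poly[OF G ann] show ?thesis by (simp add: mult.assoc)
  qed
  from AE_zero_of_xy_poly[OF int this] have "AE z in disk_measure. g z * poly Q z = 0" .
  moreover have "AE z in disk_measure. poly Q z \<noteq> 0"
  proof -
    have "{z. poly Q z = 0} \<in> null_sets lborel" by (rule finite_imp_null_set_lborel[OF poly_roots_finite[OF Q]])
    from AE_completion[OF AE_not_in[OF this]] show ?thesis
      by (subst AE_restrict_space_iff) (auto elim!: eventually_mono)
  qed
  ultimately show ?thesis by eventually_elim simp
qed

theorem theorem5p4:
  fixes f :: "complex \<Rightarrow> complex"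
    and F :: "int \<Rightarrow> real \<Rightarrow> complex"
    and M l0 :: int
    and G :: "(complex \<Rightarrow> complex) \<Rightarrow> complex"
  assumes "f \<in> L2_disk"
    and "polar_expansion f F M"
    and "\<forall>l>l0. radial_moment (F M) l \<noteq> 0"
    and "G \<in> compact_distributions"
    and "finite_rank_on (toeplitz_domain f) (toeplitz_distr G \<circ> toeplitz f)"
  shows "finite (distr_support G) \<and>
    (\<forall>g. is_regular_distr G g \<longrightarrow> (AE z in disk_measure. g z = 0))"
proof -
  obtain B where B: "finite B" "(toeplitz_distr G \<circ> toeplitz f) ` toeplitz_domain f \<subseteq> complex_fun.span B"
    using assms(5) unfolding finite_rank_on_def by blast
  \<comment> \<open>Large enough that m = d - M is nonnegative and 2 m + M + 1 = 2 d - M + 1 exceeds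
    \<open>l0\<close> for every d \<ge> d0.\<close>
  define d0 where "d0 = nat (\<bar>M\<bar> + \<bar>l0\<bar>)"
  have q: "\<exists>q. degree q = d \<and> coeff q d \<noteq> 0 \<and> toeplitz_distr G (disk_poly q) \<in> complex_fun.span B"
    if "d \<ge> d0" for d
  proof -
    define m where "m = nat (int d - M)"
    have dM: "int m + M = int d" using that by (auto simp: m_def d0_def)
    have "2 * int m + M + 1 > l0" using that dM by (auto simp: d0_def)
    from toeplitz_monomial[OF assms(1-3) dM this] obtain q u where
      q: "u \<in> toeplitz_domain f" "toeplitz f u = disk_poly q" "degree q = d" "coeff q d \<noteq> 0" by blast
    have "(toeplitz_distr G \<circ> toeplitz f) u \<in> complex_fun.span B" using B(2) q(1) by blast
    with q show ?thesis by auto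
  qed
  obtain Q where Q: "Q \<noteq> 0" "\<And>p q. poly_pairing G (Q * p) q = 0"
  proof (rule finite_rank_annihilator[OF assms(4), where R = "card B + d0"])
    fix n :: nat and u v
    assume uv: "\<And>i j. i < n \<Longrightarrow> j < n \<Longrightarrow> poly_pairing G (u i) (v j) = (if i = j then 1 else 0)"
    show "n \<le> card B + d0" by (rule biorthogonal_bound[OF assms(4) B(1) q uv])
  qed blast
  then show ?thesis
    using finite_support_of_annihilator[OF assms(4) Q] regular_annihilator_zero[OF assms(4) Q] by blast
qed

end
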